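(* Let $k$ be an algebraically closed field of characteristic two. Every non-degenerate non-$F$-pure cubic form in three variables over $k$ is projectively equivalent to a plane curve in $\mathbb P^2$ defined by one of the following: (1) $x^3+ y^3+z^3$; (2) $x^2z + y^3$; (3) $x^2z + xy^2$. The first is, up to projective equivalence, the only non-$F$-pure smooth cubic curve: every supersingular elliptic curve (smooth plane cubic) over $k$ is projectively equivalent to this Fermat curve. The second is an irreducible cuspidal cubic curve with one singular point, at $[0:0:1]$. The third is a union of a smooth conic and a line tangent to it at one point, namely $[0:0:1]$.
   Context: A form in $n$ variables is non-degenerate if it cannot be written as a form in fewer than $n$ variables after a linear change of coordinates. A cubic form $f\in k[x,y,z]$ (or the plane curve it defines) is $F$-pure if the ring $R=k[x,y,z]/\langle f\rangle$ is $F$-pure, that is, its Frobenius map $R\to R$, $r\mapsto r^p$ (here $p=2$), is pure (it stays injective after tensoring with any $R$-module). Projectively equivalent means equivalent under an invertible linear change of coordinates (up to scaling the equation). *)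

theory Defs
  imports
    "HOL-Analysis.Cartesian_Space"
    "HOL-Library.Poly_Mapping"
    "HOL-Library.Extended_Nat"
    "HOL-Library.Multiset"
    "HOL-Algebra.Algebraic_Closure_Type"
    "HOL-Algebra.Free_Abelian_Groups"
begin

section \<open>Polynomials in finitely many variables\<close>

text \<open>
  Variables are indexed by a finite type \<open>'v\<close>. A monomial is an exponent vector, and a polynomial
  is a finitely supported function from monomials to coefficients; its ring structure is that of
  \<^theory>\<open>HOL-Library.Poly_Mapping\<close>.
\<close>

type_synonym ('v, 'a) mpoly = "('v \<Rightarrow>\<^sub>0 nat) \<Rightarrow>\<^sub>0 'a"

definition Const :: "'a \<Rightarrow> ('v, 'a::comm_ring_1) mpoly" where
  "Const c = Poly_Mapping.single 0 c"

definition Var :: "'v \<Rightarrow> ('v, 'a::comm_ring_1) mpoly" where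
  "Var i = Poly_Mapping.single (Poly_Mapping.single i 1) 1"

definition mono_degree :: "('v::finite \<Rightarrow>\<^sub>0 nat) \<Rightarrow> nat" where
  "mono_degree m = (\<Sum>i\<in>UNIV. Poly_Mapping.lookup m i)"

text \<open>
  The value of a polynomial when coefficients are mapped along \<open>h\<close> and the variable \<open>i\<close> is
  replaced by \<open>\<sigma> i\<close>.
\<close>

definition insertion :: "('a \<Rightarrow> 'b) \<Rightarrow> ('v::finite \<Rightarrow> 'b) \<Rightarrow> ('v, 'a::zero) mpoly \<Rightarrow> 'b::comm_ring_1"
  where
  "insertion h \<sigma> p =
     (\<Sum>m\<in>Poly_Mapping.keys p. h (Poly_Mapping.lookup p m) * (\<Prod>i\<in>UNIV. \<sigma> i ^ Poly_Mapping.lookup m i))"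

definition eval :: "('v::finite, 'a::comm_ring_1) mpoly \<Rightarrow> 'a ^ 'v \<Rightarrow> 'a" where
  "eval p v = insertion (\<lambda>c. c) (\<lambda>i. v $ i) p"

definition partial :: "'v \<Rightarrow> ('v::finite, 'a::comm_ring_1) mpoly \<Rightarrow> ('v, 'a) mpoly" where
  "partial i p = (\<Sum>m\<in>Poly_Mapping.keys p. Poly_Mapping.single (m - Poly_Mapping.single i 1)
      (of_nat (Poly_Mapping.lookup m i) * Poly_Mapping.lookup p m))"

definition form :: "nat \<Rightarrow> ('v::finite, 'a::comm_ring_1) mpoly \<Rightarrow> bool" where
  "form d p \<longleftrightarrow> (\<forall>m\<in>Poly_Mapping.keys p. mono_degree m = d)"

definition hom_part :: "nat \<Rightarrow> ('v::finite, 'a::comm_ring_1) mpoly \<Rightarrow> ('v, 'a) mpoly" where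
  "hom_part d p = (\<Sum>m\<in>{m \<in> Poly_Mapping.keys p. mono_degree m = d}.
      Poly_Mapping.single m (Poly_Mapping.lookup p m))"

definition vars :: "('v, 'a::comm_ring_1) mpoly \<Rightarrow> 'v set" where
  "vars p = (\<Union>m\<in>Poly_Mapping.keys p. Poly_Mapping.keys m)"


section \<open>Linear changes of coordinates\<close>

definition lin_subst :: "'a ^ 'v ^ 'v \<Rightarrow> ('v::finite, 'a::comm_ring_1) mpoly \<Rightarrow> ('v, 'a) mpoly" where
  "lin_subst A p = insertion Const (\<lambda>i. \<Sum>j\<in>UNIV. Const (A $ i $ j) * Var j) p"

definition nondegenerate :: "('v::finite, 'a::comm_ring_1) mpoly \<Rightarrow> bool" where
  "nondegenerate p \<longleftrightarrow> \<not> (\<exists>A. invertible A \<and> card (vars (lin_subst A p)) < CARD('v))"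

definition proj_equiv :: "('v::finite, 'a::field) mpoly \<Rightarrow> ('v, 'a) mpoly \<Rightarrow> bool" where
  "proj_equiv p q \<longleftrightarrow> (\<exists>A c. invertible A \<and> c \<noteq> 0 \<and> q = Const c * lin_subst A p)"


section \<open>Purity of the Frobenius map\<close>

text \<open>
  The tensor product of two modules is the free abelian group on pairs of elements modulo the
  subgroup generated by the usual bilinear relations. Only its underlying abelian group is
  needed to speak about injectivity.
\<close>

definition tensor_relations ::
  "('r, 'c) ring_scheme \<Rightarrow> ('r, 'n, 'd) module_scheme \<Rightarrow> ('r, 'm, 'e) module_scheme
    \<Rightarrow> ('n \<times> 'm \<Rightarrow>\<^sub>0 int) set" where
  "tensor_relations R N M =
     {frag_of (a \<oplus>\<^bsub>N\<^esub> b, x) - frag_of (a, x) - frag_of (b, x) | a b x.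
        a \<in> carrier N \<and> b \<in> carrier N \<and> x \<in> carrier M}
   \<union> {frag_of (a, x \<oplus>\<^bsub>M\<^esub> y) - frag_of (a, x) - frag_of (a, y) | a x y.
        a \<in> carrier N \<and> x \<in> carrier M \<and> y \<in> carrier M}
   \<union> {frag_of (r \<odot>\<^bsub>N\<^esub> a, x) - frag_of (a, r \<odot>\<^bsub>M\<^esub> x) | r a x.
        r \<in> carrier R \<and> a \<in> carrier N \<and> x \<in> carrier M}"

definition tensor_kernel ::
  "('r, 'c) ring_scheme \<Rightarrow> ('r, 'n, 'd) module_scheme \<Rightarrow> ('r, 'm, 'e) module_scheme
    \<Rightarrow> ('n \<times> 'm \<Rightarrow>\<^sub>0 int) set" where
  "tensor_kernel R N M =
     generate (free_Abelian_group (carrier N \<times> carrier M)) (tensor_relations R N M)"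

definition tensor ::
  "('r, 'c) ring_scheme \<Rightarrow> ('r, 'n, 'd) module_scheme \<Rightarrow> ('r, 'm, 'e) module_scheme
    \<Rightarrow> ('n \<times> 'm \<Rightarrow>\<^sub>0 int) set monoid" where
  "tensor R N M = free_Abelian_group (carrier N \<times> carrier M) Mod tensor_kernel R N M"

text \<open>
  The map from \<open>tensor R N M\<close> to \<open>tensor R N' M\<close> induced by an \<open>R\<close>-linear map \<open>h\<close> from \<open>N\<close> to
  \<open>N'\<close>: the class of \<open>\<Sum> k\<^sub>j (a\<^sub>j, x\<^sub>j)\<close> goes to the class of \<open>\<Sum> k\<^sub>j (h a\<^sub>j, x\<^sub>j)\<close>. The union runs over
  all representatives of a class and, for linear \<open>h\<close>, is a single coset.
\<close>

definition tensor_map ::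
  "('r, 'c) ring_scheme \<Rightarrow> ('r, 'n, 'd) module_scheme \<Rightarrow> ('r, 'm, 'e) module_scheme
    \<Rightarrow> ('k \<Rightarrow> 'n) \<Rightarrow> ('k \<times> 'm \<Rightarrow>\<^sub>0 int) set \<Rightarrow> ('n \<times> 'm \<Rightarrow>\<^sub>0 int) set" where
  "tensor_map R N' M h C =
     (\<Union>u\<in>C. tensor_kernel R N' M #>\<^bsub>free_Abelian_group (carrier N' \<times> carrier M)\<^esub>
                frag_extend (\<lambda>(a, x). frag_of (h a, x)) u)"

text \<open>
  An \<open>R\<close>-linear map is pure if it stays injective after tensoring with any \<open>R\<close>-module. A definition
  in HOL cannot quantify over types, so the type \<open>'m\<close> of elements of the test modules is a
  parameter. A failure of purity is witnessed over some type: a hypothesis \<open>\<not> pure_linear TYPE('m) \<dots>\<close>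
  with \<open>'m\<close> a type variable says that the map is not pure, whatever type the witnessing module
  lives on, and a conclusion \<open>\<not> pure_linear TYPE(t) \<dots>\<close> at a concrete type \<open>t\<close> implies that it is
  not pure.
\<close>

definition pure_linear ::
  "'m itself \<Rightarrow> ('r, 'c) ring_scheme \<Rightarrow> ('r, 'k, 'd) module_scheme \<Rightarrow> ('r, 'n, 'e) module_scheme
    \<Rightarrow> ('k \<Rightarrow> 'n) \<Rightarrow> bool" where
  "pure_linear _ R N N' h \<longleftrightarrow>
     (\<forall>M :: ('r, 'm) module. Module.module R M \<longrightarrow>
        inj_on (tensor_map R N' M h) (carrier (tensor R N M)))"

definition regular_module :: "('r, 'c) ring_scheme \<Rightarrow> ('r, 'r) module" where
  "regular_module R = \<lparr>carrier = carrier R, monoid.mult = monoid.mult R, one = \<one>\<^bsub>R\<^esub>,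
     ring.zero = \<zero>\<^bsub>R\<^esub>, add = add R, module.smult = (\<lambda>r s. r \<otimes>\<^bsub>R\<^esub> s)\<rparr>"

text \<open>The target of the Frobenius map: \<open>R\<close> with \<open>r\<close> acting as multiplication by \<open>r\<^sup>p\<close>.\<close>

definition frobenius_module :: "nat \<Rightarrow> ('r, 'c) ring_scheme \<Rightarrow> ('r, 'r) module" where
  "frobenius_module p R = (regular_module R)\<lparr>module.smult := (\<lambda>r s. (r [^]\<^bsub>R\<^esub> p) \<otimes>\<^bsub>R\<^esub> s)\<rparr>"

definition F_pure_ring :: "'m itself \<Rightarrow> nat \<Rightarrow> ('r, 'c) ring_scheme \<Rightarrow> bool" where
  "F_pure_ring T p R \<longleftrightarrow>
     pure_linear T R (regular_module R) (frobenius_module p R) (\<lambda>r. r [^]\<^bsub>R\<^esub> p)"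

definition coord_ring :: "('v, 'a::comm_ring_1) mpoly \<Rightarrow> ('v, 'a) mpoly set ring" where
  "coord_ring f = ring_of_type_algebra Quot (Idl\<^bsub>ring_of_type_algebra\<^esub> {f})"

definition F_pure :: "'m itself \<Rightarrow> ('v, 'a::comm_ring_1) mpoly \<Rightarrow> bool" where
  "F_pure T f \<longleftrightarrow> F_pure_ring T CHAR('a) (coord_ring f)"


section \<open>Plane curves\<close>

type_synonym 'a ternary = "(3, 'a) mpoly"

text \<open>
  The literals of the index type \<open>3\<close> are \<open>1\<close>, \<open>2\<close>, \<open>3\<close> (with \<open>3 = 0\<close>), matching the components of
  \<^term>\<open>vector [a, b, c] :: 'a::zero ^ 3\<close>.
\<close>

abbreviation vx :: "'a::comm_ring_1 ternary" where "vx \<equiv> Var 1"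
abbreviation vy :: "'a::comm_ring_1 ternary" where "vy \<equiv> Var 2"
abbreviation vz :: "'a::comm_ring_1 ternary" where "vz \<equiv> Var 3"

text \<open>Points of the projective plane are classes of nonzero vectors up to scaling.\<close>

definition proj_pt :: "'a::field ^ 3 \<Rightarrow> ('a ^ 3) set" where
  "proj_pt v = {c *s v | c. c \<noteq> 0}"

definition curve :: "'a::field ternary \<Rightarrow> ('a ^ 3) set set" where
  "curve f = {proj_pt v | v. v \<noteq> 0 \<and> eval f v = 0}"

definition singular_points :: "'a::field ternary \<Rightarrow> ('a ^ 3) set set" where
  "singular_points f = {proj_pt v | v. v \<noteq> 0 \<and> eval f v = 0 \<and> (\<forall>i. eval (partial i f) v = 0)}"

definition smooth :: "'a::field ternary \<Rightarrow> bool" where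
  "smooth f \<longleftrightarrow> singular_points f = {}"

definition linear_form :: "'a::field ternary \<Rightarrow> bool" where
  "linear_form l \<longleftrightarrow> form 1 l \<and> l \<noteq> 0"

text \<open>
  The intersection multiplicity at \<open>P\<close> of \<open>f\<close> with a line \<open>l\<close> through \<open>P\<close>: for \<open>P = [v]\<close> and another
  point \<open>[w]\<close> of the line, it is the order of vanishing at \<open>t = 0\<close> of \<open>f(v + t w)\<close>, and infinite if
  the line is a component of \<open>f\<close>.
\<close>

definition line_restrict :: "'a::field ternary \<Rightarrow> 'a ^ 3 \<Rightarrow> 'a ^ 3 \<Rightarrow> 'a poly" where
  "line_restrict f v w = insertion (\<lambda>c. [:c:]) (\<lambda>i. [:v $ i, w $ i:]) f"

definition line_mult :: "'a::field ternary \<Rightarrow> 'a ternary \<Rightarrow> ('a ^ 3) set \<Rightarrow> enat" where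
  "line_mult f l P = (THE n. \<exists>v w. P = proj_pt v \<and> eval l v = 0 \<and> eval l w = 0
      \<and> (\<forall>c d. c *s v + d *s w = 0 \<longrightarrow> c = 0 \<and> d = 0)
      \<and> n = (if line_restrict f v w = 0 then \<infinity> else enat (Polynomial.order 0 (line_restrict f v w))))"

text \<open>
  Multiplicity and tangent lines of a form \<open>f\<close> at \<open>[v]\<close> are read off from the lowest homogeneous part
  of \<open>f(v + x)\<close>. For \<open>v = (0, 0, 1)\<close> this part does not involve \<open>z\<close>, because
  \<open>f(x, y, 1 + z) = \<Sum> f\<^sub>i(x, y) (1 + z)\<^sup>d\<^sup>-\<^sup>i\<close> with \<open>f\<^sub>i\<close> of degree \<open>i\<close>, so that it equals the lowest part
  of the affine equation \<open>f(x, y, 1)\<close>; its linear factors are the tangent lines.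
\<close>

definition taylor :: "'a::field ^ 3 \<Rightarrow> 'a ternary \<Rightarrow> 'a ternary" where
  "taylor v f = insertion Const (\<lambda>i. Const (v $ i) + Var i) f"

definition point_mult :: "'a::field ternary \<Rightarrow> 'a ^ 3 \<Rightarrow> nat" where
  "point_mult f v = (LEAST d. hom_part d (taylor v f) \<noteq> 0)"

definition tangent_cone :: "'a::field ternary \<Rightarrow> 'a ^ 3 \<Rightarrow> 'a ternary" where
  "tangent_cone f v = hom_part (point_mult f v) (taylor v f)"

definition tangent_line :: "'a::field ternary \<Rightarrow> 'a ^ 3 \<Rightarrow> 'a ternary \<Rightarrow> bool" where
  "tangent_line f v l \<longleftrightarrow> linear_form l \<and> l dvd tangent_cone f v"

text \<open>
  A cusp is a double point with only one tangent line, which meets the curve there with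
  multiplicity three.
\<close>

definition cusp :: "'a::field ternary \<Rightarrow> 'a ^ 3 \<Rightarrow> bool" where
  "cusp f v \<longleftrightarrow> point_mult f v = 2 \<and>
     (\<exists>l. (\<forall>l'. tangent_line f v l' \<longleftrightarrow> (\<exists>c. c \<noteq> 0 \<and> l' = Const c * l)) \<and>
          line_mult f l (proj_pt v) = 3)"


section \<open>Supersingular plane cubics\<close>

text \<open>
  The group law on a smooth cubic with base point \<open>e\<close>: if \<open>P * Q\<close> denotes the third intersection
  point, with multiplicities, of the curve with the line through \<open>P\<close> and \<open>Q\<close>, then
  \<open>P + Q = e * (P * Q)\<close>. In positive characteristic \<open>p\<close> the curve is supersingular if it has no
  nontrivial \<open>p\<close>-torsion point over the algebraically closed ground field.
\<close>

definition line_section ::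
  "'a::field ternary \<Rightarrow> ('a ^ 3) set \<Rightarrow> ('a ^ 3) set \<Rightarrow> ('a ^ 3) set \<Rightarrow> bool" where
  "line_section f P Q R \<longleftrightarrow> (\<exists>l. linear_form l \<and> {P, Q, R} \<subseteq> curve l \<and>
     (\<forall>S\<in>curve l. line_mult f l S = enat (count {#P, Q, R#} S)))"

definition third_point ::
  "'a::field ternary \<Rightarrow> ('a ^ 3) set \<Rightarrow> ('a ^ 3) set \<Rightarrow> ('a ^ 3) set" where
  "third_point f P Q = (THE R. line_section f P Q R)"

definition ell_add ::
  "'a::field ternary \<Rightarrow> ('a ^ 3) set \<Rightarrow> ('a ^ 3) set \<Rightarrow> ('a ^ 3) set \<Rightarrow> ('a ^ 3) set" where
  "ell_add f e P Q = third_point f e (third_point f P Q)"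

definition ell_mult :: "'a::field ternary \<Rightarrow> ('a ^ 3) set \<Rightarrow> nat \<Rightarrow> ('a ^ 3) set \<Rightarrow> ('a ^ 3) set" where
  "ell_mult f e n P = (ell_add f e P ^^ n) e"

definition elliptic_curve :: "'a::field ternary \<Rightarrow> ('a ^ 3) set \<Rightarrow> bool" where
  "elliptic_curve f e \<longleftrightarrow> form 3 f \<and> smooth f \<and> e \<in> curve f"

definition supersingular :: "'a::alg_closed_field ternary \<Rightarrow> ('a ^ 3) set \<Rightarrow> bool" where
  "supersingular f e \<longleftrightarrow> (\<forall>P\<in>curve f. ell_mult f e CHAR('a) P = e \<longrightarrow> P = e)"

end

theory Submission
  imports Defs "HOL-Analysis.Determinants"
begin

text \<open>
  In characteristic two every ternary cubic can be written as
  \<open>f = \<Sum> a\<^sub>i\<^sub>j x\<^sub>i\<^sup>2 x\<^sub>j + c xyz\<close>, and the whole theorem turns on the single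
  coefficient \<open>c\<close>.

  If \<open>c \<noteq> 0\<close>, then \<open>f\<close> is \<open>F\<close>-pure, and if it is also smooth, it is not supersingular. For the
  first claim (\<open>F_pure_cubic\<close>), consider the map \<open>\<Phi>\<close> on polynomials that sends \<open>a x\<^sup>2\<^sup>m\<^sup>+\<^sup>1\<close> to
  \<open>\<surd>a x\<^sup>m\<close>, where \<open>2m + 1\<close> stands for an exponent vector with odd entries, and all other monomials
  to \<open>0\<close>. It satisfies \<open>\<Phi>(g\<^sup>2 h) = g \<Phi>(h)\<close>, so \<open>h \<mapsto> \<Phi>(f h)\<close> maps the ideal of \<open>f\<close> to itself and
  descends to the coordinate ring, and it sends \<open>1\<close> to \<open>\<Phi>(f) = \<surd>c\<close>. After division by \<open>\<surd>c\<close> it is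
  a linear left inverse of Frobenius, and a split map is pure. For the second claim
  (\<open>ell_2_torsion\<close>), let \<open>T\<close> be the third point on the tangent at the origin \<open>E\<close> of the group law.
  The lines through \<open>T\<close> that are tangent at another point, or meet the curve in \<open>T\<close> three times,
  correspond to the zeros of a binary quadratic form whose polarization is \<open>c\<close> times a determinant.
  So there are two of them, and the one that is not the tangent at \<open>E\<close> touches the curve in a
  nontrivial point of order two.

  It remains to classify the cubics with \<open>c = 0\<close>. Such a cubic is \<open>h(v, v)\<close> for the form
  \<open>h(u, v) = \<Sum> a\<^sub>i\<^sub>j u\<^sub>i\<^sup>2 v\<^sub>j\<close>, which is additive in both arguments, and a linear change of
  coordinates replaces the matrix \<open>(a\<^sub>i\<^sub>j)\<close> by the Gram matrix of another basis. Everything follows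
  from a nonzero \<open>u\<close> with \<open>h(u, u) = 0\<close> such that \<open>h(w, u) = 0\<close> whenever \<open>h(u, w) = 0\<close>; for a smooth
  curve this means that the tangent at \<open>u\<close> is an inflectional tangent. Taking \<open>u\<close> as last basis
  vector, and solving equations of degree at most four, brings a nondegenerate \<open>f\<close> to
  \<open>\<gamma> x\<^sup>2z + y\<^sup>3 + xz\<^sup>2\<close> with a constant \<open>\<gamma>\<close> or to \<open>x\<^sup>2z + xy\<^sup>2\<close>. The first of these is the Fermat
  cubic for \<open>\<gamma> \<noteq> 0\<close>, since \<open>x\<^sup>2z + xz\<^sup>2\<close> has three distinct linear factors, and the cuspidal cubic
  for \<open>\<gamma> = 0\<close>.

  If the matrix is singular, any \<open>u\<close> in its kernel will do. If it is invertible
  (\<open>flex_exists\<close>), then \<open>h(w, \<tau> v) = h(v, w)\<^sup>2\<close> defines an injective map \<open>\<tau>\<close> with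
  \<open>\<tau>(k v) = k\<^sup>4 \<tau> v\<close>. Such a map has a nonzero fixed vector \<open>v\<close>
  (\<open>semilinear_fixed_vector\<close>), and \<open>h(w, v) = h(v, w)\<^sup>2\<close> says that the left and right orthogonal
  complements of \<open>v\<close> agree. Now \<open>v\<close> or an isotropic vector of its complement is the required \<open>u\<close>.

  That the Fermat cubic is not \<open>F\<close>-pure is seen on the module \<open>R/I\<close>, where \<open>I\<close> is the ideal of the
  coordinate ring \<open>R\<close> generated by \<open>x\<close> and \<open>y\<close>: the element \<open>z\<^sup>2\<close> is not in \<open>I\<close>, but
  \<open>z\<^sup>4 = zx \<cdot> x\<^sup>2 + zy \<cdot> y\<^sup>2\<close>.
\<close>

(* The dollar sign for coefficients of power series makes vector components ambiguous. *)
no_notation fps_nth (infixl \<open>$\<close> 75)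

section \<open>Polynomial maps and substitutions\<close>

text \<open>
  An identity between additive functions of a polynomial need only be checked on monomials.
\<close>

lemma mpoly_induct [case_names monom add]:
  fixes p :: "('v, 'a::comm_ring_1) mpoly"
  assumes "\<And>m c. P (Poly_Mapping.single m c)"
    and "\<And>p q. P p \<Longrightarrow> P q \<Longrightarrow> P (p + q)"
  shows "P p"
proof (induction p rule: update_induct)
  case const
  show ?case using assms(1)[of 0 0] by simp
next
  case (update q m c)
  have "Poly_Mapping.update m c q = q + Poly_Mapping.single m c"
    using update(1) by (intro poly_mapping_eqI)
      (auto simp: lookup_update lookup_add lookup_single in_keys_iff when_def)
  then show ?case using assms update by simp
qed

lemma monomial_eq_prod:
  "Poly_Mapping.single m (c::'a::comm_ring_1) = Const c * (\<Prod>i\<in>UNIV. Var i ^ Poly_Mapping.lookup m i)"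
  for m :: "'v::finite \<Rightarrow>\<^sub>0 nat"
proof -
  have pow: "Var i ^ k = Poly_Mapping.single (Poly_Mapping.single i k) (1::'a)" for i :: 'v and k
    by (induction k) (simp_all add: Var_def mult_single flip: single_add)
  have "(\<Prod>i\<in>S. Var i ^ Poly_Mapping.lookup m i) =
      Poly_Mapping.single (\<Sum>i\<in>S. Poly_Mapping.single i (Poly_Mapping.lookup m i)) (1::'a)"
    if "finite S" for S
    using that by (induction S) (simp_all add: pow mult_single)
  moreover have "(\<Sum>i\<in>UNIV. Poly_Mapping.single i (Poly_Mapping.lookup m i)) = m"
    by (intro poly_mapping_eqI) (simp add: lookup_sum lookup_single when_def)
  ultimately show ?thesis by (simp add: Const_def mult_single)
qed

lemma Const_0 [simp]: "Const 0 = 0"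
  and Const_1 [simp]: "Const 1 = 1"
  and Const_add: "Const (a + b) = Const a + Const b"
  and Const_mult: "Const (a * b) = Const a * Const b"
  by (simp_all add: Const_def single_add mult_single)

lemma Const_power: "Const (a ^ n) = Const a ^ n"
  by (induction n) (simp_all add: Const_mult)

text \<open>
  The evaluation of polynomials, linear substitutions, Taylor expansions and restrictions to lines
  are all values of \<open>insertion\<close> at different coefficient homomorphisms, so that its multiplicativity
  is proved for an arbitrary one.
\<close>

locale coeff_hom =
  fixes h :: "'a::comm_ring_1 \<Rightarrow> 'b::comm_ring_1"
  assumes zero: "h 0 = 0" and one: "h 1 = 1"
    and add: "h (a + b) = h a + h b" and mult: "h (a * b) = h a * h b"
begin

context
  fixes \<sigma> :: "'v::finite \<Rightarrow> 'b"
begin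

lemma insertion_superset:
  assumes "finite S" "Poly_Mapping.keys p \<subseteq> S"
  shows "insertion h \<sigma> p =
    (\<Sum>m\<in>S. h (Poly_Mapping.lookup p m) * (\<Prod>i\<in>UNIV. \<sigma> i ^ Poly_Mapping.lookup m i))"
  unfolding insertion_def
  by (rule sum.mono_neutral_left) (use assms in \<open>auto simp: in_keys_iff zero\<close>)

lemma insertion_monom:
  "insertion h \<sigma> (Poly_Mapping.single m c) = h c * (\<Prod>i\<in>UNIV. \<sigma> i ^ Poly_Mapping.lookup m i)"
  by (subst insertion_superset[of "{m}"]) (auto simp: zero)

lemma insertion_add: "insertion h \<sigma> (p + q) = insertion h \<sigma> p + insertion h \<sigma> q"
proof -
  let ?S = "Poly_Mapping.keys p \<union> Poly_Mapping.keys q"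
  show ?thesis
    by (subst (1 2 3) insertion_superset[of ?S])
      (auto simp: keys_add lookup_add add algebra_simps sum.distrib)
qed

lemma insertion_mult: "insertion h \<sigma> (p * q) = insertion h \<sigma> p * insertion h \<sigma> q"
proof (induction p rule: mpoly_induct)
  case (monom m a)
  show ?case
  proof (induction q rule: mpoly_induct)
    case (monom n b)
    show ?case
      by (simp add: mult_single insertion_monom mult lookup_add power_add prod.distrib)
  qed (simp add: insertion_add algebra_simps)
qed (simp add: insertion_add algebra_simps)

lemma insertion_Const [simp]: "insertion h \<sigma> (Const c) = h c"
  by (simp add: Const_def insertion_monom)

lemma insertion_Var [simp]: "insertion h \<sigma> (Var i) = \<sigma> i"
proof -
  have "(\<Prod>j\<in>UNIV. \<sigma> j ^ Poly_Mapping.lookup (Poly_Mapping.single i 1) j) = (\<Prod>j\<in>{i}. \<sigma> j)"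
    by (rule prod.mono_neutral_cong_right) (auto simp: lookup_single)
  then show ?thesis by (simp add: Var_def insertion_monom one)
qed

lemma insertion_0 [simp]: "insertion h \<sigma> 0 = 0"
  and insertion_1 [simp]: "insertion h \<sigma> 1 = 1"
  by (metis insertion_Const Const_0 zero, metis insertion_Const Const_1 one)

lemma insertion_power: "insertion h \<sigma> (p ^ n) = insertion h \<sigma> p ^ n"
  by (induction n) (simp_all add: insertion_mult)

lemma insertion_sum: "insertion h \<sigma> (sum g S) = (\<Sum>i\<in>S. insertion h \<sigma> (g i))"
  by (induction S rule: infinite_finite_induct) (simp_all add: insertion_add)

lemmas insertion_simps = insertion_add insertion_mult insertion_power insertion_sum

end
end

interpretation id_hom: coeff_hom "\<lambda>c. c"
  by unfold_locales simp_all
interpretation Const_hom: coeff_hom Const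
  by unfold_locales (simp_all add: Const_add Const_mult)
interpretation poly_const_hom: coeff_hom "\<lambda>c. [:c:]"
  by unfold_locales simp_all

lemma eval_0 [simp]: "eval 0 v = 0"
  and eval_1 [simp]: "eval 1 v = 1"
  and eval_Const [simp]: "eval (Const c) v = c"
  and eval_Var [simp]: "eval (Var i) v = v $ i"
  and eval_add [simp]: "eval (p + q) v = eval p v + eval q v"
  and eval_mult [simp]: "eval (p * q) v = eval p v * eval q v"
  and eval_power [simp]: "eval (p ^ n) v = eval p v ^ n"
  and eval_sum [simp]: "eval (sum g S) v = (\<Sum>i\<in>S. eval (g i) v)"
  by (simp_all add: eval_def id_hom.insertion_simps)

lemma lin_subst_Const [simp]: "lin_subst A (Const c) = Const c"
  and lin_subst_Var [simp]: "lin_subst A (Var i) = (\<Sum>j\<in>UNIV. Const (A $ i $ j) * Var j)"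
  and lin_subst_add: "lin_subst A (p + q) = lin_subst A p + lin_subst A q"
  and lin_subst_mult: "lin_subst A (p * q) = lin_subst A p * lin_subst A q"
  and lin_subst_power: "lin_subst A (p ^ n) = lin_subst A p ^ n"
  by (simp_all add: lin_subst_def Const_hom.insertion_simps)

lemma taylor_Const [simp]: "taylor v (Const c) = Const c"
  and taylor_Var [simp]: "taylor v (Var i) = Const (v $ i) + Var i"
  and taylor_add [simp]: "taylor v (p + q) = taylor v p + taylor v q"
  and taylor_mult [simp]: "taylor v (p * q) = taylor v p * taylor v q"
  and taylor_power [simp]: "taylor v (p ^ n) = taylor v p ^ n"
  by (simp_all add: taylor_def Const_hom.insertion_simps)

lemma line_restrict_Const [simp]: "line_restrict (Const c) v w = [:c:]"
  and line_restrict_Var [simp]: "line_restrict (Var i) v w = [:v $ i, w $ i:]"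
  and line_restrict_add [simp]: "line_restrict (p + q) v w = line_restrict p v w + line_restrict q v w"
  and line_restrict_mult [simp]: "line_restrict (p * q) v w = line_restrict p v w * line_restrict q v w"
  and line_restrict_power [simp]: "line_restrict (p ^ n) v w = line_restrict p v w ^ n"
  by (simp_all add: line_restrict_def poly_const_hom.insertion_simps)

lemma poly_line_restrict: "poly (line_restrict p v w) t = eval p (v + t *s w)"
proof (induction p rule: mpoly_induct)
  case (monom m c)
  show ?case
    by (simp add: line_restrict_def eval_def id_hom.insertion_monom poly_const_hom.insertion_monom
        poly_prod)
next
  case (add p q)
  then show ?case by simp
qed

subsection \<open>Partial derivatives\<close>

lemma partial_superset:
  assumes "finite S" "Poly_Mapping.keys p \<subseteq> S"
  shows "partial i p = (\<Sum>m\<in>S. Poly_Mapping.single (m - Poly_Mapping.single i 1)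
      (of_nat (Poly_Mapping.lookup m i) * Poly_Mapping.lookup p m))"
  unfolding partial_def
  by (rule sum.mono_neutral_left) (use assms in \<open>auto simp: in_keys_iff\<close>)

lemma partial_monom:
  "partial i (Poly_Mapping.single m c) =
     Poly_Mapping.single (m - Poly_Mapping.single i 1) (of_nat (Poly_Mapping.lookup m i) * c)"
  by (subst partial_superset[of "{m}"]) auto

lemma partial_add [simp]: "partial i (p + q) = partial i p + partial i q"
proof -
  let ?S = "Poly_Mapping.keys p \<union> Poly_Mapping.keys q"
  show ?thesis
    by (subst (1 2 3) partial_superset[of ?S])
      (auto simp: keys_add lookup_add algebra_simps sum.distrib single_add)
qed

lemma partial_mult [simp]: "partial i (p * q) = partial i p * q + p * partial i q"
proof (induction p rule: mpoly_induct)
  case (monom m a)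
  show ?case
  proof (induction q rule: mpoly_induct)
    case (monom n b)
    let ?e = "Poly_Mapping.single i 1"
    have shift: "Poly_Mapping.single (k - ?e + l) (of_nat (Poly_Mapping.lookup k i) * x)
        = Poly_Mapping.single (k + l - ?e) (of_nat (Poly_Mapping.lookup k i) * x)"
      for k l and x :: 'b
    proof (cases "Poly_Mapping.lookup k i = 0")
      case False
      then have "k - ?e + l = k + l - ?e"
        by (intro poly_mapping_eqI) (auto simp: lookup_add lookup_minus lookup_single when_def)
      then show ?thesis by simp
    qed simp
    have "partial i (Poly_Mapping.single m a) * Poly_Mapping.single n b =
        Poly_Mapping.single (m + n - ?e) (of_nat (Poly_Mapping.lookup m i) * (a * b))"
      using shift[of m n "a * b"] by (simp add: partial_monom mult_single mult.assoc)
    moreover have "Poly_Mapping.single m a * partial i (Poly_Mapping.single n b) =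
        Poly_Mapping.single (m + n - ?e) (of_nat (Poly_Mapping.lookup n i) * (a * b))"
      using shift[of n m "a * b"] by (simp add: partial_monom mult_single add.commute mult.left_commute)
    ultimately show ?case
      by (simp add: mult_single partial_monom lookup_add distrib_right single_add)
  qed (simp add: algebra_simps)
qed (simp add: algebra_simps)

lemma partial_Const [simp]: "partial i (Const c) = 0"
  by (simp add: Const_def partial_monom)

lemma partial_Var [simp]: "partial i (Var j) = (if i = j then 1 else 0)"
  by (auto simp: Var_def partial_monom lookup_single)

subsection \<open>Homogeneous parts\<close>

lemma mono_degree_add: "mono_degree (m + n) = mono_degree m + mono_degree n"
  by (simp add: mono_degree_def lookup_add sum.distrib)

lemma hom_part_lookup:
  "Poly_Mapping.lookup (hom_part d p) m = (if mono_degree m = d then Poly_Mapping.lookup p m else 0)"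
  by (auto simp: hom_part_def lookup_sum lookup_single when_def in_keys_iff)

lemma hom_part_add: "hom_part d (p + q) = hom_part d p + hom_part d q"
  by (intro poly_mapping_eqI) (simp add: hom_part_lookup lookup_add)

lemma hom_part_form: "form d p \<Longrightarrow> hom_part e p = (if e = d then p else 0)"
  by (intro poly_mapping_eqI) (auto simp: hom_part_lookup form_def in_keys_iff)

lemma form_add: "form d p \<Longrightarrow> form d q \<Longrightarrow> form d (p + q)"
  unfolding form_def using keys_add[of p q] by blast

lemma form_sum: "(\<And>i. i \<in> S \<Longrightarrow> form d (g i)) \<Longrightarrow> form d (sum g S)"
  by (induction S rule: infinite_finite_induct) (auto simp: form_add, auto simp: form_def)

lemma form_mult: "form d p \<Longrightarrow> form e q \<Longrightarrow> form (d + e) (p * q)"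
  unfolding form_def using keys_mult[of p q] by (auto simp: mono_degree_add)

lemma form_Const [simp]: "form 0 (Const c)"
  by (auto simp: form_def Const_def mono_degree_def)

lemma form_Var [simp]: "form 1 (Var i)"
  by (auto simp: form_def Var_def mono_degree_def lookup_single when_def)

lemma form_power: "form d p \<Longrightarrow> form (d * n) (p ^ n)"
proof (induction n)
  case 0
  then show ?case using form_Const[of 1] by simp
next
  case (Suc n)
  then show ?case using form_mult[of d p "d * n" "p ^ n"] by simp
qed

section \<open>Cubic forms as Gram matrices\<close>

text \<open>
  The form \<open>h(u, v)\<close>: semilinear for the Frobenius map in \<open>u\<close> and linear in \<open>v\<close> when the
  characteristic is two.
\<close>

definition gram :: "'a::field ^ 3 ^ 3 \<Rightarrow> 'a ^ 3 \<Rightarrow> 'a ^ 3 \<Rightarrow> 'a" where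
  "gram A u v = (\<Sum>i\<in>UNIV. \<Sum>j\<in>UNIV. A $ i $ j * (u $ i)\<^sup>2 * v $ j)"

definition cubic :: "'a::field ^ 3 ^ 3 \<Rightarrow> 'a \<Rightarrow> 'a ternary" where
  "cubic A c = (\<Sum>i\<in>UNIV. \<Sum>j\<in>UNIV. Const (A $ i $ j) * Var i ^ 2 * Var j) + Const c * (vx * vy * vz)"

definition det3 :: "'a::field ^ 3 \<Rightarrow> 'a ^ 3 \<Rightarrow> 'a ^ 3 \<Rightarrow> 'a" where
  "det3 u v w = u$1 * (v$2 * w$3 - v$3 * w$2) - u$2 * (v$1 * w$3 - v$3 * w$1)
     + u$3 * (v$1 * w$2 - v$2 * w$1)"

text \<open>
  The matrix with columns \<open>p\<close>, \<open>q\<close>, \<open>r\<close>; it substitutes coordinates with respect to this basis.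
\<close>

definition frame :: "'a::field ^ 3 \<Rightarrow> 'a ^ 3 \<Rightarrow> 'a ^ 3 \<Rightarrow> 'a ^ 3 ^ 3" where
  "frame p q r = transpose (vector [p, q, r])"

lemma vec3_eq_iff: "(u::'a^3) = v \<longleftrightarrow> u$1 = v$1 \<and> u$2 = v$2 \<and> u$3 = v$3"
  by (simp add: vec_eq_iff forall_3)

lemma invertible_frame: "invertible (frame p q r) \<longleftrightarrow> det3 p q r \<noteq> (0::'a::field)"
proof -
  have "det (frame p q r) = det3 p q r"
    by (simp add: frame_def transpose_def det_3 det3_def algebra_simps)
  then show ?thesis by (simp add: invertible_det_nz)
qed

lemma frame_mult: "frame p q r *v x = x$1 *s p + x$2 *s q + x$3 *s r"
  by (simp add: vec3_eq_iff frame_def matrix_vector_mult_def transpose_def sum_3 algebra_simps)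

lemma column_frame: "column j (frame p q r) = (vector [p, q, r] :: 'a::field^3^3) $ j"
  by (simp add: vec_eq_iff column_def frame_def transpose_def)

lemma singular_matrix_kernel:
  fixes A :: "'a::field ^ 3 ^ 3"
  assumes "\<not> invertible A" obtains x where "x \<noteq> 0" "A *v x = 0"
  using assms matrix_left_invertible_ker[of A] invertible_left_inverse[of A] by blast

lemma invertible_kernel:
  fixes A :: "'a::field ^ 3 ^ 3"
  assumes "invertible A" "A *v x = 0" shows "x = 0"
  using assms matrix_left_invertible_ker[of A] invertible_left_inverse[of A] by blast

lemma det3_zero_relation:
  fixes u :: "'a::field ^ 3"
  assumes "det3 u v w = 0"
  obtains a b c where "a *s u + b *s v + c *s w = 0" "a \<noteq> 0 \<or> b \<noteq> 0 \<or> c \<noteq> 0"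
proof -
  have "\<not> invertible (frame u v w)" using assms by (simp add: invertible_frame)
  then obtain x where "x \<noteq> 0" "frame u v w *v x = 0" by (rule singular_matrix_kernel)
  then show thesis using that[of "x$1" "x$2" "x$3"] by (auto simp: frame_mult vec3_eq_iff)
qed

lemma det3_nonzero_expand:
  fixes u :: "'a::field ^ 3"
  assumes "det3 u v w \<noteq> 0" obtains a b c where "x = a *s u + b *s v + c *s w"
proof -
  obtain B where "frame u v w ** B = mat 1"
    using assms invertible_frame invertible_def by blast
  then have "frame u v w *v (B *v x) = x"
    by (simp add: matrix_vector_mul_assoc)
  then show thesis using that by (metis frame_mult)
qed

text \<open>
  The functional \<open>n\<close> is given by its coefficients, and the basis is adapted to its kernel.
\<close>

lemma functional_basis:
  fixes n :: "'a::field ^ 3"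
  assumes "n \<noteq> 0"
  obtains b p q where "(\<Sum>i\<in>UNIV. n$i * b$i) = 1" "(\<Sum>i\<in>UNIV. n$i * p$i) = 0"
    "(\<Sum>i\<in>UNIV. n$i * q$i) = 0" "det3 b p q \<noteq> 0"
proof -
  consider "n$1 \<noteq> 0" | "n$2 \<noteq> 0" | "n$3 \<noteq> 0" using assms by (auto simp: vec3_eq_iff)
  then show thesis
  proof cases
    case 1
    then show ?thesis
      by (intro that[of "vector [1/n$1,0,0]" "vector [-n$2,n$1,0]" "vector [-n$3,0,n$1]"])
        (simp_all add: sum_3 det3_def)
  next
    case 2
    then show ?thesis
      by (intro that[of "vector [0,1/n$2,0]" "vector [n$2,-n$1,0]" "vector [0,-n$3,n$2]"])
        (simp_all add: sum_3 det3_def)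
  next
    case 3
    then show ?thesis
      by (intro that[of "vector [0,0,1/n$3]" "vector [n$3,0,-n$1]" "vector [0,n$3,-n$2]"])
        (simp_all add: sum_3 det3_def)
  qed
qed

text \<open>
  Here the kernel is spanned by \<open>p\<close> and the prescribed vector \<open>u\<close>: for any basis of the kernel one
  of the two vectors can be exchanged for \<open>u\<close>.
\<close>

lemma functional_basis_through:
  fixes n u :: "'a::field ^ 3"
  assumes n: "n \<noteq> 0" and nu: "(\<Sum>i\<in>UNIV. n$i * u$i) = 0" and u: "u \<noteq> 0"
  obtains b p where "(\<Sum>i\<in>UNIV. n$i * b$i) = 1" "(\<Sum>i\<in>UNIV. n$i * p$i) = 0" "det3 b p u \<noteq> 0"
proof -
  obtain b p q where b: "(\<Sum>i\<in>UNIV. n$i * b$i) = 1" and p: "(\<Sum>i\<in>UNIV. n$i * p$i) = 0"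
    and q: "(\<Sum>i\<in>UNIV. n$i * q$i) = 0" and d: "det3 b p q \<noteq> 0"
    using functional_basis[OF n] .
  obtain x y z where xyz: "u = x *s b + y *s p + z *s q"
    using det3_nonzero_expand[OF d] .
  have "(\<Sum>i\<in>UNIV. n$i * u$i)
      = x * (\<Sum>i\<in>UNIV. n$i * b$i) + y * (\<Sum>i\<in>UNIV. n$i * p$i) + z * (\<Sum>i\<in>UNIV. n$i * q$i)"
    unfolding xyz by (simp add: sum_3 algebra_simps)
  then have x: "x = 0" using nu b p q by simp
  have "det3 b p u = z * det3 b p q" "det3 b q u = - y * det3 b p q"
    unfolding xyz x by (simp_all add: det3_def algebra_simps)
  moreover have "y \<noteq> 0 \<or> z \<noteq> 0" using u unfolding xyz x by auto
  ultimately show thesis using that b p q d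
    by (metis minus_mult_left mult_eq_0_iff neg_equal_0_iff_equal)
qed

lemma gram_add_right: "gram A u (v + w) = gram A u v + gram A u w"
  and gram_scale_right: "gram A u (c *s v) = c * gram A u v"
  and gram_scale_left: "gram A (c *s u) v = c\<^sup>2 * gram A u v"
  by (simp_all add: gram_def sum_3 algebra_simps power_mult_distrib)

lemma gram_zero [simp]: "gram A 0 v = 0" "gram A u 0 = 0"
  by (simp_all add: gram_def)

lemma gram_functional: "gram A u v = (\<Sum>j\<in>UNIV. gram A u (axis j 1) * v $ j)"
  by (simp add: gram_def sum_3 axis_def algebra_simps)

lemma form_cubic: "form 3 (cubic A c)"
proof -
  have sq: "form 2 (Var i ^ 2 :: 'a ternary)" for i
    using form_power[OF form_Var, of 2 i] by simp
  have "form 3 (Const a * Var i ^ 2 * Var j :: 'a ternary)" for a i j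
    using form_mult[OF form_mult[OF form_Const sq] form_Var, of a i j] by (simp add: numeral_3_eq_3)
  moreover have "form 3 (Const c * (vx * vy * vz))"
    using form_mult[OF form_Const form_mult[OF form_mult[OF form_Var form_Var] form_Var]]
    by (simp add: numeral_3_eq_3)
  ultimately show ?thesis unfolding cubic_def by (intro form_add form_sum)
qed

lemma cubic_add: "cubic A c + cubic B d = cubic (A + B) (c + d)"
  by (simp add: cubic_def sum_3 Const_add algebra_simps)

lemma compositions_of_3:
  fixes a b c :: nat
  assumes "a + b + c = 3"
  shows "(a, b, c) \<in> {(3,0,0), (2,1,0), (2,0,1), (1,2,0), (1,1,1), (1,0,2), (0,3,0), (0,2,1), (0,1,2), (0,0,3)}"
proof -
  have "a = 0 \<or> a = 1 \<or> a = 2 \<or> a = 3" using assms by linarith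
  moreover have "b = 0 \<or> b = 1 \<or> b = 2 \<or> b = 3" using assms by linarith
  moreover have "c = 3 - (a + b)" using assms by linarith
  ultimately show ?thesis using assms by (elim disjE) simp_all
qed

lemma prod_UNIV_3: "prod f (UNIV::3 set) = f 1 * f 2 * f 3"
  unfolding UNIV_3 by (simp add: ac_simps)

text \<open>
  Any monomial of degree three other than \<open>xyz\<close> has a repeated variable.
\<close>

lemma form_3_eq_cubic:
  fixes f :: "'a::field ternary"
  assumes "form 3 f" shows "\<exists>A c. f = cubic A c"
proof -
  have single: "\<exists>A c. Const a * Var i ^ 2 * Var j = cubic A (c::'a)" for a i j
  proof (intro exI)
    show "Const a * Var i ^ 2 * Var j = cubic (\<chi> k l. if k = i \<and> l = j then a else 0) 0"
      using exhaust_3[of i] exhaust_3[of j] by (elim disjE) (simp_all add: cubic_def sum_3)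
  qed
  have xyz: "\<exists>A c. Const a * (vx * vy * vz) = cubic A (c::'a)" for a
  proof (intro exI)
    show "Const a * (vx * vy * vz) = cubic 0 a" by (simp add: cubic_def)
  qed
  have cubic_monom: "\<exists>A c. Poly_Mapping.single m a = cubic A (c::'a)" if "mono_degree m = 3" for m a
  proof -
    define k where "k i = Poly_Mapping.lookup m i" for i
    have eq: "Poly_Mapping.single m a = Const a * (vx ^ k 1 * vy ^ k 2 * vz ^ k 3)"
      unfolding k_def monomial_eq_prod[of m a] prod_UNIV_3 ..
    have deg: "k 1 + k 2 + k 3 = 3"
      using that by (simp add: mono_degree_def sum_3 k_def)
    show ?thesis
      using compositions_of_3[OF deg] single[of a 1 1] single[of a 1 2] single[of a 1 3] single[of a 2 1]
        single[of a 2 2] single[of a 2 3] single[of a 3 1] single[of a 3 2] single[of a 3 3] xyz[of a]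
      unfolding eq insert_iff prod.inject empty_iff
      by (elim disjE conjE) (simp_all add: power3_eq_cube power2_eq_square ac_simps)
  qed
  have "f = hom_part 3 f" using assms by (simp add: hom_part_form)
  moreover have "\<exists>A c. hom_part 3 f = cubic A c"
  proof (induction f rule: mpoly_induct)
    case (monom m a)
    show ?case
    proof (cases "mono_degree m = 3")
      case True
      then have "hom_part 3 (Poly_Mapping.single m a) = Poly_Mapping.single m a"
        by (intro poly_mapping_eqI) (auto simp: hom_part_lookup lookup_single when_def)
      then show ?thesis using cubic_monom[OF True] by simp
    next
      case False
      then have "hom_part 3 (Poly_Mapping.single m a) = cubic 0 0"
        by (intro poly_mapping_eqI) (auto simp: hom_part_lookup lookup_single when_def cubic_def)
      then show ?thesis by blast
    qed
  next
    case (add p q)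
    then show ?case by (metis hom_part_add cubic_add)
  qed
  ultimately show ?thesis by simp
qed

section \<open>Cubics without a mixed term\<close>

subsection \<open>Change of basis\<close>

lemma sum_square_char_2:
  assumes "(2::'b::comm_ring_1) = 0"
  shows "(x + y)\<^sup>2 = x\<^sup>2 + (y::'b)\<^sup>2"
proof -
  have "(x + y)\<^sup>2 = x\<^sup>2 + y\<^sup>2 + 2 * (x * y)" by (simp add: power2_eq_square algebra_simps)
  then show ?thesis using assms by simp
qed

definition pullback :: "'a::field ^ 3 ^ 3 \<Rightarrow> 'a ^ 3 ^ 3 \<Rightarrow> 'a ^ 3 ^ 3" where
  "pullback A B = (\<chi> j k. gram A (column j B) (column k B))"

text \<open>
  Gram matrices of one form with respect to two bases.
\<close>

definition congr :: "'a::field ^ 3 ^ 3 \<Rightarrow> 'a ^ 3 ^ 3 \<Rightarrow> bool" where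
  "congr A A' \<longleftrightarrow> (\<exists>B. invertible B \<and> A' = pullback A B)"

text \<open>
  A vector orthogonal to everything on both sides is a direction on which the cubic does not depend.
\<close>

definition radical_free :: "'a::field ^ 3 ^ 3 \<Rightarrow> bool" where
  "radical_free A \<longleftrightarrow> (\<forall>u. (\<forall>w. gram A u w = 0) \<and> (\<forall>w. gram A w u = 0) \<longrightarrow> u = 0)"

abbreviation mat3 :: "'a::zero \<Rightarrow> 'a \<Rightarrow> 'a \<Rightarrow> 'a \<Rightarrow> 'a \<Rightarrow> 'a \<Rightarrow> 'a \<Rightarrow> 'a \<Rightarrow> 'a \<Rightarrow> 'a^3^3" where
  "mat3 a b c d e f g h i \<equiv> vector [vector [a, b, c], vector [d, e, f], vector [g, h, i]]"

text \<open>
  The parameter only fixes the type of the ground field. Within this locale sums cancel against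
  themselves, signs disappear and numerals reduce to \<open>0\<close> and \<open>1\<close> by simplification.
\<close>

locale alg_closed_char_2 =
  fixes K :: "'k::alg_closed_field itself"
  assumes char_2: "CHAR('k) = 2"
begin

lemma two: "(2::'k) = 0"
  using char_2 by (metis of_nat_CHAR of_nat_numeral)

lemma square_add: "(x + y)\<^sup>2 = x\<^sup>2 + (y::'k)\<^sup>2"
  by (rule sum_square_char_2[OF two])

lemma add_self [simp]: "(x::'k) + x = 0"
  using two by (metis mult_2 mult_zero_left)

lemma add_self_left [simp]: "(x::'k) + (x + y) = y"
  by (simp flip: add.assoc)

lemma minus_char_2 [simp]: "- (x::'k) = x"
  by (rule minus_unique) simp

lemma diff_char_2 [simp]: "(x::'k) - y = x + y"
  by (metis diff_conv_add_uminus minus_char_2)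

lemma add_eq_0_char_2: "(x::'k) + y = 0 \<longleftrightarrow> x = y"
  by (metis add_eq_0_iff minus_char_2)

lemma sqrt_exists: obtains y where "y\<^sup>2 = (x::'k)"
  using nth_root_exists[of 2 x] by auto

lemma two_mpoly: "(2::'k ternary) = 0"
proof -
  have "(2::'k ternary) = Const 2" by (metis Const_1 Const_add one_add_one)
  then show ?thesis by (simp add: two)
qed

lemma gram_add_left: "gram A (u + v) w = gram A u w + gram A v (w::'k^3)"
  by (simp add: gram_def square_add sum_3 algebra_simps)

lemmas gram_simps = gram_add_left gram_add_right gram_scale_left gram_scale_right

lemma gram_pullback: "gram (pullback A B) u v = gram A (B *v u) (B *v (v::'k^3))"
proof -
  have B: "B *v x = x$1 *s column 1 B + x$2 *s column 2 B + x$3 *s column 3 B" for x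
    by (simp add: vec3_eq_iff matrix_vector_mult_def column_def sum_3 mult.commute)
  have entry: "pullback A B $ j $ k = gram A (column j B) (column k B)" for j k
    by (simp add: pullback_def)
  show ?thesis
    unfolding gram_def[of "pullback A B"] entry sum_3 B gram_simps by (simp add: algebra_simps)
qed

lemma pullback_pullback: "pullback (pullback A B) C = pullback A (B ** (C::'k^3^3))"
proof -
  have "B *v column j C = column j (B ** C)" for j
    by (simp add: vec_eq_iff column_def matrix_vector_mult_def matrix_matrix_mult_def)
  then show ?thesis by (simp add: pullback_def[of _ C] pullback_def[of _ "B ** C"] gram_pullback)
qed

lemma congr_trans: "congr A A' \<Longrightarrow> congr A' A'' \<Longrightarrow> congr A (A''::'k^3^3)"
  unfolding congr_def using invertible_mult pullback_pullback by metis

lemma congr_frame: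
  assumes "det3 p q r \<noteq> 0"
  shows "congr A (mat3 (gram A p p) (gram A p q) (gram A p r) (gram A q p) (gram A q q) (gram A q r)
    (gram A r p) (gram A r q) (gram A r (r::'k^3)))"
  unfolding congr_def
proof (intro exI conjI)
  show "invertible (frame p q r)" using assms by (simp add: invertible_frame)
  show "mat3 (gram A p p) (gram A p q) (gram A p r) (gram A q p) (gram A q q) (gram A q r)
    (gram A r p) (gram A r q) (gram A r r) = pullback A (frame p q r)"
    by (simp add: pullback_def column_frame vec_eq_iff forall_3)
qed

lemma congr_radical_free:
  assumes "congr A A'" "radical_free A" shows "radical_free (A'::'k^3^3)"
proof -
  obtain B where B: "invertible B" "A' = pullback A B" using assms(1) congr_def by blast
  then obtain C where C: "B ** C = mat 1" by (auto simp: invertible_def)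
  have surj: "\<exists>x. w = B *v x" for w
    by (rule exI[of _ "C *v w"]) (simp add: matrix_vector_mul_assoc C)
  show ?thesis unfolding radical_free_def
  proof (intro allI impI, elim conjE)
    fix u assume l: "\<forall>w. gram A' u w = 0" and r: "\<forall>w. gram A' w u = 0"
    have "gram A (B *v u) w = 0 \<and> gram A w (B *v u) = 0" for w
      using surj[of w] l r unfolding B(2) gram_pullback by auto
    then have "B *v u = 0" using assms(2) unfolding radical_free_def by blast
    then show "u = 0" using invertible_kernel[OF B(1)] by blast
  qed
qed

text \<open>
  Squaring is additive, so that substituting linear forms into \<open>x\<^sub>i\<^sup>2 x\<^sub>j\<close> produces no mixed term.
\<close>

lemma lin_subst_cubic: "lin_subst B (cubic A 0) = cubic (pullback A B) (0::'k)"
proof -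
  have sq: "(x + y)\<^sup>2 = x\<^sup>2 + (y::'k ternary)\<^sup>2" for x y
    by (rule sum_square_char_2[OF two_mpoly])
  show ?thesis
    by (simp add: cubic_def sum_3 lin_subst_add lin_subst_mult lin_subst_power pullback_def gram_def
        column_def sq power_mult_distrib Const_add Const_mult Const_power)
      (simp add: algebra_simps)
qed

lemma congr_imp_proj_equiv: "congr A A' \<Longrightarrow> proj_equiv (cubic A 0) (cubic A' (0::'k))"
  unfolding congr_def proj_equiv_def using lin_subst_cubic by (metis Const_1 mult_1 one_neq_zero)

end

subsection \<open>Normal forms\<close>

lemma vars_add: "vars (p + q) \<subseteq> vars p \<union> vars q"
  unfolding vars_def using keys_add[of p q] by blast

lemma vars_mult: "vars (p * q) \<subseteq> vars p \<union> vars q"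
proof
  fix i assume "i \<in> vars (p * q)"
  then obtain m n where mn: "m \<in> Poly_Mapping.keys p" "n \<in> Poly_Mapping.keys q"
    and i: "i \<in> Poly_Mapping.keys (m + n)"
    unfolding vars_def using keys_mult[of p q] by blast
  then show "i \<in> vars p \<union> vars q"
    unfolding vars_def using keys_add[of m n] by blast
qed

lemma vars_Const: "vars (Const c) = {}"
  by (simp add: vars_def Const_def)

lemma vars_Var: "vars (Var i :: ('v, 'a::comm_ring_1) mpoly) \<subseteq> {i}"
  by (auto simp: vars_def Var_def)

lemma poly_root_exists:
  fixes p :: "'a::alg_closed_field poly"
  assumes "coeff p n \<noteq> 0" "n > 0" obtains x where "poly p x = 0"
  using alg_closed_imp_poly_has_root[of p] le_degree[OF assms(1)] assms(2) by auto

context alg_closed_char_2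
begin

lemma numeral_char_2 [simp]: "(numeral (Num.Bit0 n) :: 'k) = 0" "(numeral (Num.Bit1 n) :: 'k) = 1"
  using two by (simp_all add: numeral_Bit0 numeral_Bit1)

lemma vars_cubic_2:
  assumes "A$3$1 = 0" "A$3$2 = 0" "A$3$3 = 0" "A$1$3 = 0" "A$2$3 = 0"
  shows "vars (cubic A (0::'k)) \<subseteq> {1, 2}"
proof -
  have vars_summand: "vars (Const a * Var i ^ 2 * Var j :: 'k ternary) \<subseteq> {1, 2}"
    if "i \<in> {1, 2}" "j \<in> {1, 2}" for a i j
  proof -
    have "vars (Const a :: 'k ternary) = {}" by (rule vars_Const)
    moreover have "vars (Var i :: 'k ternary) \<subseteq> {1, 2}" "vars (Var j :: 'k ternary) \<subseteq> {1, 2}"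
      using that vars_Var[of i] vars_Var[of j] by blast+
    ultimately show ?thesis
      using vars_mult[of "Const a * Var i ^ 2" "Var j :: 'k ternary"]
        vars_mult[of "Const a" "Var i ^ 2 :: 'k ternary"] vars_mult[of "Var i" "Var i :: 'k ternary"]
      unfolding power2_eq_square by blast
  qed
  have "cubic A 0 = (Const (A$1$1) * vx^2 * vx + Const (A$1$2) * vx^2 * vy) +
      (Const (A$2$1) * vy^2 * vx + Const (A$2$2) * vy^2 * vy)"
    using assms by (simp add: cubic_def sum_3)
  moreover have "vars (p + q) \<subseteq> {1, 2}" if "vars p \<subseteq> {1, 2}" "vars q \<subseteq> {1, 2}" for p q :: "'k ternary"
    using vars_add[of p q] that by blast
  ultimately show ?thesis by (simp add: vars_summand)
qed

text \<open>
  A nonzero radical vector, taken as last basis vector, makes the last variable disappear.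
\<close>

lemma nondegenerate_imp_radical_free:
  assumes "nondegenerate (cubic A (0::'k))" shows "radical_free A"
  unfolding radical_free_def
proof (intro allI impI, elim conjE, rule ccontr)
  fix u assume l: "\<forall>w. gram A u w = 0" and r: "\<forall>w. gram A w u = 0" and u: "u \<noteq> 0"
  obtain n :: "'k^3" where "n \<noteq> 0" "(\<Sum>i\<in>UNIV. n$i * u$i) = 0"
  proof (cases "u$1 = 0 \<and> u$2 = 0")
    case True
    then show ?thesis by (intro that[of "vector [1,0,0]"]) (simp_all add: sum_3 vec3_eq_iff)
  next
    case False
    then show ?thesis by (intro that[of "vector [u$2,u$1,0]"]) (auto simp: sum_3 vec3_eq_iff)
  qed
  then obtain b p where "det3 b p u \<noteq> 0" using functional_basis_through u by metis
  then have inv: "invertible (frame b p u)" by (simp add: invertible_frame)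
  let ?g = "lin_subst (frame b p u) (cubic A 0)"
  have "vars ?g \<subseteq> {1, 2}"
    unfolding lin_subst_cubic by (rule vars_cubic_2) (simp_all add: pullback_def column_frame l r)
  then have "card (vars ?g) \<le> card {1::3, 2}" by (intro card_mono) auto
  also have "\<dots> < CARD(3)" by simp
  finally show False using assms inv unfolding nondegenerate_def by blast
qed

lemma congrI:
  assumes "det3 p q r \<noteq> 0" "gram A p p = a" "gram A p q = b" "gram A p r = c"
    "gram A q p = d" "gram A q q = e" "gram A q r = f" "gram A r p = g" "gram A r q = h"
    "gram A r r = (i::'k)"
  shows "congr A (mat3 a b c d e f g h i)"
  using congr_frame[OF assms(1), of A] assms(2-) by simp

text \<open>
  The matrices below belong to cubics \<open>x\<^sup>2(ax + by + cz) + y\<^sup>2(dx + ey) + z\<^sup>2x\<close>, which pass through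
  \<open>[0:0:1]\<close> with tangent line \<open>x = 0\<close>; on this line they restrict to \<open>ey\<^sup>3\<close>.
\<close>

lemma gram_pointed: "gram (mat3 a b c d e 0 1 0 0) u v =
    (u$1)\<^sup>2 * (a * v$1 + b * v$2 + c * v$3) + (u$2)\<^sup>2 * (d * v$1 + e * v$2) + (u$3)\<^sup>2 * (v$1::'k)"
  by (simp add: gram_def sum_3 algebra_simps)

text \<open>
  The last row of the Gram matrix is \<open>h(u, _)\<close> and its last column is \<open>h(_, u)\<close>. The hypothesis on
  \<open>u\<close> makes the entry of the middle basis vector, which is taken from the kernel of \<open>h(u, _)\<close>, vanish
  in the last column as well.
\<close>

lemma congr_pointed:
  fixes A :: "'k^3^3"
  assumes u: "u \<noteq> 0" and uu: "gram A u u = 0" and nz: "gram A u w0 \<noteq> 0"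
    and flex: "\<And>w. gram A u w = 0 \<Longrightarrow> gram A w u = 0"
  obtains a b c d e where "congr A (mat3 a b c d e 0 1 0 0)"
    "(\<forall>w. gram A w u = 0) \<longrightarrow> c = 0"
proof -
  define n where "n = (\<chi> j. gram A u (axis j 1))"
  have n: "gram A u w = (\<Sum>i\<in>UNIV. n$i * w$i)" for w
    unfolding n_def by (subst gram_functional) simp
  have "n \<noteq> 0" using nz unfolding n by auto
  then obtain b p where b: "gram A u b = 1" and p: "gram A u p = 0" and d: "det3 b p u \<noteq> 0"
    using functional_basis_through[of n u] u uu unfolding n by metis
  have "congr A (mat3 (gram A b b) (gram A b p) (gram A b u) (gram A p b) (gram A p p) 0 1 0 0)"
    by (rule congrI[OF d]) (simp_all add: b p uu flex)
  then show thesis by (rule that) simp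
qed

text \<open>
  The vectors \<open>(1, y, t)\<close>, \<open>(0, r, s)\<close> and \<open>(0, 0, 1)\<close> keep the flag formed by \<open>[0:0:1]\<close> and its
  tangent. Four of the nine entries have to be arranged: \<open>r\<close> normalizes the coefficient of \<open>y\<^sup>3\<close>,
  \<open>y\<close> removes \<open>xy\<^sup>2\<close>, \<open>s\<close> removes \<open>x\<^sup>2y\<close> and \<open>t\<close> removes \<open>x\<^sup>3\<close>. This works for \<open>c = 0\<close> and for
  \<open>c \<noteq> 0\<close> alike, so that the cuspidal and the smooth case are treated together.
\<close>

lemma congr_cusp:
  fixes e :: 'k
  assumes "e \<noteq> 0"
  shows "congr (mat3 a b c d e 0 1 0 0) (mat3 0 0 c 0 1 0 1 0 0)"
proof -
  obtain r where "r ^ 3 = 1 / e" using nth_root_exists[of 3 "1 / e"] by auto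
  then have r: "e * r ^ 3 = 1" using assms by simp
  then have r0: "r \<noteq> 0" by auto
  (* Once y is expressed through s, the coefficient of x^2 y becomes this quartic in s. *)
  obtain s where "poly [:b * r + d\<^sup>2 * r ^ 4, c, 0, 0, 1:] s = 0"
    using alg_closed_imp_poly_has_root[of "[:b * r + d\<^sup>2 * r ^ 4, c, 0, 0, 1:]"] by auto
  then have s: "b * r + d\<^sup>2 * r ^ 4 + c * s + s ^ 4 = 0"
    by (simp add: algebra_simps power4_eq_xxxx)
  (* The value of y for which the coefficient of x y^2 vanishes, using 1 / e = r^3. *)
  define y where "y = r * s\<^sup>2 + d * r ^ 3"
  obtain t where "poly [:a + b * y + y\<^sup>2 * (d + e * y), c, 1:] t = 0"
    using alg_closed_imp_poly_has_root[of "[:a + b * y + y\<^sup>2 * (d + e * y), c, 1:]"] by auto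
  then have t: "a + b * y + c * t + y\<^sup>2 * (d + e * y) + t\<^sup>2 = 0"
    by (simp add: algebra_simps power2_eq_square)
  have "e * y = e * r * s\<^sup>2 + d * (e * r ^ 3)"
    by (simp add: y_def algebra_simps)
  then have "e * y = e * r * s\<^sup>2 + d" unfolding r by simp
  then have "r\<^sup>2 * (d + e * y) = e * r ^ 3 * s\<^sup>2"
    by (simp add: algebra_simps power2_eq_square power3_eq_cube)
  then have 1: "r\<^sup>2 * (d + e * y) + s\<^sup>2 = 0"
    unfolding r by simp
  have "y\<^sup>2 * (e * r) = e * r ^ 3 * s ^ 4 + d\<^sup>2 * r ^ 4 * (e * r ^ 3)"
    unfolding y_def square_add
    by (simp add: algebra_simps power2_eq_square power3_eq_cube power4_eq_xxxx)
  then have 2: "b * r + c * s + y\<^sup>2 * (e * r) = 0"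
    unfolding r using s by (simp add: algebra_simps)
  show ?thesis
    by (rule congrI[of "vector [1, y, t]" "vector [0, r, s]" "vector [0, 0, 1]"])
      (use r0 r t 1 2 in \<open>simp_all add: det3_def gram_pointed algebra_simps power2_eq_square power3_eq_cube\<close>)
qed

text \<open>
  The binary cubic \<open>cx\<^sup>2z + xz\<^sup>2\<close> is a sum of two cubes because it has three distinct linear
  factors; the two orthonormal vectors come from the primitive cube roots of unity.
\<close>

lemma congr_fermat:
  fixes c :: 'k
  assumes "c \<noteq> 0"
  shows "congr (mat3 0 0 c 0 1 0 1 0 0) (mat3 1 0 0 0 1 0 0 0 1)"
proof -
  obtain y where y: "y ^ 3 = c" using nth_root_exists[of 3 c] by auto
  then have y0: "y \<noteq> 0" using assms by auto
  obtain w :: 'k where "poly [:1, 1, 1:] w = 0"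
    using alg_closed_imp_poly_has_root[of "[:1, 1, 1:]"] by auto
  then have w': "w + w * w = 1"
    by (simp add: algebra_simps add_eq_0_char_2)
  have w: "w\<^sup>2 = w + 1"
    unfolding w'[symmetric] by (simp add: power2_eq_square)
  have g: "gram (mat3 0 0 c 0 1 0 1 0 0) u v =
    (u$1)\<^sup>2 * (c * v$3) + (u$2)\<^sup>2 * v$2 + (u$3)\<^sup>2 * v$1" for u v
    using gram_pointed[of 0 0 c 0 1 u v] by simp
  (* Scaling by x and y turns c x^2 z + x z^2 into x^2 z + x z^2. *)
  define x where "x = 1 / y\<^sup>2"
  have x: "x * y\<^sup>2 = 1" using y0 by (simp add: x_def)
  have "c * (y * x\<^sup>2) = (x * y\<^sup>2)\<^sup>2"
    unfolding y[symmetric] by (simp add: power2_eq_square power3_eq_cube ac_simps)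
  then have cx: "c * (y * x\<^sup>2) = 1" "c * (w * (y * x\<^sup>2)) = w"
    by (simp_all add: x mult.left_commute[of c w])
  have "x \<noteq> 0 \<and> y \<noteq> 0"
    using x y0 by auto
  then show ?thesis
    by (intro congrI[of "vector [x, 0, w * y]" "vector [0, 1, 0]" "vector [x, 0, (w + 1) * y]"])
      (simp_all add: det3_def g square_add power_mult_distrib w x cx algebra_simps)
qed

text \<open>
  For \<open>c = e = 0\<close> the cubic is \<open>x(ax\<^sup>2 + bxy + dy\<^sup>2 + z\<^sup>2)\<close>, and square roots of \<open>a\<close> and \<open>d\<close> allow
  to absorb two of the terms into \<open>z\<^sup>2\<close>.
\<close>

lemma congr_conic_tangent:
  fixes b :: 'k
  assumes "b \<noteq> 0"
  shows "congr (mat3 a b 0 d 0 0 1 0 0) (mat3 0 0 1 1 0 0 0 0 0)"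
proof -
  obtain x y where "x\<^sup>2 = a" "y\<^sup>2 = d" using sqrt_exists by metis
  then show ?thesis
    by (intro congrI[of "vector [1, 0, x]" "vector [0, 0, 1]" "vector [0, 1/b, y/b]"])
      (use assms in \<open>simp_all add: det3_def gram_pointed field_simps power2_eq_square\<close>)
qed

lemma congr_swap: "congr (mat3 0 0 0 0 1 0 1 0 0) (mat3 0 0 1 0 1 0 0 0 (0::'k))"
  by (rule congrI[of "vector [0, 0, 1]" "vector [0, 1, 0]" "vector [1, 0, 0]"])
    (simp_all add: det3_def gram_pointed)

end

subsection \<open>Flexes and classification\<close>

lemma det3_nonzero_independent:
  fixes u :: "'a::field ^ 3"
  assumes "det3 u v w \<noteq> 0" "a *s u + b *s v + c *s w = 0"
  shows "a = 0" "b = 0" "c = 0"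
proof -
  have "frame u v w *v vector [a, b, c] = 0" using assms(2) by (simp add: frame_mult)
  then have "(vector [a, b, c] :: 'a^3) = 0" using assms(1) invertible_kernel invertible_frame by blast
  then show "a = 0" "b = 0" "c = 0" by (simp_all add: vec3_eq_iff)
qed

text \<open>
  After division by \<open>t\<close> the polynomial has constant term \<open>-1\<close>, and it is not constant, so that it
  has a root, which cannot be \<open>0\<close>.
\<close>

lemma root_of_additive_polynomial:
  fixes a b c :: "'a::alg_closed_field"
  assumes "a \<noteq> 0 \<or> b \<noteq> 0 \<or> c \<noteq> 0"
  obtains t where "t \<noteq> 0" "a * t ^ 64 + b * t ^ 16 + c * t ^ 4 = t"
proof -
  let ?p = "monom a 63 + monom b 15 + monom c 3 - 1"
  have "coeff ?p 63 = a" "coeff ?p 15 = b" "coeff ?p 3 = c"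
    by simp_all
  then obtain n where "coeff ?p n \<noteq> 0" "n > 0"
    using assms by (metis zero_less_numeral)
  then obtain t where "poly ?p t = 0" by (rule poly_root_exists)
  then have t: "a * t ^ 63 + b * t ^ 15 + c * t ^ 3 = 1" by (simp add: poly_monom)
  show thesis
  proof
    show "t \<noteq> 0" using t by auto
    have "t * (a * t ^ 63 + b * t ^ 15 + c * t ^ 3) = t" unfolding t by simp
    then show "a * t ^ 64 + b * t ^ 16 + c * t ^ 4 = t"
      by (simp add: algebra_simps flip: power_Suc)
  qed
qed

lemma solve_for_last:
  fixes x w :: "'a::field ^ 3"
  assumes "x + c *s w = 0" "c \<noteq> 0" shows "w = (- 1 / c) *s x"
proof -
  have "w $ i = - 1 / c * x $ i" for i
  proof -
    have "x $ i + c * w $ i = 0" using assms(1) by (metis vector_add_component vector_smult_component zero_index)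
    then have "c * w $ i = - x $ i" by (simp add: add_eq_0_iff)
    then show ?thesis using assms(2) by (simp add: field_simps)
  qed
  then show ?thesis by (simp add: vec_eq_iff)
qed

lemma gram_eq_mult: "gram A u w = (\<Sum>i\<in>UNIV. (u $ i)\<^sup>2 * (A *v w) $ i)"
  by (simp add: gram_def matrix_vector_mult_def sum_3 algebra_simps)

context alg_closed_char_2
begin

lemma fourth_power_add: "(x + y) ^ 4 = x ^ 4 + (y::'k) ^ 4"
proof -
  have "(x + y) ^ 4 = ((x + y)\<^sup>2)\<^sup>2" by (simp flip: power_mult)
  then show ?thesis unfolding square_add by (simp flip: power_mult)
qed

text \<open>
  A fixed vector is sought in the span of \<open>u\<close>, \<open>T u\<close>, \<open>T (T u)\<close>, cut off at the first linear
  dependence. Comparing coefficients in \<open>T v = v\<close> determines all of them successively from the last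
  one, \<open>t\<close>, and leaves one equation for \<open>t\<close>: the root of an additive polynomial.
\<close>

lemma semilinear_fixed_vector:
  fixes T :: "'k ^ 3 \<Rightarrow> 'k ^ 3"
  assumes add: "\<And>u v. T (u + v) = T u + T v" and scale: "\<And>c u. T (c *s u) = c ^ 4 *s T u"
    and inj: "\<And>u. T u = 0 \<Longrightarrow> u = 0"
  obtains v where "v \<noteq> 0" "T v = v"
proof -
  (* Any nonzero vector would do. *)
  define u where "u = (axis 1 1 :: 'k^3)"
  have u0: "u \<noteq> 0" by (simp add: u_def axis_eq_0_iff)
  have pow: "(x ^ 4) ^ 4 = x ^ 16" "(x ^ 16) ^ 4 = x ^ 64" for x :: 'k
    by (simp_all flip: power_mult)
  show thesis
  proof (cases "\<exists>c. T u = c *s u")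
    case True
    then obtain c where c: "T u = c *s u" ..
    then have "c \<noteq> 0" using inj u0 by force
    then obtain s where s: "s \<noteq> 0" "c * s ^ 4 = s"
      using root_of_additive_polynomial[of 0 0 c] by auto
    have "T (s *s u) = (c * s ^ 4) *s u" unfolding scale c by simp
    then show thesis using that[of "s *s u"] s u0 by simp
  next
    case indep2: False
    show thesis
    proof (cases "\<exists>a b. T (T u) = a *s u + b *s T u")
      case True
      then obtain a b where ab: "T (T u) = a *s u + b *s T u" by auto
      have "a \<noteq> 0 \<or> b \<noteq> 0" using ab inj u0 by force
      then obtain t where t: "t \<noteq> 0" "a ^ 4 * t ^ 16 + b * t ^ 4 = t"
        using root_of_additive_polynomial[of 0 "a ^ 4" b] by auto
      let ?v = "(a * t ^ 4) *s u + t *s T u"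
      have "T ?v = ((a * t ^ 4) ^ 4) *s T u + t ^ 4 *s (a *s u + b *s T u)"
        unfolding add scale ab ..
      also have "\<dots> = (a * t ^ 4) *s u + (a ^ 4 * t ^ 16 + b * t ^ 4) *s T u"
        by (simp add: power_mult_distrib pow vec3_eq_iff algebra_simps)
      finally have "T ?v = ?v" unfolding t .
      moreover have "?v \<noteq> 0"
      proof
        assume "?v = 0"
        then have "T u = (- 1 / t * (a * t ^ 4)) *s u"
          using solve_for_last[OF _ t(1)] by (metis vector_smult_assoc)
        then show False using indep2 by blast
      qed
      ultimately show thesis using that by blast
    next
      case indep3: False
      have d: "det3 u (T u) (T (T u)) \<noteq> 0"
      proof
        assume "det3 u (T u) (T (T u)) = 0"
        then obtain a b c where abc: "a *s u + b *s T u + c *s T (T u) = 0" "a \<noteq> 0 \<or> b \<noteq> 0 \<or> c \<noteq> 0"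
          by (rule det3_zero_relation)
        have "c = 0"
        proof (rule ccontr)
          assume "c \<noteq> 0"
          then have "T (T u) = (- 1 / c) *s (a *s u + b *s T u)"
            using solve_for_last abc(1) by blast
          then have "T (T u) = (- 1 / c * a) *s u + (- 1 / c * b) *s T u"
            by (simp only: vector_add_ldistrib vector_smult_assoc)
          then show False using indep3 by blast
        qed
        moreover from this have "b = 0"
          using abc(1) solve_for_last[of "a *s u" b "T u"] indep2
          by (metis add.right_neutral vector_smult_assoc vector_smult_lzero)
        ultimately show False using abc u0 by simp
      qed
      obtain a b c where abc: "T (T (T u)) = a *s u + b *s T u + c *s T (T u)"
        using det3_nonzero_expand[OF d] .
      have indep: "z = 0" if "x *s u + y *s T u + z *s T (T u) = 0" for x y z
        using that det3_nonzero_independent[OF d] by blast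
      have "a \<noteq> 0 \<or> b \<noteq> 0 \<or> c \<noteq> 0" using abc inj u0 by force
      then obtain t where t: "t \<noteq> 0" "a ^ 16 * t ^ 64 + b ^ 4 * t ^ 16 + c * t ^ 4 = t"
        using root_of_additive_polynomial[of "a ^ 16" "b ^ 4" c] by auto
      (* The coefficients of u and T u that the comparison of coefficients in T v = v forces. *)
      let ?y = "(a * t ^ 4) ^ 4 + b * t ^ 4"
      let ?v = "(a * t ^ 4) *s u + ?y *s T u + t *s T (T u)"
      have "?v = 0 \<Longrightarrow> False" using indep t by blast
      have y: "?y ^ 4 = a ^ 16 * t ^ 64 + b ^ 4 * t ^ 16"
        by (simp add: fourth_power_add power_mult_distrib pow)
      have "T ?v = ((a * t ^ 4) ^ 4) *s T u + ?y ^ 4 *s T (T u) + t ^ 4 *s (a *s u + b *s T u + c *s T (T u))"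
        unfolding add scale abc ..
      also have "\<dots> = (a * t ^ 4) *s u + ?y *s T u + (a ^ 16 * t ^ 64 + b ^ 4 * t ^ 16 + c * t ^ 4) *s T (T u)"
        unfolding y by (simp add: vec3_eq_iff algebra_simps)
      finally have "T ?v = ?v" unfolding t .
      then show thesis using that \<open>?v = 0 \<Longrightarrow> False\<close> by blast
    qed
  qed
qed

lemma invertible_gram_functional:
  assumes "invertible (A::'k^3^3)" "u \<noteq> 0" obtains w where "gram A u w \<noteq> 0"
proof -
  let ?s = "(\<chi> i. (u $ i)\<^sup>2) :: 'k^3"
  have "transpose A *v ?s \<noteq> 0"
  proof
    assume "transpose A *v ?s = 0"
    then have "?s = 0"
      using assms(1) by (metis det_transpose invertible_det_nz invertible_kernel)
    then show False using assms(2) by (simp add: vec_eq_iff)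
  qed
  then obtain j where j: "(transpose A *v ?s) $ j \<noteq> 0" by (auto simp: vec_eq_iff)
  have "gram A u (axis j 1) = (transpose A *v ?s) $ j"
    using exhaust_3[of j]
    by (auto simp: gram_def matrix_vector_mult_def transpose_def axis_def sum_3)
  then show thesis using j that by metis
qed

text \<open>
  The square of \<open>h(v, u)\<close> is semilinear in \<open>u\<close> for the Frobenius map, hence of the form \<open>h(u, T v)\<close>
  with \<open>T\<close> semilinear for its square.
\<close>

lemma gram_fixed_vector:
  assumes "invertible (A::'k^3^3)"
  obtains v where "v \<noteq> 0" "\<forall>u. gram A u v = (gram A v u)\<^sup>2"
proof -
  obtain C where C: "A ** C = mat 1" "C ** A = mat 1" using assms by (auto simp: invertible_def)
  (* T v is the solution of A (T v) = P v^(4): P is the transpose of the matrix of squared entries. *)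
  define P :: "'k^3^3" where "P = (\<chi> i j. (A $ j $ i)\<^sup>2)"
  define T where "T v = C *v (P *v (\<chi> i. (v $ i) ^ 4))" for v :: "'k^3"
  have "A *v (C *v y) = y" for y
    by (simp add: matrix_vector_mul_assoc C)
  then have AT: "A *v T v = P *v (\<chi> i. (v $ i) ^ 4)" for v
    unfolding T_def .
  have key: "gram A u (T v) = (gram A v u)\<^sup>2" for u v
  proof -
    have "gram A u (T v) = (\<Sum>i\<in>UNIV. (u $ i)\<^sup>2 * (P *v (\<chi> i. (v $ i) ^ 4)) $ i)"
      by (simp only: gram_eq_mult AT)
    then show ?thesis
      by (simp add: gram_def matrix_vector_mult_def P_def sum_3 square_add power_mult_distrib
          algebra_simps)
  qed
  obtain v where "v \<noteq> 0" "T v = v"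
  proof (rule semilinear_fixed_vector)
    show "T (u + v) = T u + T v" for u v
    proof -
      have "(\<chi> i. ((u + v) $ i) ^ 4) = (\<chi> i. (u $ i) ^ 4) + (\<chi> i. (v $ i) ^ 4)"
        by (simp add: vec_eq_iff fourth_power_add)
      then show ?thesis by (simp only: T_def matrix_vector_right_distrib)
    qed
    show "T (c *s u) = c ^ 4 *s T u" for c u
    proof -
      have "(\<chi> i. ((c *s u) $ i) ^ 4) = c ^ 4 *s (\<chi> i. (u $ i) ^ 4)"
        by (simp add: vec_eq_iff power_mult_distrib)
      then show ?thesis by (simp add: T_def vector_scalar_commute)
    qed
    show "u = 0" if "T u = 0" for u
    proof (rule ccontr)
      assume "u \<noteq> 0"
      then obtain w where "gram A u w \<noteq> 0" using invertible_gram_functional assms by blast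
      then show False using key[of w u] that by simp
    qed
  qed blast
  show thesis
  proof (rule that[OF \<open>v \<noteq> 0\<close>])
    show "\<forall>u. gram A u v = (gram A v u)\<^sup>2" using key[of _ v] \<open>T v = v\<close> by simp
  qed
qed

text \<open>
  Take a vector \<open>v\<close> with \<open>h(w, v) = h(v, w)\<^sup>2\<close>. If it is isotropic, it is the flex. Otherwise the
  space is the orthogonal sum of \<open>v\<close> and the kernel of \<open>h(v, _)\<close>. On this plane the cubic has a zero
  \<open>w\<close>, and the kernel of \<open>h(w, _)\<close> is spanned by \<open>v\<close> and \<open>w\<close>, which are both left orthogonal to
  \<open>w\<close>.
\<close>

lemma flex_exists:
  assumes A: "invertible (A::'k^3^3)"
  obtains u where "u \<noteq> 0" "gram A u u = 0" "\<forall>w. gram A u w = 0 \<longrightarrow> gram A w u = 0"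
proof -
  obtain v where v: "v \<noteq> 0" "\<forall>u. gram A u v = (gram A v u)\<^sup>2"
    by (rule gram_fixed_vector[OF A])
  show thesis
  proof (cases "gram A v v = 0")
    case True
    have "gram A w v = (gram A v w)\<^sup>2" for w using v(2) by blast
    then show ?thesis using that[OF v(1) True] by simp
  next
    case vv: False
    define n where "n = (\<chi> j. gram A v (axis j 1))"
    have n: "gram A v w = (\<Sum>i\<in>UNIV. n$i * w$i)" for w
      unfolding n_def by (subst gram_functional) simp
    have "n \<noteq> 0" using vv unfolding n by auto
    then obtain b p q where pq: "gram A v p = 0" "gram A v q = 0" "det3 b p q \<noteq> 0"
      using functional_basis[of n] unfolding n by metis
    obtain w where w: "w \<noteq> 0" "gram A v w = 0" "gram A w w = 0"
    proof (cases "gram A p p = 0")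
      case True
      moreover have "p \<noteq> 0" using pq(3) by (auto simp: det3_def)
      ultimately show thesis using that pq(1) by blast
    next
      case False
      obtain s where "poly [:gram A q q, gram A q p, gram A p q, gram A p p:] s = 0"
        using alg_closed_imp_poly_has_root[of "[:gram A q q, gram A q p, gram A p q, gram A p p:]"] False
        by auto
      then have "gram A (s *s p + q) (s *s p + q) = 0"
        by (simp add: gram_simps algebra_simps power2_eq_square)
      moreover have "s *s p + q \<noteq> 0"
        using det3_nonzero_independent(3)[OF pq(3), of 0 s 1] by auto
      moreover have "gram A v (s *s p + q) = 0"
        by (simp add: gram_simps pq)
      ultimately show thesis using that by blast
    qed
    have wv: "gram A w v = 0" using v(2)[rule_format, of w] w(2) by simp
    obtain z where z: "gram A w z \<noteq> 0" using invertible_gram_functional[OF A w(1)] .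
    have "gram A x w = 0" if x: "gram A w x = 0" for x
    proof -
      have "det3 v w x = 0"
      proof (rule ccontr)
        assume "det3 v w x \<noteq> 0"
        then obtain a b c where "z = a *s v + b *s w + c *s x" by (rule det3_nonzero_expand)
        then show False using z w(3) x wv by (simp add: gram_simps)
      qed
      then obtain a b c where abc: "a *s v + b *s w + c *s x = 0" "a \<noteq> 0 \<or> b \<noteq> 0 \<or> c \<noteq> 0"
        by (rule det3_zero_relation)
      have "c \<noteq> 0"
      proof
        assume c: "c = 0"
        have "gram A v (a *s v + b *s w + c *s x) = a * gram A v v"
          by (simp add: gram_simps w c)
        then have "a = 0" using abc(1) vv by simp
        then show False using abc c w(1) by simp
      qed
      then have "x = (- 1 / c) *s (a *s v + b *s w)"
        using solve_for_last abc(1) by blast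
      then show ?thesis by (simp add: gram_simps w)
    qed
    then show ?thesis using that[OF w(1) w(3)] by blast
  qed
qed

text \<open>
  In the normal form at a flex both \<open>e\<close> and \<open>c\<close> are nonzero, since otherwise the matrix has a kernel.
\<close>

theorem invertible_congr_fermat:
  assumes A: "invertible (A::'k^3^3)"
  shows "congr A (mat3 1 0 0 0 1 0 0 0 1)"
proof -
  obtain u where u: "u \<noteq> 0" "gram A u u = 0" "\<forall>w. gram A u w = 0 \<longrightarrow> gram A w u = 0"
    by (rule flex_exists[OF A])
  obtain w0 where "gram A u w0 \<noteq> 0" using invertible_gram_functional[OF A u(1)] .
  then obtain a b c d e where congr: "congr A (mat3 a b c d e 0 1 0 0)"
    using congr_pointed[OF u(1,2)] u(3) by metis
  then obtain B where inv: "invertible B" and B: "mat3 a b c d e 0 1 0 0 = pullback A B"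
    unfolding congr_def by blast
  have nz: "\<exists>w. gram (mat3 a b c d e 0 1 0 0) w x \<noteq> 0" if "x \<noteq> 0" for x
  proof (rule ccontr)
    assume "\<nexists>w. gram (mat3 a b c d e 0 1 0 0) w x \<noteq> 0"
    then have z: "gram A (B *v w) (B *v x) = 0" for w
      unfolding B gram_pullback by blast
    obtain C where C: "B ** C = mat 1" using inv by (auto simp: invertible_def)
    have "(A *v (B *v x)) $ i = 0" for i
      using z[of "C *v axis i 1"] exhaust_3[of i]
      by (auto simp: matrix_vector_mul_assoc C gram_eq_mult axis_def sum_3)
    then have "A *v (B *v x) = 0" by (simp add: vec_eq_iff)
    then show False using that invertible_kernel[OF A] invertible_kernel[OF inv] by blast
  qed
  have e: "e \<noteq> 0"
  proof
    assume "e = 0"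
    show False
    proof (cases "b = 0")
      case True
      then show False using nz[of "vector [0, 1, 0]"] \<open>e = 0\<close>
        by (auto simp: gram_pointed vec3_eq_iff)
    next
      case False
      then show False using nz[of "vector [0, c, b]"] \<open>e = 0\<close>
        by (auto simp: gram_pointed vec3_eq_iff mult.commute)
    qed
  qed
  have c: "c \<noteq> 0"
    using nz[of "vector [0, 0, 1]"] by (auto simp: gram_pointed vec3_eq_iff)
  show ?thesis
    using congr_trans[OF congr_trans[OF congr congr_cusp[OF e]] congr_fermat[OF c]] .
qed

text \<open>
  A kernel vector of a singular matrix serves as the distinguished point, and then \<open>c = 0\<close>. What
  remains is the dichotomy \<open>e \<noteq> 0\<close> (cusp) or \<open>e = 0\<close> (conic and tangent); if \<open>b\<close> vanishes in the
  second case, there is a radical vector.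
\<close>

theorem radical_free_classification:
  assumes "radical_free (A::'k^3^3)"
  shows "congr A (mat3 1 0 0 0 1 0 0 0 1) \<or> congr A (mat3 0 0 1 0 1 0 0 0 0)
    \<or> congr A (mat3 0 0 1 1 0 0 0 0 0)"
proof (cases "invertible A")
  case True
  then show ?thesis using invertible_congr_fermat by blast
next
  case False
  then obtain u where u: "u \<noteq> 0" "A *v u = 0" by (rule singular_matrix_kernel)
  have wu: "gram A w u = 0" for w
    by (simp add: gram_eq_mult u)
  obtain w0 where w0: "gram A u w0 \<noteq> 0"
    using assms u(1) wu unfolding radical_free_def by blast
  obtain a b d e where congr: "congr A (mat3 a b 0 d e 0 1 0 0)"
    using congr_pointed[OF u(1) wu w0 wu] wu by metis
  show ?thesis
  proof (cases "e = 0")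
    case False
    show ?thesis
      using congr_trans[OF congr_trans[OF congr congr_cusp[OF False]] congr_swap]
      by simp
  next
    case e: True
    have "b \<noteq> 0"
    proof
      assume "b = 0"
      (* The cubic is x (a x^2 + (k y + z)^2), so that (0, 1, k) is a radical vector. *)
      obtain k where k: "k\<^sup>2 = d" using sqrt_exists .
      have "(vector [0, 1, k] :: 'k^3) = 0"
        using congr_radical_free[OF congr assms] e \<open>b = 0\<close> k
        unfolding radical_free_def gram_pointed by simp
      then show False by (simp add: vec3_eq_iff)
    qed
    then show ?thesis using congr_trans[OF _ congr_conic_tangent] congr e by blast
  qed
qed

end

section \<open>Purity of the Frobenius map\<close>

subsection \<open>Tensor products and split maps\<close>

text \<open>
  The first factor \<open>N\<close> stands for the ring or for the target of its Frobenius map. Its closure under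
  the operations places the tensor relations in the free abelian group on \<open>N \<times> M\<close>.
\<close>

locale tensor_pair = module R M
  for R :: "('r, 'c) ring_scheme" (structure) and M :: "('r, 'm, 'e) module_scheme" (structure) +
  fixes N :: "('r, 'n, 'd) module_scheme" (structure)
  assumes add_closed_N: "\<lbrakk>a \<in> carrier N; b \<in> carrier N\<rbrakk> \<Longrightarrow> a \<oplus>\<^bsub>N\<^esub> b \<in> carrier N"
    and smult_closed_N: "\<lbrakk>r \<in> carrier R; a \<in> carrier N\<rbrakk> \<Longrightarrow> r \<odot>\<^bsub>N\<^esub> a \<in> carrier N"
begin

abbreviation "F \<equiv> free_Abelian_group (carrier N \<times> carrier M)"
abbreviation "K \<equiv> tensor_kernel R N M"

lemma relations_in_carrier: "tensor_relations R N M \<subseteq> carrier F"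
  unfolding tensor_relations_def
  using add_closed_N smult_closed_N M.add.m_closed
  by (auto dest!: subsetD[OF keys_diff])

lemma kernel_subgroup: "subgroup K F"
  unfolding tensor_kernel_def
  by (rule group.generate_is_subgroup[OF group_free_Abelian_group relations_in_carrier])

lemma kernel_keys: "u \<in> K \<Longrightarrow> Poly_Mapping.keys u \<subseteq> carrier N \<times> carrier M"
  using subgroup.mem_carrier[OF kernel_subgroup] by simp

lemma kernel_zero: "0 \<in> K"
  using subgroup.one_closed[OF kernel_subgroup] by simp

lemma kernel_add: "u \<in> K \<Longrightarrow> v \<in> K \<Longrightarrow> u + v \<in> K"
  using subgroup.m_closed[OF kernel_subgroup] by simp

lemma kernel_minus: "u \<in> K \<Longrightarrow> - u \<in> K"
  using subgroup.m_inv_closed[OF kernel_subgroup] kernel_keys by fastforce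

lemma kernel_diff: "u \<in> K \<Longrightarrow> v \<in> K \<Longrightarrow> u - v \<in> K"
  using kernel_add kernel_minus by fastforce

lemma kernel_relation: "u \<in> tensor_relations R N M \<Longrightarrow> u \<in> K"
  unfolding tensor_kernel_def by (rule generate.incl)

text \<open>
  Generation by differences alone suffices in an abelian group, and this spares the inductions below
  the bookkeeping of supports.
\<close>

lemma kernel_induct [consumes 1, case_names zero relation diff]:
  assumes "u \<in> K" and zero: "P 0" and rel: "\<And>x. x \<in> tensor_relations R N M \<Longrightarrow> P x"
    and diff: "\<And>x y. P x \<Longrightarrow> P y \<Longrightarrow> P (x - y)"
  shows "P u"
  using assms(1) unfolding tensor_kernel_def
proof (induction rule: generate.induct)
  case one
  then show ?case using zero by simp
next
  case (incl h)
  then show ?case by (rule rel)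
next
  case (inv h)
  then have "inv\<^bsub>F\<^esub> h = 0 - h" using relations_in_carrier by auto
  then show ?case using diff[OF zero rel[OF inv]] by simp
next
  case (eng x y)
  have "P (x - (0 - y))" using eng zero by (intro diff)
  then show ?case by simp
qed

lemma kernel_add_left:
  assumes "a \<in> carrier N" "b \<in> carrier N" "x \<in> carrier M"
  shows "frag_of (a \<oplus>\<^bsub>N\<^esub> b, x) - frag_of (a, x) - frag_of (b, x) \<in> K"
  by (rule kernel_relation) (use assms in \<open>unfold tensor_relations_def, blast\<close>)

lemma kernel_balance:
  assumes "r \<in> carrier R" "a \<in> carrier N" "x \<in> carrier M"
  shows "frag_of (r \<odot>\<^bsub>N\<^esub> a, x) - frag_of (a, r \<odot>\<^bsub>M\<^esub> x) \<in> K"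
  by (rule kernel_relation) (use assms in \<open>unfold tensor_relations_def, blast\<close>)

lemma kernel_zero_right:
  assumes "a \<in> carrier N" shows "frag_of (a, \<zero>\<^bsub>M\<^esub>) \<in> K"
proof -
  have "frag_of (a, \<zero>\<^bsub>M\<^esub> \<oplus>\<^bsub>M\<^esub> \<zero>\<^bsub>M\<^esub>) - frag_of (a, \<zero>\<^bsub>M\<^esub>) - frag_of (a, \<zero>\<^bsub>M\<^esub>) \<in> K"
    by (rule kernel_relation) (use assms in \<open>unfold tensor_relations_def, blast\<close>)
  then show ?thesis using kernel_minus by fastforce
qed

lemma coset_eq: "K #>\<^bsub>F\<^esub> u = {k + u | k. k \<in> K}"
  by (auto simp: r_coset_def)

lemma tensor_carrier: "carrier (tensor R N M) = {K #>\<^bsub>F\<^esub> u | u. u \<in> carrier F}"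
  by (auto simp: tensor_def FactGroup_def RCOSETS_def)

end

text \<open>
  The map on representatives that underlies \<open>tensor_map\<close>.
\<close>

definition frag_map :: "('a \<Rightarrow> 'b) \<Rightarrow> ('a \<times> 'm \<Rightarrow>\<^sub>0 int) \<Rightarrow> ('b \<times> 'm \<Rightarrow>\<^sub>0 int)" where
  "frag_map h = frag_extend (\<lambda>(a, x). frag_of (h a, x))"

lemma frag_map_simps [simp]:
  "frag_map h 0 = 0" "frag_map h (frag_of (a, x)) = frag_of (h a, x)"
  "frag_map h (u + v) = frag_map h u + frag_map h v"
  "frag_map h (u - v) = frag_map h u - frag_map h v"
  by (simp_all add: frag_map_def frag_extend_add frag_extend_diff)

lemma frag_map_kernel:
  assumes "tensor_pair R M N" "tensor_pair R M N'"
    and closed: "\<And>a. a \<in> carrier N \<Longrightarrow> h a \<in> carrier N'"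
    and additive: "\<And>a b. \<lbrakk>a \<in> carrier N; b \<in> carrier N\<rbrakk> \<Longrightarrow> h (a \<oplus>\<^bsub>N\<^esub> b) = h a \<oplus>\<^bsub>N'\<^esub> h b"
    and linear: "\<And>r a. \<lbrakk>r \<in> carrier R; a \<in> carrier N\<rbrakk> \<Longrightarrow> h (r \<odot>\<^bsub>N\<^esub> a) = r \<odot>\<^bsub>N'\<^esub> h a"
    and "u \<in> tensor_kernel R N M"
  shows "frag_map h u \<in> tensor_kernel R N' M"
proof -
  interpret N: tensor_pair R M N by fact
  interpret N': tensor_pair R M N' by fact
  show ?thesis using assms(6)
  proof (induction rule: N.kernel_induct)
    case zero
    then show ?case by (simp add: N'.kernel_zero)
  next
    case (relation x)
    then have "frag_map h x \<in> tensor_relations R N' M"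
      unfolding tensor_relations_def using closed
      by (elim UnE CollectE exE conjE) (simp_all add: additive linear, blast+)
    then show ?case by (rule N'.kernel_relation)
  next
    case (diff x y)
    then show ?case by (simp add: N'.kernel_diff)
  qed
qed

text \<open>
  A linear left inverse \<open>g\<close> of \<open>h\<close> maps relations to relations. So if \<open>h\<close> identifies two elements
  modulo relations, applying \<open>g\<close> shows that they were already equal modulo relations.
\<close>

lemma split_imp_tensor_inj:
  assumes "tensor_pair R M N" "tensor_pair R M N'"
    and closed: "\<And>a. a \<in> carrier N' \<Longrightarrow> g a \<in> carrier N"
    and additive: "\<And>a b. \<lbrakk>a \<in> carrier N'; b \<in> carrier N'\<rbrakk> \<Longrightarrow> g (a \<oplus>\<^bsub>N'\<^esub> b) = g a \<oplus>\<^bsub>N\<^esub> g b"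
    and linear: "\<And>r a. \<lbrakk>r \<in> carrier R; a \<in> carrier N'\<rbrakk> \<Longrightarrow> g (r \<odot>\<^bsub>N'\<^esub> a) = r \<odot>\<^bsub>N\<^esub> g a"
    and split: "\<And>a. a \<in> carrier N \<Longrightarrow> g (h a) = a"
  shows "inj_on (tensor_map R N' M h) (carrier (tensor R N M))"
proof -
  interpret N: tensor_pair R M N by fact
  interpret N': tensor_pair R M N' by fact
  have retract: "frag_map g (frag_map h u) = u" if "u \<in> carrier N.F" for u
  proof -
    have "Poly_Mapping.keys u \<subseteq> carrier N \<times> carrier M" using that by simp
    then show ?thesis by (induction rule: frag_induction) (auto simp: split)
  qed
  have coset_carrier: "u \<in> carrier N.F" if "C \<in> carrier (tensor R N M)" "u \<in> C" for C u
    using that N.kernel_keys unfolding N.tensor_carrier N.coset_eq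
    by (fastforce dest: subsetD[OF keys_add])
  have diff: "\<exists>u2\<in>C2. u1 - u2 \<in> N.K"
    if C: "C1 \<in> carrier (tensor R N M)" "C2 \<in> carrier (tensor R N M)" "u1 \<in> C1"
      and eq: "tensor_map R N' M h C1 = tensor_map R N' M h C2" for C1 C2 u1
  proof -
    have "frag_map h u1 \<in> tensor_map R N' M h C1"
      unfolding tensor_map_def N'.coset_eq frag_map_def[symmetric]
      using C(3) N'.kernel_zero by force
    then obtain u2 k where u2: "u2 \<in> C2" "k \<in> N'.K" "frag_map h u1 = k + frag_map h u2"
      unfolding eq unfolding tensor_map_def N'.coset_eq frag_map_def[symmetric] by blast
    then have "frag_map g (frag_map h u1) = frag_map g k + frag_map g (frag_map h u2)" by simp
    then have "u1 - u2 = frag_map g k" using coset_carrier C u2(1) retract by simp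
    moreover have "frag_map g k \<in> N.K"
      by (rule frag_map_kernel[OF assms(2,1) closed additive linear u2(2)])
    ultimately show ?thesis by (intro bexI[OF _ u2(1)]) (simp only:)
  qed
  have subset: "C1 \<subseteq> C2"
    if C: "C1 \<in> carrier (tensor R N M)" "C2 \<in> carrier (tensor R N M)"
      and eq: "tensor_map R N' M h C1 = tensor_map R N' M h C2" for C1 C2
  proof
    fix u1 assume "u1 \<in> C1"
    then obtain u2 where u2: "u2 \<in> C2" "u1 - u2 \<in> N.K" using diff C eq by blast
    obtain v where v: "C2 = {k + v | k. k \<in> N.K}"
      using C(2) unfolding N.tensor_carrier N.coset_eq by blast
    then obtain k where k: "u2 = k + v" "k \<in> N.K" using u2(1) by blast
    have "u1 = ((u1 - u2) + k) + v" using k by simp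
    then show "u1 \<in> C2" unfolding v using N.kernel_add[OF u2(2) k(2)] by blast
  qed
  show ?thesis
    by (rule inj_onI) (metis subset subset_antisym)
qed

lemma regular_module_simps [simp]:
  "carrier (regular_module R) = carrier R" "a \<oplus>\<^bsub>regular_module R\<^esub> b = a \<oplus>\<^bsub>R\<^esub> b"
  "r \<odot>\<^bsub>regular_module R\<^esub> a = r \<otimes>\<^bsub>R\<^esub> a"
  "carrier (frobenius_module p R) = carrier R" "a \<oplus>\<^bsub>frobenius_module p R\<^esub> b = a \<oplus>\<^bsub>R\<^esub> b"
  "r \<odot>\<^bsub>frobenius_module p R\<^esub> a = (r [^]\<^bsub>R\<^esub> p) \<otimes>\<^bsub>R\<^esub> a"
  by (simp_all add: regular_module_def frobenius_module_def)

lemma tensor_pair_regular: "Module.module R M \<Longrightarrow> tensor_pair R M (regular_module R)"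
  and tensor_pair_frobenius: "Module.module R M \<Longrightarrow> tensor_pair R M (frobenius_module p R)"
  by (auto simp: tensor_pair_def tensor_pair_axioms_def Module.module_def cring_def
      intro!: ring.ring_simprules monoid.nat_pow_closed ring.is_monoid)

theorem Frobenius_split_imp_F_pure:
  fixes R :: "('r, 'c) ring_scheme" (structure)
  assumes closed: "\<And>a. a \<in> carrier R \<Longrightarrow> g a \<in> carrier R"
    and additive: "\<And>a b. \<lbrakk>a \<in> carrier R; b \<in> carrier R\<rbrakk> \<Longrightarrow> g (a \<oplus> b) = g a \<oplus> g b"
    and linear: "\<And>r a. \<lbrakk>r \<in> carrier R; a \<in> carrier R\<rbrakk> \<Longrightarrow> g ((r [^] p) \<otimes> a) = r \<otimes> g a"
    and split: "\<And>a. a \<in> carrier R \<Longrightarrow> g (a [^] p) = a"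
  shows "F_pure_ring T p R"
  unfolding F_pure_ring_def pure_linear_def
proof (intro allI impI)
  fix M assume M: "Module.module R M"
  show "inj_on (tensor_map R (frobenius_module p R) M (\<lambda>r. r [^] p))
      (carrier (tensor R (regular_module R) M))"
    by (rule split_imp_tensor_inj[OF tensor_pair_regular[OF M] tensor_pair_frobenius[OF M], where g = g])
      (simp_all add: assms)
qed

subsection \<open>The coordinate ring\<close>

lemma ring_of_type_algebra_simps [simp]:
  "carrier ring_of_type_algebra = UNIV"
  "a \<oplus>\<^bsub>ring_of_type_algebra\<^esub> b = a + b" "a \<otimes>\<^bsub>ring_of_type_algebra\<^esub> b = a * b"
  "\<one>\<^bsub>ring_of_type_algebra\<^esub> = 1" "\<zero>\<^bsub>ring_of_type_algebra\<^esub> = 0"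
  for a b :: "'a::comm_ring_1"
  by (simp_all add: ring_of_type_algebra_def)

lemma ring_of_type_algebra_minus [simp]:
  "a \<ominus>\<^bsub>ring_of_type_algebra\<^esub> b = a - (b :: 'a::comm_ring_1)"
proof -
  interpret ring "ring_of_type_algebra :: 'a ring" by (rule ring_from_type_algebra)
  have "\<ominus>\<^bsub>ring_of_type_algebra\<^esub> b = - b"
    by (rule minus_equality) simp_all
  then show ?thesis by (simp add: a_minus_def)
qed

text \<open>
  The class of a polynomial in the coordinate ring.
\<close>

definition residue_class :: "('v, 'a::comm_ring_1) mpoly \<Rightarrow> ('v, 'a) mpoly \<Rightarrow> ('v, 'a) mpoly set" where
  "residue_class f p = (Idl\<^bsub>ring_of_type_algebra\<^esub> {f}) +>\<^bsub>ring_of_type_algebra\<^esub> p"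

context
  fixes f :: "('v, 'a::comm_ring_1) mpoly"
begin

interpretation S: cring "ring_of_type_algebra :: ('v, 'a) mpoly ring"
  by (rule cring_from_type_algebra)

interpretation J: ideal "Idl\<^bsub>ring_of_type_algebra\<^esub> {f}" ring_of_type_algebra
  by (rule S.genideal_ideal) simp

interpretation hom: ring_hom_ring ring_of_type_algebra "coord_ring f" "residue_class f"
  using J.rcos_ring_hom_ring unfolding coord_ring_def residue_class_def[abs_def] .

lemma principal_ideal_mem: "p \<in> Idl\<^bsub>ring_of_type_algebra\<^esub> {f} \<longleftrightarrow> f dvd p"
  using S.cgenideal_eq_genideal[of f] by (auto simp: cgenideal_def dvd_def mult.commute)

lemma coord_ring_cring: "cring (coord_ring f)"
  unfolding coord_ring_def by (rule J.quotient_is_cring) (rule S.cring_axioms)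

lemma carrier_coord_ring: "carrier (coord_ring f) = range (residue_class f)"
  by (auto simp: coord_ring_def FactRing_def A_RCOSETS_def' residue_class_def)

lemma residue_class_add: "residue_class f p \<oplus>\<^bsub>coord_ring f\<^esub> residue_class f q = residue_class f (p + q)"
  and residue_class_mult: "residue_class f p \<otimes>\<^bsub>coord_ring f\<^esub> residue_class f q = residue_class f (p * q)"
  using hom.hom_add[of p q] hom.hom_mult[of p q] by simp_all

lemma residue_class_power: "residue_class f p [^]\<^bsub>coord_ring f\<^esub> (n::nat) = residue_class f (p ^ n)"
  using hom.hom_one by (induction n) (simp_all add: residue_class_mult mult.commute)

lemma residue_class_eq_iff: "residue_class f p = residue_class f q \<longleftrightarrow> f dvd p - q"
  using S.quotient_eq_iff_same_a_r_cos[OF J.is_ideal, of p q]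
  by (simp add: residue_class_def principal_ideal_mem)

lemma residue_class_ideal:
  assumes "\<And>p q. p \<in> I \<Longrightarrow> q \<in> I \<Longrightarrow> p + q \<in> I" "\<And>p q. p \<in> I \<Longrightarrow> q * p \<in> I" "0 \<in> I"
  shows "ideal (residue_class f ` I) (coord_ring f)"
proof -
  have "ideal I ring_of_type_algebra"
  proof (rule idealI)
    show "subgroup I (add_monoid ring_of_type_algebra)"
    proof (rule subgroup.intro)
      have "\<ominus>\<^bsub>ring_of_type_algebra\<^esub> x = -1 * x" for x :: "('v, 'a) mpoly"
        using ring_of_type_algebra_minus[of 0 x] by (simp add: a_minus_def)
      then show "inv\<^bsub>add_monoid ring_of_type_algebra\<^esub> x \<in> I" if "x \<in> I" for x
        using assms(2)[OF that, of "-1"] by (simp add: a_inv_def)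
    qed (use assms in auto)
  qed (use assms in \<open>auto simp: mult.commute S.ring_axioms\<close>)
  then show ?thesis
    using S.ring_ideal_imp_quot_ideal[OF J.is_ideal]
    unfolding coord_ring_def residue_class_def[abs_def] by blast
qed

end

subsection \<open>Cubics with a mixed term\<close>

text \<open>
  Square roots are unique in characteristic two, so that the choice does not matter there.
\<close>

definition char2_root :: "'a::field \<Rightarrow> 'a" where "char2_root x = (SOME y. y\<^sup>2 = x)"

definition odd_monom :: "(3 \<Rightarrow>\<^sub>0 nat) \<Rightarrow> (3 \<Rightarrow>\<^sub>0 nat)" where
  "odd_monom m = m + m + (\<Sum>i\<in>UNIV. Poly_Mapping.single i 1)"

lemma lookup_odd_monom: "Poly_Mapping.lookup (odd_monom m) i = 2 * Poly_Mapping.lookup m i + 1"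
  by (simp add: odd_monom_def lookup_add lookup_sum lookup_single when_def)

lemma inj_odd_monom: "inj odd_monom"
proof (rule injI)
  fix m n assume "odd_monom m = odd_monom n"
  then have "2 * Poly_Mapping.lookup m i + 1 = 2 * Poly_Mapping.lookup n i + 1" for i
    by (metis lookup_odd_monom)
  then show "m = n" by (intro poly_mapping_eqI) simp
qed

text \<open>
  The map \<open>\<Phi>\<close> with \<open>\<Phi>(a x\<^sup>2\<^sup>m\<^sup>+\<^sup>1) = \<surd>a x\<^sup>m\<close> that kills the other monomials: the polynomial ring is
  free over its squares on the monomials with exponents \<open>0\<close> and \<open>1\<close>, and \<open>\<Phi>\<close> reads off the square
  root of the coordinate at \<open>xyz\<close>.
\<close>

definition square_trace :: "'a::field ternary \<Rightarrow> 'a ternary" where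
  "square_trace p = Poly_Mapping.map char2_root (Poly_Mapping.map_key odd_monom p)"

context alg_closed_char_2
begin

lemma char2_root_square: "(char2_root x)\<^sup>2 = (x::'k)"
  unfolding char2_root_def by (rule someI_ex) (metis sqrt_exists)

lemma square_inj: "x\<^sup>2 = (y::'k)\<^sup>2 \<Longrightarrow> x = y"
  using square_add[of x y] add_eq_0_char_2 by simp

lemma char2_root_add: "char2_root (x + y) = char2_root x + char2_root (y::'k)"
  by (rule square_inj) (simp add: square_add char2_root_square)

lemma char2_root_mult_square: "char2_root (x\<^sup>2 * y) = x * char2_root (y::'k)"
  by (rule square_inj) (simp add: power_mult_distrib char2_root_square)

lemma char2_root_eq_0_iff [simp]: "char2_root x = 0 \<longleftrightarrow> x = (0::'k)"
  using char2_root_square[of x] by auto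

lemma char2_root_0 [simp]: "char2_root (0::'k) = 0"
  by simp

lemma lookup_square_trace:
  "Poly_Mapping.lookup (square_trace p) m = char2_root (Poly_Mapping.lookup p (odd_monom m) :: 'k)"
  using map_key.rep_eq[OF inj_odd_monom, of p]
  by (simp add: square_trace_def Poly_Mapping.map.rep_eq when_def)

lemma square_trace_add: "square_trace (p + q) = square_trace p + square_trace (q::'k ternary)"
  by (intro poly_mapping_eqI) (simp add: lookup_square_trace lookup_add char2_root_add)

lemma square_trace_monom_odd: "square_trace (Poly_Mapping.single (odd_monom m) c) = Poly_Mapping.single m (char2_root (c::'k))"
  by (intro poly_mapping_eqI)
    (auto simp: lookup_square_trace lookup_single when_def dest: injD[OF inj_odd_monom])

lemma square_trace_monom_not_odd: "n \<notin> range odd_monom \<Longrightarrow> square_trace (Poly_Mapping.single n (c::'k)) = 0"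
  by (intro poly_mapping_eqI) (auto simp: lookup_square_trace lookup_single when_def)

text \<open>
  Multiplication by the square of a monomial does not change the parities of the exponents.
\<close>

lemma square_trace_square_monom:
  "square_trace (Poly_Mapping.single m c ^ 2 * q) = Poly_Mapping.single m c * square_trace (q::'k ternary)"
proof (induction q rule: mpoly_induct)
  case (monom n b)
  have sq: "Poly_Mapping.single m c ^ 2 * Poly_Mapping.single n b = Poly_Mapping.single (m + m + n) (c\<^sup>2 * b)"
    by (simp add: power2_eq_square mult_single)
  show ?case
  proof (cases "n \<in> range odd_monom")
    case True
    then obtain k where k: "n = odd_monom k" by blast
    then have "m + m + n = odd_monom (m + k)" by (simp add: odd_monom_def ac_simps)
    then show ?thesis unfolding sq by (simp add: k square_trace_monom_odd mult_single char2_root_mult_square)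
  next
    case False
    have "m + m + n \<notin> range odd_monom"
    proof
      assume "m + m + n \<in> range odd_monom"
      then obtain k where k: "m + m + n = odd_monom k" by blast
      have "Poly_Mapping.lookup n i = Poly_Mapping.lookup (odd_monom (k - m)) i" for i
      proof -
        have "Poly_Mapping.lookup (m + m + n) i = Poly_Mapping.lookup (odd_monom k) i"
          unfolding k ..
        then show ?thesis by (simp add: lookup_odd_monom lookup_add lookup_minus)
      qed
      then have "n = odd_monom (k - m)" by (rule poly_mapping_eqI)
      then show False using False by blast
    qed
    then show ?thesis unfolding sq by (simp add: square_trace_monom_not_odd False)
  qed
qed (simp add: distrib_left square_trace_add)

lemma square_trace_square_mult: "square_trace (p\<^sup>2 * q) = p * square_trace (q::'k ternary)"
proof (induction p rule: mpoly_induct)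
  case (add p p')
  then show ?case
    by (simp add: sum_square_char_2[OF two_mpoly] distrib_right square_trace_add)
qed (rule square_trace_square_monom)

text \<open>
  The only monomial of degree three with odd exponents is \<open>xyz\<close>.
\<close>

lemma square_trace_cubic: "square_trace (cubic A c) = Const (char2_root (c::'k))"
proof -
  have "Poly_Mapping.single j 1 \<noteq> odd_monom m" for j m
  proof
    assume eq: "Poly_Mapping.single j 1 = odd_monom m"
    obtain i where "i \<noteq> j" by (metis exhaust_3 exhaust_3 zero_neq_one one_neq_zero numeral_eq_one_iff)
    then have "Poly_Mapping.lookup (Poly_Mapping.single j (1::nat)) i = 0" by (simp add: lookup_single)
    then show False unfolding eq lookup_odd_monom by simp
  qed
  then have var: "square_trace (Var j :: 'k ternary) = 0" for j
    unfolding Var_def by (intro square_trace_monom_not_odd) blast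
  have "square_trace (Const a * Var i ^ 2 * Var j) = 0" for a :: 'k and i j
  proof -
    have "Const a * Var i ^ 2 * Var j = (Const (char2_root a) * Var i)\<^sup>2 * Var j"
      by (simp add: power_mult_distrib char2_root_square flip: Const_power)
    then show ?thesis by (simp only: square_trace_square_mult var mult_zero_right)
  qed
  moreover have "Const c * (vx * vy * vz) = Poly_Mapping.single (odd_monom 0) c"
    by (simp add: Const_def Var_def mult_single odd_monom_def sum_3 add.assoc)
  ultimately show ?thesis
    by (simp add: cubic_def sum_3 square_trace_add square_trace_monom_odd) (simp add: Const_def)
qed

text \<open>
  The splitting is \<open>h \<mapsto> \<Phi>(f h) / \<surd>c\<close>. It is well defined modulo \<open>f\<close> because
  \<open>\<Phi>(f \<cdot> f h) = f \<Phi>(h)\<close>.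
\<close>

theorem F_pure_cubic:
  assumes "c \<noteq> 0" shows "F_pure T (cubic A (c::'k))"
proof -
  define f where "f = cubic A c"
  define d where "d = 1 / char2_root c"
  define g where "g = (\<lambda>C. residue_class f (Const d * square_trace (f * (SOME q. C = residue_class f q))))"
  have g: "g (residue_class f p) = residue_class f (Const d * square_trace (f * p))" for p
  proof -
    define q where "q = (SOME q. residue_class f p = residue_class f q)"
    have "residue_class f p = residue_class f q" unfolding q_def by (rule someI[of _ p]) simp
    then obtain r where r: "p = q + f * r" by (auto simp: residue_class_eq_iff dvd_def algebra_simps)
    have "f * p = f * q + f\<^sup>2 * r" unfolding r by (simp add: power2_eq_square algebra_simps)
    then have "square_trace (f * p) = square_trace (f * q) + f * square_trace r"
      by (simp add: square_trace_add square_trace_square_mult)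
    moreover have "g (residue_class f p) = residue_class f (Const d * square_trace (f * q))"
      unfolding g_def q_def ..
    ultimately show ?thesis by (simp add: residue_class_eq_iff algebra_simps)
  qed
  show ?thesis
    unfolding F_pure_def char_2 f_def[symmetric]
  proof (rule Frobenius_split_imp_F_pure[where g = g])
    show "g a \<in> carrier (coord_ring f)" for a
      unfolding g_def carrier_coord_ring by blast
    show "g (a \<oplus>\<^bsub>coord_ring f\<^esub> b) = g a \<oplus>\<^bsub>coord_ring f\<^esub> g b"
      if "a \<in> carrier (coord_ring f)" "b \<in> carrier (coord_ring f)" for a b
      using that unfolding carrier_coord_ring
      by (auto simp: g residue_class_add distrib_left square_trace_add)
    have gsq: "g (residue_class f (r\<^sup>2 * p)) = residue_class f r \<otimes>\<^bsub>coord_ring f\<^esub> g (residue_class f p)" for r p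
    proof -
      have "f * (r\<^sup>2 * p) = r\<^sup>2 * (f * p)" by (rule mult.left_commute)
      then have "Const d * square_trace (f * (r\<^sup>2 * p)) = r * (Const d * square_trace (f * p))"
        using square_trace_square_mult[of r "f * p"] by (simp only: mult.left_commute)
      then show ?thesis unfolding g residue_class_mult by (rule arg_cong)
    qed
    show "g (r [^]\<^bsub>coord_ring f\<^esub> (2::nat) \<otimes>\<^bsub>coord_ring f\<^esub> a) = r \<otimes>\<^bsub>coord_ring f\<^esub> g a"
      if r: "r \<in> carrier (coord_ring f)" and a: "a \<in> carrier (coord_ring f)" for r a
    proof -
      obtain x where x: "r = residue_class f x" using r unfolding carrier_coord_ring by auto
      obtain y where y: "a = residue_class f y" using a unfolding carrier_coord_ring by auto
      show ?thesis unfolding x y residue_class_power residue_class_mult by (rule gsq)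
    qed
    show "g (a [^]\<^bsub>coord_ring f\<^esub> (2::nat)) = a" if a: "a \<in> carrier (coord_ring f)" for a
    proof -
      obtain p where p: "a = residue_class f p" using a unfolding carrier_coord_ring by auto
      have "Const d * square_trace f = Const (d * char2_root c)"
        unfolding f_def square_trace_cubic Const_mult ..
      also have "\<dots> = 1" using assms by (simp add: d_def)
      finally have "g (residue_class f 1) = residue_class f 1" using g[of 1] by simp
      then have "g (residue_class f (p\<^sup>2 * 1)) = residue_class f (p * 1)"
        unfolding gsq by (simp only: residue_class_mult)
      then show ?thesis unfolding p residue_class_power by (simp only: mult_1_right)
    qed
  qed
qed

end

subsection \<open>A criterion for failure of purity\<close>

text \<open>
  The ring operations of \<open>R/I\<close> are kept only because the record type of modules contains them.
\<close>

definition quotient_module :: "('r, 'c) ring_scheme \<Rightarrow> 'r set \<Rightarrow> ('r, 'r set) module" where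
  "quotient_module R I = \<lparr>carrier = carrier (R Quot I), monoid.mult = monoid.mult (R Quot I),
     one = \<one>\<^bsub>R Quot I\<^esub>, ring.zero = \<zero>\<^bsub>R Quot I\<^esub>, add = add (R Quot I),
     module.smult = (\<lambda>r C. (I +>\<^bsub>R\<^esub> r) \<otimes>\<^bsub>R Quot I\<^esub> C)\<rparr>"

lemma quotient_module_simps [simp]:
  "carrier (quotient_module R I) = carrier (R Quot I)"
  "x \<oplus>\<^bsub>quotient_module R I\<^esub> y = x \<oplus>\<^bsub>R Quot I\<^esub> y"
  "\<zero>\<^bsub>quotient_module R I\<^esub> = \<zero>\<^bsub>R Quot I\<^esub>"
  "r \<odot>\<^bsub>quotient_module R I\<^esub> x = (I +>\<^bsub>R\<^esub> r) \<otimes>\<^bsub>R Quot I\<^esub> x"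
  by (simp_all add: quotient_module_def)

lemma zero_FactRing: "\<zero>\<^bsub>R Quot I\<^esub> = I"
  by (simp add: FactRing_def)

lemma quotient_module_is_module:
  assumes "cring R" "ideal I R"
  shows "Module.module R (quotient_module R I)"
proof -
  interpret R: cring R by fact
  interpret I: ideal I R by fact
  interpret Q: cring "R Quot I" by (rule I.quotient_is_cring) fact
  interpret hom: ring_hom_ring R "R Quot I" "(+>\<^bsub>R\<^esub>) I" by (rule I.rcos_ring_hom_ring)
  have "abelian_group (quotient_module R I)"
  proof (rule abelian_groupI)
    show "\<exists>y\<in>carrier (quotient_module R I). y \<oplus>\<^bsub>quotient_module R I\<^esub> x = \<zero>\<^bsub>quotient_module R I\<^esub>"
      if "x \<in> carrier (quotient_module R I)" for x
      using that Q.l_neg Q.a_inv_closed by auto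
  qed (simp_all add: Q.a_ac)
  then show ?thesis
    by (intro moduleI) (simp_all add: R.cring_axioms Q.l_distr Q.r_distr Q.m_assoc)
qed

text \<open>
  The scalar multiplication \<open>a \<otimes> x \<mapsto> a x\<close> is well defined on the tensor product; this detects
  nonzero tensors.
\<close>

lemma tensor_kernel_smult:
  assumes "cring R" "Module.module R M" "u \<in> tensor_kernel R (regular_module R) M"
    and \<Theta>: "\<Theta> \<in> hom (free_Abelian_group (carrier R \<times> carrier M)) (add_monoid M)"
    and \<Theta>_of: "\<And>a x. a \<in> carrier R \<Longrightarrow> x \<in> carrier M \<Longrightarrow> \<Theta> (frag_of (a, x)) = a \<odot>\<^bsub>M\<^esub> x"
  shows "\<Theta> u = \<zero>\<^bsub>M\<^esub>"
proof -
  interpret M: Module.module R M by fact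
  interpret T: tensor_pair R M "regular_module R" by (rule tensor_pair_regular) fact
  interpret \<Theta>: group_hom "free_Abelian_group (carrier R \<times> carrier M)" "add_monoid M" \<Theta>
    by (simp add: group_hom_def group_hom_axioms_def \<Theta> M.M.a_group)
  have add: "\<Theta> (u + v) = \<Theta> u \<oplus>\<^bsub>M\<^esub> \<Theta> v"
    if "u \<in> carrier (free_Abelian_group (carrier R \<times> carrier M))"
      "v \<in> carrier (free_Abelian_group (carrier R \<times> carrier M))" for u v
    using \<Theta>.hom_mult[OF that] by simp
  let ?Z = "{u \<in> carrier (free_Abelian_group (carrier R \<times> carrier M)). \<Theta> u = \<zero>\<^bsub>M\<^esub>}"
  have sub: "subgroup ?Z (free_Abelian_group (carrier R \<times> carrier M))"
    using \<Theta>.subgroup_kernel by (simp add: kernel_def)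
  have cancel: "x - y \<in> ?Z"
    if "x \<in> carrier (free_Abelian_group (carrier R \<times> carrier M))"
      "y \<in> carrier (free_Abelian_group (carrier R \<times> carrier M))" "\<Theta> x = \<Theta> y" for x y
  proof -
    have c: "x - y \<in> carrier (free_Abelian_group (carrier R \<times> carrier M))"
      using that(1,2) keys_diff[of x y] by auto
    then have "\<Theta> y \<oplus>\<^bsub>M\<^esub> \<Theta> (x - y) = \<Theta> y"
      using add[OF that(2) c] that(3) by simp
    then have "\<Theta> (x - y) = \<zero>\<^bsub>M\<^esub>"
      using \<Theta>.hom_closed[OF c] \<Theta>.hom_closed[OF that(2)] M.M.add.l_cancel_one' by auto
    then show ?thesis using c by simp
  qed
  have "tensor_relations R (regular_module R) M \<subseteq> ?Z"
  proof
    fix r assume "r \<in> tensor_relations R (regular_module R) M"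
    then consider
      a b x where "r = frag_of (a \<oplus>\<^bsub>R\<^esub> b, x) - (frag_of (a, x) + frag_of (b, x))"
        "a \<in> carrier R" "b \<in> carrier R" "x \<in> carrier M"
    | a x y where "r = frag_of (a, x \<oplus>\<^bsub>M\<^esub> y) - (frag_of (a, x) + frag_of (a, y))"
        "a \<in> carrier R" "x \<in> carrier M" "y \<in> carrier M"
    | s a x where "r = frag_of (s \<otimes>\<^bsub>R\<^esub> a, x) - frag_of (a, s \<odot>\<^bsub>M\<^esub> x)"
        "s \<in> carrier R" "a \<in> carrier R" "x \<in> carrier M"
      unfolding tensor_relations_def by (auto simp: diff_diff_eq)
    then show "r \<in> ?Z"
    proof cases
      case 1
      then show ?thesis unfolding 1(1)
        by (intro cancel) (auto simp: add \<Theta>_of M.smult_l_distr dest!: subsetD[OF keys_add])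
    next
      case 2
      then show ?thesis unfolding 2(1)
        by (intro cancel) (auto simp: add \<Theta>_of M.smult_r_distr dest!: subsetD[OF keys_add])
    next
      case 3
      then have "\<Theta> (frag_of (s \<otimes>\<^bsub>R\<^esub> a, x)) = \<Theta> (frag_of (a, s \<odot>\<^bsub>M\<^esub> x))"
        by (simp add: \<Theta>_of M.smult_assoc1[symmetric] M.R.m_comm)
      then show ?thesis unfolding 3(1) using 3(2-) by (intro cancel) auto
    qed
  qed
  then have "tensor_kernel R (regular_module R) M \<subseteq> ?Z"
    unfolding tensor_kernel_def
    using group.generate_subgroup_incl[OF group_free_Abelian_group _ sub] by simp
  then show ?thesis using assms(3) by blast
qed

text \<open>
  The tensor \<open>1 \<otimes> r\<close> with values in \<open>R/I\<close> is nonzero as \<open>r\<close> is not in \<open>I\<close>. Frobenius maps it to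
  \<open>r\<^sup>p \<otimes> 1 = s \<otimes> a 1 + t \<otimes> b 1\<close>, which is zero since \<open>a\<close> and \<open>b\<close> annihilate \<open>R/I\<close>.
\<close>

theorem ideal_criterion_not_F_pure:
  fixes R :: "('r, 'c) ring_scheme" (structure)
  assumes R: "cring R" and I: "ideal I R"
    and Frobenius_add: "\<And>x y. \<lbrakk>x \<in> carrier R; y \<in> carrier R\<rbrakk> \<Longrightarrow> (x \<oplus> y) [^] p = x [^] p \<oplus> y [^] p"
    and r: "r \<in> carrier R" "r \<notin> I" and ab: "a \<in> I" "b \<in> I" and st: "s \<in> carrier R" "t \<in> carrier R"
    and eq: "r [^] p = (a [^] p \<otimes> s) \<oplus> (b [^] p \<otimes> t)"
  shows "\<not> F_pure_ring TYPE('r set) p R"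
proof
  assume pure: "F_pure_ring TYPE('r set) p R"
  interpret R: cring R by fact
  interpret I: ideal I R by fact
  interpret Q: cring "R Quot I" by (rule I.quotient_is_cring) fact
  interpret hom: ring_hom_ring R "R Quot I" "(+>) I" by (rule I.rcos_ring_hom_ring)
  define M where "M = quotient_module R I"
  have M: "Module.module R M" unfolding M_def by (rule quotient_module_is_module[OF R I])
  interpret M: Module.module R M by fact
  interpret N: tensor_pair R M "regular_module R" by (rule tensor_pair_regular[OF M])
  interpret N': tensor_pair R M "frobenius_module p R" by (rule tensor_pair_frobenius[OF M])
  have abR: "a \<in> carrier R" "b \<in> carrier R" using ab I.Icarr by auto
  have one_M: "I +> \<one> \<in> carrier M" by (simp add: M_def)
  have zero_M: "\<zero>\<^bsub>M\<^esub> = I"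
    unfolding M_def quotient_module_simps zero_FactRing ..
  have act: "x \<odot>\<^bsub>M\<^esub> (I +> \<one>) = I +> x" if "x \<in> carrier R" for x
    using that by (simp add: M_def flip: hom.hom_mult)
  have act_I: "x \<odot>\<^bsub>M\<^esub> (I +> \<one>) = \<zero>\<^bsub>M\<^esub>" if "x \<in> I" for x
  proof -
    have "x \<odot>\<^bsub>M\<^esub> (I +> \<one>) = I +> x" by (rule act[OF I.Icarr[OF that]])
    also have "\<dots> = I" by (rule I.a_rcos_const[OF that])
    finally show ?thesis by (simp only: zero_M)
  qed
  define w where "w = frag_of (\<one>, I +> r)"
  define w' where "w' = frag_of (\<one> [^] p, I +> r)"
  have rM: "I +> r \<in> carrier M" using r by (simp add: M_def)
  have "w \<notin> N.K"
  proof
    assume w: "w \<in> N.K"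
    obtain \<Theta> where \<Theta>: "\<Theta> \<in> hom (free_Abelian_group (carrier R \<times> carrier M)) (add_monoid M)"
      "\<And>z. z \<in> carrier R \<times> carrier M \<Longrightarrow> \<Theta> (frag_of z) = (case z of (a, x) \<Rightarrow> a \<odot>\<^bsub>M\<^esub> x)"
      by (rule comm_group.free_Abelian_group_universal[OF M.M.a_comm_group,
            of "\<lambda>(a, x). a \<odot>\<^bsub>M\<^esub> x" "carrier R \<times> carrier M"]) auto
    have "\<Theta> w = \<zero>\<^bsub>M\<^esub>"
      using tensor_kernel_smult[OF R M w \<Theta>(1)] \<Theta>(2) by simp
    moreover have "\<Theta> w = \<one> \<odot>\<^bsub>M\<^esub> (I +> r)"
      using \<Theta>(2)[of "(\<one>, I +> r)"] rM by (simp add: w_def)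
    ultimately have "I +> r = \<zero>\<^bsub>M\<^esub>" using rM by simp
    then have "I +> r = I" by (simp only: zero_M)
    then show False using r(2) I.a_rcos_self[OF r(1)] by simp
  qed
  have "w' \<in> N'.K"
  proof -
    let ?e = "I +> \<one>"
    have 1: "frag_of (r [^] p, ?e) - frag_of (\<one>, I +> r) \<in> N'.K"
      using N'.kernel_balance[of r \<one> ?e] r one_M act by simp
    have 2: "frag_of (r [^] p, ?e) - frag_of (a [^] p \<otimes> s, ?e) - frag_of (b [^] p \<otimes> t, ?e) \<in> N'.K"
      using N'.kernel_add_left[of "a [^] p \<otimes> s" "b [^] p \<otimes> t" ?e] abR st one_M by (simp add: eq)
    have 3: "frag_of (a [^] p \<otimes> s, ?e) - frag_of (s, \<zero>\<^bsub>M\<^esub>) \<in> N'.K"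
      using N'.kernel_balance[of a s ?e] abR st one_M act_I[OF ab(1)] by simp
    have 4: "frag_of (b [^] p \<otimes> t, ?e) - frag_of (t, \<zero>\<^bsub>M\<^esub>) \<in> N'.K"
      using N'.kernel_balance[of b t ?e] abR st one_M act_I[OF ab(2)] by simp
    have 5: "frag_of (s, \<zero>\<^bsub>M\<^esub>) \<in> N'.K" "frag_of (t, \<zero>\<^bsub>M\<^esub>) \<in> N'.K"
      using N'.kernel_zero_right[of s] N'.kernel_zero_right[of t] st by simp_all
    have "frag_of (\<one>, I +> r) =
      ((frag_of (r [^] p, ?e) - frag_of (a [^] p \<otimes> s, ?e) - frag_of (b [^] p \<otimes> t, ?e))
       - (frag_of (r [^] p, ?e) - frag_of (\<one>, I +> r)))
       + ((frag_of (a [^] p \<otimes> s, ?e) - frag_of (s, \<zero>\<^bsub>M\<^esub>)) + frag_of (s, \<zero>\<^bsub>M\<^esub>))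
       + ((frag_of (b [^] p \<otimes> t, ?e) - frag_of (t, \<zero>\<^bsub>M\<^esub>)) + frag_of (t, \<zero>\<^bsub>M\<^esub>))"
      by simp
    also have "\<dots> \<in> N'.K"
      by (intro N'.kernel_add N'.kernel_diff[OF 2 1] 3 4 5)
    finally show ?thesis by (simp add: w'_def)
  qed
  define h where "h x = x [^] p" for x
  have map_kernel: "frag_map h k \<in> N'.K" if "k \<in> N.K" for k
    by (rule frag_map_kernel[OF N.tensor_pair_axioms N'.tensor_pair_axioms _ _ _ that])
      (simp_all add: h_def Frobenius_add R.nat_pow_distrib)
  have image: "tensor_map R (frobenius_module p R) M h (N.K #>\<^bsub>N.F\<^esub> u) = N'.K"
    if "frag_map h u \<in> N'.K" for u
  proof (intro equalityI subsetI)
    fix x assume "x \<in> tensor_map R (frobenius_module p R) M h (N.K #>\<^bsub>N.F\<^esub> u)"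
    then obtain k k' where "k \<in> N.K" "k' \<in> N'.K" "x = k' + frag_map h (k + u)"
      unfolding tensor_map_def N.coset_eq N'.coset_eq frag_map_def[symmetric] by blast
    then show "x \<in> N'.K" using map_kernel that by (simp add: N'.kernel_add)
  next
    fix x assume x: "x \<in> N'.K"
    have "u \<in> N.K #>\<^bsub>N.F\<^esub> u" unfolding N.coset_eq using N.kernel_zero by force
    moreover have "x \<in> N'.K #>\<^bsub>N'.F\<^esub> frag_map h u"
      unfolding N'.coset_eq using N'.kernel_diff[OF x that] by force
    ultimately show "x \<in> tensor_map R (frobenius_module p R) M h (N.K #>\<^bsub>N.F\<^esub> u)"
      unfolding tensor_map_def frag_map_def[symmetric] by blast
  qed
  have inj: "inj_on (tensor_map R (frobenius_module p R) M h) (carrier (tensor R (regular_module R) M))"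
    using pure M unfolding F_pure_ring_def pure_linear_def h_def[abs_def] by blast
  have wF: "w \<in> carrier N.F" using rM by (simp add: w_def)
  have "tensor_map R (frobenius_module p R) M h (N.K #>\<^bsub>N.F\<^esub> w) = N'.K"
    by (rule image) (use \<open>w' \<in> N'.K\<close> in \<open>simp add: w_def w'_def h_def\<close>)
  moreover have "tensor_map R (frobenius_module p R) M h (N.K #>\<^bsub>N.F\<^esub> 0) = N'.K"
    by (rule image) (simp add: N'.kernel_zero)
  moreover have "N.K #>\<^bsub>N.F\<^esub> u \<in> carrier (tensor R (regular_module R) M)" if "u \<in> carrier N.F" for u
    using that unfolding N.tensor_carrier by blast
  moreover have "0 \<in> carrier N.F" by simp
  ultimately have "N.K #>\<^bsub>N.F\<^esub> w = N.K #>\<^bsub>N.F\<^esub> 0"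
    using inj_onD[OF inj] wF by metis
  moreover have "w \<in> N.K #>\<^bsub>N.F\<^esub> w" unfolding N.coset_eq using N.kernel_zero by force
  ultimately have "w \<in> N.K" unfolding N.coset_eq by auto
  then show False using \<open>w \<notin> N.K\<close> by contradiction
qed

context alg_closed_char_2
begin

text \<open>
  The criterion applies to the ideal of \<open>x\<close> and \<open>y\<close> in the coordinate ring, as the image of the ideal
  of polynomials that lie in \<open>(z\<^sup>3)\<close> after setting \<open>x\<close> and \<open>y\<close> to zero, and to \<open>r = z\<^sup>2\<close>.
\<close>

theorem fermat_not_F_pure:
  "\<not> F_pure TYPE('k ternary set set) (vx^3 + vy^3 + vz^3 :: 'k ternary)"
proof -
  define f where "f = (vx^3 + vy^3 + vz^3 :: 'k ternary)"
  define \<epsilon> where "\<epsilon> p = insertion (\<lambda>c. [:c:]) (\<lambda>i. if i = 3 then [:0, 1:] else 0) p" for p :: "'k ternary"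
  note \<epsilon>_simps = \<epsilon>_def poly_const_hom.insertion_simps poly_const_hom.insertion_Var
  (* It contains the Fermat form, whose image is z^3, but not z^2. *)
  define I where "I = {p. monom 1 3 dvd \<epsilon> p}"
  have I: "p \<in> I \<longleftrightarrow> monom 1 3 dvd \<epsilon> p" for p by (simp add: I_def)
  have ideal: "ideal (residue_class f ` I) (coord_ring f)"
    by (rule residue_class_ideal) (auto simp: I \<epsilon>_simps poly_const_hom.insertion_0)
  have fI: "f \<in> I"
    by (simp add: I f_def \<epsilon>_simps monom_altdef)
  show ?thesis
    unfolding F_pure_def char_2 f_def[symmetric]
  proof (rule ideal_criterion_not_F_pure[OF coord_ring_cring ideal])
    show "(x \<oplus>\<^bsub>coord_ring f\<^esub> y) [^]\<^bsub>coord_ring f\<^esub> (2::nat) =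
        x [^]\<^bsub>coord_ring f\<^esub> (2::nat) \<oplus>\<^bsub>coord_ring f\<^esub> y [^]\<^bsub>coord_ring f\<^esub> (2::nat)"
      if "x \<in> carrier (coord_ring f)" "y \<in> carrier (coord_ring f)" for x y
      using that unfolding carrier_coord_ring
      by (auto simp: residue_class_add residue_class_power sum_square_char_2[OF two_mpoly])
    show "residue_class f (vz^2) \<notin> residue_class f ` I"
    proof
      assume "residue_class f (vz^2) \<in> residue_class f ` I"
      then obtain p where p: "p \<in> I" "f dvd vz^2 - p" by (auto simp: residue_class_eq_iff)
      then obtain q where "vz^2 = p + q * f" by (auto simp: dvd_def algebra_simps)
      then have "\<epsilon> (vz^2) = \<epsilon> p + \<epsilon> q * \<epsilon> f" by (simp add: \<epsilon>_simps)
      then have "monom 1 3 dvd \<epsilon> (vz^2)" using p(1) fI by (simp add: I)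
      then have "monom 1 3 dvd (monom 1 2 :: 'k poly)" by (simp add: \<epsilon>_simps monom_altdef)
      then show False by (simp add: monom_1_dvd_iff)
    qed
    show "residue_class f vx \<in> residue_class f ` I" "residue_class f vy \<in> residue_class f ` I"
      by (auto simp: I \<epsilon>_simps)
    have "vz^4 - (vx^2 * (vz * vx) + vy^2 * (vz * vy)) = vz * f - 2 * (vz * (vx^3 + vy^3))"
      by (simp add: f_def algebra_simps power2_eq_square power3_eq_cube power4_eq_xxxx)
    then have "f dvd vz^4 - (vx^2 * (vz * vx) + vy^2 * (vz * vy))"
      by (simp add: two_mpoly)
    then show "residue_class f (vz^2) [^]\<^bsub>coord_ring f\<^esub> (2::nat) =
       (residue_class f vx [^]\<^bsub>coord_ring f\<^esub> (2::nat) \<otimes>\<^bsub>coord_ring f\<^esub> residue_class f (vz * vx)) \<oplus>\<^bsub>coord_ring f\<^esub>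
       (residue_class f vy [^]\<^bsub>coord_ring f\<^esub> (2::nat) \<otimes>\<^bsub>coord_ring f\<^esub> residue_class f (vz * vy))"
      by (simp add: residue_class_power residue_class_mult residue_class_add residue_class_eq_iff flip: power_mult)
  qed (simp_all add: carrier_coord_ring)
qed

end

section \<open>Lines and plane cubics\<close>

subsection \<open>Points on a line\<close>

lemma infinite_alg_closed: "infinite (UNIV :: 'a::alg_closed_field set)"
proof
  assume fin: "finite (UNIV :: 'a set)"
  let ?p = "(\<Prod>a\<in>UNIV. [:- a, 1:]) + 1 :: 'a poly"
  have deg: "degree (\<Prod>a\<in>(UNIV::'a set). [:- a, 1:]) = card (UNIV :: 'a set)"
    by (subst degree_prod_eq_sum_degree) auto
  have "card (UNIV :: 'a set) > 0" using fin by (simp add: card_gt_0_iff)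
  then have "degree ?p > 0" using deg by (simp add: degree_add_eq_left)
  then obtain x where "poly ?p x = 0" using alg_closed_imp_poly_has_root by blast
  moreover have "poly ?p x = 1"
    using fin by (auto simp: poly_prod intro!: prod_zero)
  ultimately show False by simp
qed

lemma poly_ext:
  fixes p q :: "'a::alg_closed_field poly"
  assumes "\<And>t. poly p t = poly q t" shows "p = q"
proof (rule ccontr)
  assume "p \<noteq> q"
  then have "finite {t. poly (p - q) t = 0}" by (intro poly_roots_finite) simp
  then show False using assms infinite_alg_closed[where 'a = 'a] by simp
qed

lemma order_0_eqI:
  fixes p :: "'a::idom poly"
  assumes "coeff p n \<noteq> 0" "\<And>k. k < n \<Longrightarrow> coeff p k = 0"
  shows "order 0 p = n"
proof -
  have "p \<noteq> 0" using assms(1) by auto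
  then have "m \<le> order 0 p \<longleftrightarrow> (\<forall>k<m. coeff p k = 0)" for m
    by (metis monom_1_dvd_iff monom_1_dvd_iff')
  then have "n \<le> order 0 p" "\<not> Suc n \<le> order 0 p" using assms by auto
  then show ?thesis by simp
qed

text \<open>
  Two points on a line that may serve as basis in the definition of \<open>line_mult\<close>.
\<close>

definition indep2 :: "'a::field ^ 3 \<Rightarrow> 'a ^ 3 \<Rightarrow> bool" where
  "indep2 u v \<longleftrightarrow> (\<forall>c d. c *s u + d *s v = 0 \<longrightarrow> c = 0 \<and> d = 0)"

lemma indep2_nonzero: "indep2 u v \<Longrightarrow> u \<noteq> 0" "indep2 u v \<Longrightarrow> v \<noteq> 0"
proof -
  show "indep2 u v \<Longrightarrow> u \<noteq> 0" unfolding indep2_def by (metis add.right_neutral vector_smult_lzero vector_smult_rzero zero_neq_one)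
  show "indep2 u v \<Longrightarrow> v \<noteq> 0" unfolding indep2_def by (metis add.right_neutral vector_smult_lzero vector_smult_rzero zero_neq_one)
qed

lemma det3_indep2: "det3 u v w \<noteq> 0 \<Longrightarrow> indep2 u v"
  unfolding indep2_def
proof (intro allI impI)
  fix c d assume "det3 u v w \<noteq> 0" "c *s u + d *s v = 0"
  then show "c = 0 \<and> d = 0" using det3_nonzero_independent(1,2)[of u v w c d 0] by simp
qed

lemma proj_pt_eq_iff:
  assumes "v \<noteq> (0::'a::field^3)"
  shows "proj_pt v = proj_pt w \<longleftrightarrow> (\<exists>k. k \<noteq> 0 \<and> w = k *s v)"
proof
  assume "proj_pt v = proj_pt w"
  moreover have "w \<in> proj_pt w" unfolding proj_pt_def by (auto intro!: exI[of _ 1])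
  ultimately show "\<exists>k. k \<noteq> 0 \<and> w = k *s v" unfolding proj_pt_def by blast
next
  assume "\<exists>k. k \<noteq> 0 \<and> w = k *s v"
  then obtain k where k: "k \<noteq> 0" "w = k *s v" by blast
  show "proj_pt v = proj_pt w"
    unfolding proj_pt_def
  proof (intro equalityI subsetI; clarsimp)
    fix c :: 'a assume "c \<noteq> 0"
    then show "\<exists>d. c *s v = d *s w \<and> d \<noteq> 0" using k by (intro exI[of _ "c / k"]) simp
  next
    fix c :: 'a assume "c \<noteq> 0"
    then show "\<exists>d. c *s w = d *s v \<and> d \<noteq> 0" using k by (intro exI[of _ "c * k"]) simp
  qed
qed

lemma indep2_iff_proj_pt:
  assumes "u \<noteq> (0::'a::field^3)" "v \<noteq> 0"
  shows "indep2 u v \<longleftrightarrow> proj_pt u \<noteq> proj_pt v"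
proof
  assume ind: "indep2 u v"
  show "proj_pt u \<noteq> proj_pt v"
  proof
    assume "proj_pt u = proj_pt v"
    then obtain k where "v = k *s u" using proj_pt_eq_iff[OF assms(1)] by blast
    then have "k *s u + (- 1) *s v = 0" by simp
    then show False using ind unfolding indep2_def by (metis neg_equal_0_iff_equal zero_neq_one)
  qed
next
  assume ne: "proj_pt u \<noteq> proj_pt v"
  show "indep2 u v"
    unfolding indep2_def
  proof (intro allI impI)
    fix c d assume rel: "c *s u + d *s v = 0"
    show "c = 0 \<and> d = 0"
    proof (cases "d = 0")
      case True
      then show ?thesis using rel assms(1) by simp
    next
      case False
      then have v: "v = (- 1 / d * c) *s u" using solve_for_last[OF rel] by simp
      then have "- 1 / d * c \<noteq> 0" using assms(2) by auto
      then show ?thesis using v ne proj_pt_eq_iff[OF assms(1)] by blast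
    qed
  qed
qed

lemma indep2_det3_exists:
  fixes u v :: "'a::field ^ 3"
  assumes "indep2 u v" obtains w where "det3 u v w \<noteq> 0"
proof -
  have "\<exists>w. det3 u v w \<noteq> 0"
  proof (rule ccontr)
    assume "\<nexists>w. det3 u v w \<noteq> 0"
    then have "det3 u v (axis i 1) = 0" for i by blast
    from this[of 1] this[of 2] this[of 3]
    have cross: "u$2 * v$3 = u$3 * v$2" "u$1 * v$3 = u$3 * v$1" "u$1 * v$2 = u$2 * v$1"
      by (simp_all add: det3_def axis_def)
    have rel: "(v $ i) *s u + (- (u $ i)) *s v = 0" for i
      using exhaust_3[of i] cross by (auto simp: vec3_eq_iff algebra_simps)
    then have "u $ i = 0" for i using assms unfolding indep2_def by (metis neg_equal_0_iff_equal)
    then have "u = 0" by (simp add: vec_eq_iff)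
    then show False using indep2_nonzero[OF assms] by blast
  qed
  then show thesis using that by blast
qed

lemma functional_kernel_span:
  fixes n :: "'a::field ^ 3"
  assumes n: "n \<noteq> 0" and z: "(\<Sum>i\<in>UNIV. n$i * u$i) = 0" "(\<Sum>i\<in>UNIV. n$i * v$i) = 0"
    "(\<Sum>i\<in>UNIV. n$i * x$i) = 0" and ind: "indep2 u v"
  obtains a b where "x = a *s u + b *s v"
proof -
  obtain b p q where b: "(\<Sum>i\<in>UNIV. n$i * b$i) = 1" using functional_basis[OF n] by metis
  have "det3 u v x = 0"
  proof (rule ccontr)
    assume "det3 u v x \<noteq> 0"
    then obtain c d e where "b = c *s u + d *s v + e *s x" by (rule det3_nonzero_expand)
    then have "(\<Sum>i\<in>UNIV. n$i * b$i) = c * (\<Sum>i\<in>UNIV. n$i * u$i) + d * (\<Sum>i\<in>UNIV. n$i * v$i)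
        + e * (\<Sum>i\<in>UNIV. n$i * x$i)"
      by (simp add: sum_3 algebra_simps)
    then show False using b z by simp
  qed
  then obtain c d e where rel: "c *s u + d *s v + e *s x = 0" "c \<noteq> 0 \<or> d \<noteq> 0 \<or> e \<noteq> 0"
    by (rule det3_zero_relation)
  have "e \<noteq> 0" using rel ind unfolding indep2_def by (metis add.right_neutral vector_smult_lzero)
  then have "x = (- 1 / e) *s (c *s u + d *s v)" using solve_for_last rel(1) by blast
  then have "x = (- 1 / e * c) *s u + (- 1 / e * d) *s v"
    by (simp only: vector_add_ldistrib vector_smult_assoc)
  then show thesis using that by blast
qed

subsection \<open>Linear forms\<close>

lemma form_1_eq:
  fixes l :: "'a::field ternary"
  assumes "form 1 l" obtains n where "l = (\<Sum>i\<in>UNIV. Const (n $ i) * Var i)"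
proof -
  have deg1: "\<exists>i. m = Poly_Mapping.single i 1" if "mono_degree m = 1" for m :: "3 \<Rightarrow>\<^sub>0 nat"
  proof -
    define k where "k i = Poly_Mapping.lookup m i" for i
    have "k 1 + k 2 + k 3 = 1" using that by (simp add: mono_degree_def sum_3 k_def)
    then have "k 1 = 1 \<and> k 2 = 0 \<and> k 3 = 0 \<or> k 1 = 0 \<and> k 2 = 1 \<and> k 3 = 0 \<or> k 1 = 0 \<and> k 2 = 0 \<and> k 3 = 1"
      by linarith
    then have "(\<forall>j. k j = (if j = 1 then 1 else 0)) \<or> (\<forall>j. k j = (if j = 2 then 1 else 0))
        \<or> (\<forall>j. k j = (if j = 3 then 1 else 0))"
      by (simp add: forall_3)
    moreover have "m = Poly_Mapping.single i 1" if "\<forall>j. k j = (if j = i then 1 else 0)" for i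
      using that by (intro poly_mapping_eqI) (simp add: k_def lookup_single when_def)
    ultimately show ?thesis by blast
  qed
  have "\<exists>n. hom_part 1 p = (\<Sum>i\<in>UNIV. Const (n $ i) * Var i)" for p :: "'a ternary"
  proof (induction p rule: mpoly_induct)
    case (monom m c)
    show ?case
    proof (cases "mono_degree m = 1")
      case True
      then obtain i where i: "m = Poly_Mapping.single i 1" using deg1 by blast
      have "hom_part 1 (Poly_Mapping.single m c) = Poly_Mapping.single m c"
        using True by (intro poly_mapping_eqI) (auto simp: hom_part_lookup lookup_single when_def)
      also have "\<dots> = (\<Sum>j\<in>UNIV. Const (axis i c $ j) * Var j)"
        using exhaust_3[of i] by (auto simp: i Const_def Var_def mult_single axis_def sum_3)
      finally show ?thesis by blast
    next
      case False
      then have "hom_part 1 (Poly_Mapping.single m c) = 0"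
        by (intro poly_mapping_eqI) (auto simp: hom_part_lookup lookup_single when_def)
      then show ?thesis by (intro exI[of _ 0]) simp
    qed
  next
    case (add p q)
    then obtain n n' where "hom_part 1 p = (\<Sum>i\<in>UNIV. Const (n $ i) * Var i)"
      "hom_part 1 q = (\<Sum>i\<in>UNIV. Const (n' $ i) * Var i)" by blast
    then have "hom_part 1 (p + q) = (\<Sum>i\<in>UNIV. Const ((n + n') $ i) * Var i)"
      by (simp add: hom_part_add sum.distrib distrib_right Const_add)
    then show ?case by blast
  qed
  then obtain n where "hom_part 1 l = (\<Sum>i\<in>UNIV. Const (n $ i) * Var i)" by blast
  then show thesis using that[of n] hom_part_form[OF assms, of 1] by simp
qed

lemma linear_form_functional:
  assumes "linear_form (l :: 'a::field ternary)"
  obtains n where "n \<noteq> 0" "l = (\<Sum>i\<in>UNIV. Const (n $ i) * Var i)"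
proof -
  obtain n where n: "l = (\<Sum>i\<in>UNIV. Const (n $ i) * Var i)"
    using assms form_1_eq unfolding linear_form_def by blast
  moreover have "n \<noteq> 0" using assms n unfolding linear_form_def by auto
  ultimately show thesis using that by simp
qed

lemma linear_formI:
  assumes "n \<noteq> 0" shows "linear_form (\<Sum>i\<in>UNIV. Const (n $ i) * Var i :: 'a::field ternary)"
  unfolding linear_form_def
proof
  show "form 1 (\<Sum>i\<in>UNIV. Const (n $ i) * Var i :: 'a ternary)"
  proof (rule form_sum)
    show "form 1 (Const (n $ i) * Var i :: 'a ternary)" for i
      using form_mult[OF form_Const form_Var, of "n $ i" i] by simp
  qed
  obtain b p q where "(\<Sum>i\<in>UNIV. n$i * b$i) = 1" using functional_basis[OF assms] by metis
  then have "eval (\<Sum>i\<in>UNIV. Const (n $ i) * Var i) b \<noteq> eval 0 b" by simp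
  then show "(\<Sum>i\<in>UNIV. Const (n $ i) * Var i :: 'a ternary) \<noteq> 0" by metis
qed

lemma curve_linear_form:
  assumes "linear_form l" "v \<noteq> 0" shows "proj_pt v \<in> curve l \<longleftrightarrow> eval l v = 0"
proof
  assume "proj_pt v \<in> curve l"
  then obtain w where w: "proj_pt v = proj_pt w" "w \<noteq> 0" "eval l w = 0" unfolding curve_def by blast
  then obtain k where k: "k \<noteq> 0" "w = k *s v" using proj_pt_eq_iff[OF assms(2)] by blast
  obtain n where l: "l = (\<Sum>i\<in>UNIV. Const (n $ i) * Var i)"
    using linear_form_functional[OF assms(1)] .
  have n: "eval l x = (\<Sum>i\<in>UNIV. n $ i * x $ i)" for x
    unfolding l by simp
  have "eval l w = k * eval l v"
    unfolding n k(2) by (simp add: sum_3 distrib_left mult.left_commute)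
  then show "eval l v = 0" using w(3) k(1) by simp
qed (use assms(2) in \<open>auto simp: curve_def\<close>)

subsection \<open>Intersection of a cubic with a line\<close>

text \<open>
  In characteristic two this is the derivative of the cubic at \<open>u\<close> in the direction \<open>v\<close>, and the
  cubic at \<open>u + tv\<close> is \<open>P(u, u) + P(u, v) t + P(v, u) t\<^sup>2 + P(v, v) t\<^sup>3\<close>. As a function of \<open>u\<close> it is a
  quadratic form whose polarization is \<open>c\<close> times a determinant.
\<close>

definition polar :: "'a::field ^ 3 ^ 3 \<Rightarrow> 'a \<Rightarrow> 'a ^ 3 \<Rightarrow> 'a ^ 3 \<Rightarrow> 'a" where
  "polar A c u v = gram A u v + c * (u$1 * u$2 * v$3 + u$1 * u$3 * v$2 + u$2 * u$3 * v$1)"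

lemma polar_functional: "polar A c u v = (\<Sum>j\<in>UNIV. polar A c u (axis j 1) * v $ (j::3))"
  by (simp add: polar_def gram_def sum_3 axis_def algebra_simps)

text \<open>
  The order of vanishing at \<open>t = 0\<close> of \<open>a + bt + ct\<^sup>2 + dt\<^sup>3\<close>.
\<close>

definition lowest_index :: "'a::zero \<Rightarrow> 'a \<Rightarrow> 'a \<Rightarrow> 'a \<Rightarrow> enat" where
  "lowest_index a b c d = (if a \<noteq> 0 then 0 else if b \<noteq> 0 then 1 else if c \<noteq> 0 then 2
     else if d \<noteq> 0 then 3 else \<infinity>)"

lemma order_cubic_poly:
  "(if [:a, b, c, d:] = 0 then \<infinity> else enat (Polynomial.order 0 [:a, b, c, d:])) = lowest_index a b c (d::'a::idom)"
proof -
  consider "a \<noteq> 0" | "a = 0" "b \<noteq> 0" | "a = 0" "b = 0" "c \<noteq> 0" | "a = 0" "b = 0" "c = 0" "d \<noteq> 0"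
    | "a = 0" "b = 0" "c = 0" "d = 0" by blast
  then show ?thesis
  proof cases
    case 1
    then have "Polynomial.order 0 [:a, b, c, d:] = 0" by (intro order_0_eqI) simp_all
    then show ?thesis using 1 by (simp add: lowest_index_def zero_enat_def)
  next
    case 2
    then have "Polynomial.order 0 [:a, b, c, d:] = 1" by (intro order_0_eqI) simp_all
    then show ?thesis using 2 by (simp add: lowest_index_def one_enat_def)
  next
    case 3
    then have "Polynomial.order 0 [:a, b, c, d:] = 2"
      by (intro order_0_eqI) (auto simp: numeral_2_eq_2 less_Suc_eq)
    then show ?thesis using 3 by (simp add: lowest_index_def numeral_eq_enat)
  next
    case 4
    then have "Polynomial.order 0 [:a, b, c, d:] = 3"
      by (intro order_0_eqI) (auto simp: numeral_3_eq_3 less_Suc_eq)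
    then show ?thesis using 4 by (simp add: lowest_index_def numeral_eq_enat)
  next
    case 5 then show ?thesis by (simp add: lowest_index_def)
  qed
qed

context alg_closed_char_2
begin

lemma numeral_mpoly_char_2 [simp]:
  "(numeral (Num.Bit0 n) :: 'k ternary) = 0" "(numeral (Num.Bit1 n) :: 'k ternary) = 1"
proof -
  have "x + x = 0" for x :: "'k ternary"
    using two_mpoly by (metis mult_2 mult_zero_left)
  then show "(numeral (Num.Bit0 n) :: 'k ternary) = 0" "(numeral (Num.Bit1 n) :: 'k ternary) = 1"
    by (simp_all only: numeral_Bit0 numeral_Bit1 add_0)
qed

lemma polar_add_right: "polar A c u (v + w) = polar A c u v + polar A c u (w::'k^3)"
  and polar_scale_right: "polar A c u (k *s v) = k * polar A c u (v::'k^3)"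
  and polar_scale_left: "polar A c (k *s u) v = k\<^sup>2 * polar A c u (v::'k^3)"
  by (simp_all add: polar_def gram_simps power2_eq_square algebra_simps)

lemma polar_add_left: "polar A c (u + v) w = polar A c u w + polar A c v w + c * det3 u v (w::'k^3)"
  by (simp add: polar_def gram_simps det3_def algebra_simps)

lemmas polar_linear = polar_add_left polar_add_right polar_scale_left polar_scale_right

lemma eval_cubic: "eval (cubic A c) u = polar A c u (u::'k^3)"
  by (simp add: cubic_def polar_def gram_def sum_3 algebra_simps)

lemma partial_cubic: "eval (partial i (cubic A c)) u = polar A c u (axis i (1::'k))"
  using exhaust_3[of i]
  by (elim disjE) (simp_all add: cubic_def polar_def gram_def sum_3 axis_def power2_eq_square algebra_simps)

lemma line_restrict_cubic:
  "line_restrict (cubic A c) u (v::'k^3)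
    = [:polar A c u u, polar A c u v, polar A c v u, polar A c v v:]"
proof -
  have 2: "(2::'k poly) = 0" by (metis two numeral_poly pCons_0_0)
  have sq: "[:a, b:]\<^sup>2 = [:a\<^sup>2, 0, b\<^sup>2:]" for a b :: 'k
    by (simp add: power2_eq_square mult.commute)
  show ?thesis
    unfolding cubic_def polar_def gram_def sum_3 line_restrict_add line_restrict_mult line_restrict_Const
      line_restrict_power line_restrict_Var sq
    by (simp add: algebra_simps)
qed

lemma eval_cubic_line:
  "eval (cubic A c) (s *s u + r *s v) = s ^ 3 * polar A c u u + s\<^sup>2 * r * polar A c u v
     + s * r\<^sup>2 * polar A c v u + r ^ 3 * polar A c v (v::'k^3)"
proof -
  have "det3 (s *s u) (r *s v) u = 0" "det3 (s *s u) (r *s v) v = 0"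
    by (simp_all add: det3_def algebra_simps)
  then show ?thesis
    unfolding eval_cubic polar_linear
    by (simp add: power2_eq_square power3_eq_cube algebra_simps)
qed

text \<open>
  Another choice of basis is of the form \<open>(k u, d u + e v)\<close> with \<open>k\<close> and \<open>e\<close> nonzero. It changes the
  four coefficients by a triangular matrix and so does not affect the index of the lowest nonzero
  one. Hence the definite description in \<open>line_mult\<close> denotes.
\<close>

lemma line_mult_cubic:
  fixes u v :: "'k^3"
  assumes l: "linear_form l" "eval l u = 0" "eval l v = 0" and ind: "indep2 u v"
  shows "line_mult (cubic A c) l (proj_pt u)
    = lowest_index (polar A c u u) (polar A c u v) (polar A c v u) (polar A c v v)"
proof -
  let ?P = "polar A c"
  let ?m = "\<lambda>v w. if line_restrict (cubic A c) v w = 0 then \<infinity>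
      else enat (Polynomial.order 0 (line_restrict (cubic A c) v w))"
  have m: "?m v w = lowest_index (?P v v) (?P v w) (?P w v) (?P w w)" for v w
    unfolding line_restrict_cubic by (rule order_cubic_poly)
  obtain n where n0: "n \<noteq> 0" and nl: "l = (\<Sum>i\<in>UNIV. Const (n $ i) * Var i)"
    using linear_form_functional[OF l(1)] .
  have n: "eval l x = (\<Sum>i\<in>UNIV. n $ i * x $ i)" for x
    unfolding nl by simp
  have "?m u' v' = ?m u v"
    if pt: "proj_pt u = proj_pt u'" and z: "eval l v' = 0" and ind': "indep2 u' v'" for u' v'
  proof -
    obtain k where k: "k \<noteq> 0" "u' = k *s u"
      using pt proj_pt_eq_iff[OF indep2_nonzero(1)[OF ind]] by blast
    obtain d e where de: "v' = d *s u + e *s v"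
      using functional_kernel_span[OF n0 _ _ _ ind, of v'] l(2,3) z unfolding n .
    have e: "e \<noteq> 0"
    proof
      assume "e = 0"
      then have "d *s u' + k *s v' = 0" by (simp add: k de mult.commute vec_eq_iff)
      then show False using ind' k(1) unfolding indep2_def by blast
    qed
    have det: "det3 (d *s u) (e *s v) u = 0" "det3 (d *s u) (e *s v) v = 0"
      by (simp_all add: det3_def algebra_simps)
    have "?P u' u' = k ^ 3 * ?P u u"
      by (simp add: k polar_linear power3_eq_cube power2_eq_square)
    moreover have "?P u' v' = k\<^sup>2 * (d * ?P u u + e * ?P u v)"
      by (simp add: k de polar_linear algebra_simps)
    moreover have "?P v' u' = k * (d\<^sup>2 * ?P u u + e\<^sup>2 * ?P v u)"
      by (simp add: k de polar_linear det algebra_simps)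
    moreover have "?P v' v' = d ^ 3 * ?P u u + d\<^sup>2 * e * ?P u v + d * e\<^sup>2 * ?P v u + e ^ 3 * ?P v v"
      by (simp add: de polar_linear det algebra_simps power3_eq_cube power2_eq_square)
    ultimately show ?thesis
      using k(1) e unfolding m by (simp add: lowest_index_def)
  qed
  note unique = this
  show ?thesis
    unfolding line_mult_def indep2_def[symmetric] m[symmetric]
  proof (rule the_equality)
    show "\<exists>v' w. proj_pt u = proj_pt v' \<and> eval l v' = 0 \<and> eval l w = 0 \<and> indep2 v' w \<and> ?m u v = ?m v' w"
      using l ind by blast
  next
    fix n assume "\<exists>v w. proj_pt u = proj_pt v \<and> eval l v = 0 \<and> eval l w = 0 \<and> indep2 v w \<and> n = ?m v w"
    then show "n = ?m u v" using unique by blast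
  qed
qed

lemma smooth_cubic:
  assumes "smooth (cubic A (c::'k))" "\<And>w. polar A c u w = 0" shows "u = 0"
proof (rule ccontr)
  assume "u \<noteq> 0"
  then have "proj_pt u \<in> singular_points (cubic A c)"
    using assms(2) by (auto simp: singular_points_def eval_cubic partial_cubic)
  then show False using assms(1) by (simp add: smooth_def)
qed

text \<open>
  At a point of a line on the cubic the derivatives along the line vanish. The derivative in a
  transversal direction is a binary quadratic form in the position on the line, and at a zero of it
  the cubic is singular.
\<close>

lemma smooth_cubic_contains_no_line:
  assumes smooth: "smooth (cubic A (c::'k))" and ind: "indep2 u v"
    and zero: "polar A c u u = 0" "polar A c u v = 0" "polar A c v u = 0" "polar A c v v = 0"
  shows False
proof -
  obtain w where w: "det3 u v w \<noteq> 0" using indep2_det3_exists[OF ind] .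
  obtain s r where sr: "s \<noteq> 0 \<or> r \<noteq> 0"
    "s\<^sup>2 * polar A c u w + s * r * (c * det3 u v w) + r\<^sup>2 * polar A c v w = 0"
  proof (cases "polar A c u w = 0")
    case True
    then show ?thesis using that[of 1 0] by simp
  next
    case False
    then obtain s where "poly [:polar A c v w, c * det3 u v w, polar A c u w:] s = 0"
      using alg_closed_imp_poly_has_root[of "[:polar A c v w, c * det3 u v w, polar A c u w:]"] by auto
    then show ?thesis using that[of s 1] by (simp add: algebra_simps power2_eq_square)
  qed
  let ?x = "s *s u + r *s v"
  have xu: "polar A c ?x u = 0" and xv: "polar A c ?x v = 0"
    by (simp_all add: polar_linear zero) (simp_all add: det3_def algebra_simps)
  have xw: "polar A c ?x w = 0"
  proof -
    have "det3 (s *s u) (r *s v) w = s * r * det3 u v w" by (simp add: det3_def algebra_simps)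
    then show ?thesis using sr(2) unfolding polar_linear by (simp add: algebra_simps)
  qed
  have "polar A c ?x y = 0" for y
  proof -
    obtain a b d where y: "y = a *s u + b *s v + d *s w" using det3_nonzero_expand[OF w] .
    show ?thesis unfolding y polar_add_right polar_scale_right xu xv xw by simp
  qed
  then have "?x = 0" using smooth_cubic[OF smooth] by blast
  then show False using ind sr(1) unfolding indep2_def by blast
qed

end

subsection \<open>Line sections\<close>

lemma line_mult_cong:
  assumes "\<And>x. eval l x = 0 \<longleftrightarrow> eval l' x = 0" shows "line_mult f l P = line_mult f l' P"
  unfolding line_mult_def assms ..

lemma curve_cong:
  assumes "\<And>x. eval l x = 0 \<longleftrightarrow> eval l' x = 0" shows "curve l = curve l'"
  unfolding curve_def assms ..

lemma order_linear_factor: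
  fixes a b :: "'a::idom"
  assumes "a \<noteq> 0 \<or> b \<noteq> 0"
  shows "Polynomial.order 0 [:a, b:] = (if a = 0 then 1 else 0)"
  using assms by (auto intro!: order_0_eqI simp: less_Suc_eq)

lemma count_mset3: "count {#P, Q, R#} S =
  (if P = S then 1 else 0) + (if Q = S then 1 else 0) + (if R = S then 1 else 0)"
  by simp

lemma det3_span: "det3 u v (x *s u + y *s v) = (0::'a::field)"
  by (simp add: det3_def algebra_simps)

lemma line_section_perm: "line_section f P Q R \<Longrightarrow> line_section f Q R P"
  unfolding line_section_def count_mset3 by (auto simp: insert_commute add.commute add.left_commute)

context alg_closed_char_2
begin

text \<open>
  The point \<open>a u + b v\<close> of a line has the equation \<open>b s + a r = 0\<close> in the coordinates \<open>(s, r)\<close>; in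
  characteristic two no sign is needed.
\<close>

lemma proj_pt_on_line:
  fixes u v :: "'k^3"
  assumes ind: "indep2 u v" and ab: "a \<noteq> 0 \<or> b \<noteq> 0" and xy: "x \<noteq> 0 \<or> y \<noteq> 0"
  shows "proj_pt (a *s u + b *s v) = proj_pt (x *s u + y *s v) \<longleftrightarrow> b * x + a * y = 0"
proof -
  have eq: "p *s u + q *s v = p' *s u + q' *s v \<longleftrightarrow> p = p' \<and> q = q'" for p q p' q'
  proof
    assume "p *s u + q *s v = p' *s u + q' *s v"
    then have "(p - p') *s u + (q - q') *s v = 0"
      by (simp only: vector_sub_rdistrib) (simp add: algebra_simps)
    then show "p = p' \<and> q = q'" using ind unfolding indep2_def by (metis eq_iff_diff_eq_0)
  qed simp
  have nz: "a *s u + b *s v \<noteq> 0" using ind ab unfolding indep2_def by blast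
  have "proj_pt (a *s u + b *s v) = proj_pt (x *s u + y *s v) \<longleftrightarrow>
      (\<exists>k. k \<noteq> 0 \<and> x = k * a \<and> y = k * b)"
    unfolding proj_pt_eq_iff[OF nz] by (simp add: vector_add_ldistrib eq)
  also have "\<dots> \<longleftrightarrow> b * x + a * y = 0"
  proof
    assume "\<exists>k. k \<noteq> 0 \<and> x = k * a \<and> y = k * b"
    then show "b * x + a * y = 0" by (auto simp: mult.left_commute mult.commute)
  next
    assume "b * x + a * y = 0"
    then have eq: "b * x = a * y" using add_eq_0_char_2 by blast
    show "\<exists>k. k \<noteq> 0 \<and> x = k * a \<and> y = k * b"
    proof (cases "a = 0")
      case True
      then have "x = 0" "b \<noteq> 0" "y \<noteq> 0" using eq ab xy by auto
      then show ?thesis using True by (intro exI[of _ "y / b"]) simp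
    next
      case False
      then have "x \<noteq> 0" using eq xy by auto
      then show ?thesis using False eq by (intro exI[of _ "x / a"]) (simp add: field_simps)
    qed
  qed
  finally show ?thesis .
qed

text \<open>
  The restriction of the cubic to the line is a product of three linear factors, and its order of
  vanishing at a point counts the factors that vanish there.
\<close>

lemma line_section_cubicI:
  fixes u v :: "'k^3"
  assumes ind: "indep2 u v" and k: "k \<noteq> 0"
    and nz: "a1 \<noteq> 0 \<or> b1 \<noteq> 0" "a2 \<noteq> 0 \<or> b2 \<noteq> 0" "a3 \<noteq> 0 \<or> b3 \<noteq> 0"
    and split: "\<And>s r. eval (cubic A c) (s *s u + r *s v)
      = k * (b1 * s + a1 * r) * (b2 * s + a2 * r) * (b3 * s + a3 * r)"
  shows "line_section (cubic A c) (proj_pt (a1 *s u + b1 *s v)) (proj_pt (a2 *s u + b2 *s v))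
    (proj_pt (a3 *s u + b3 *s v))"
proof -
  let ?f = "cubic A c"
  define n where "n = (\<chi> i. det3 u v (axis i 1))"
  define l where "l = (\<Sum>i\<in>UNIV. Const (n $ i) * Var i)"
  have l: "eval l x = det3 u v x" for x
    by (simp add: l_def n_def sum_3 det3_def axis_def algebra_simps)
  obtain w where "det3 u v w \<noteq> 0" using indep2_det3_exists[OF ind] .
  then have "n \<noteq> 0" using l[of w] by (auto simp: l_def)
  then have lin: "linear_form l" unfolding l_def by (rule linear_formI)
  have on_l: "eval l (a *s u + b *s v) = 0" for a b
    by (simp add: l det3_def algebra_simps)
  have nonzero: "a *s u + b *s v \<noteq> 0" if "a \<noteq> 0 \<or> b \<noteq> 0" for a b
    using that ind unfolding indep2_def by blast
  have on_curve: "proj_pt (a *s u + b *s v) \<in> curve l" if "a \<noteq> 0 \<or> b \<noteq> 0" for a b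
    using curve_linear_form[OF lin nonzero[OF that]] on_l by simp
  have mult: "line_mult ?f l S = enat (count {#proj_pt (a1 *s u + b1 *s v),
      proj_pt (a2 *s u + b2 *s v), proj_pt (a3 *s u + b3 *s v)#} S)" if S: "S \<in> curve l" for S
  proof -
    obtain x where x: "S = proj_pt x" "x \<noteq> 0" "eval l x = 0" using S unfolding curve_def by blast
    have ker: "eval l y = (\<Sum>i\<in>UNIV. n$i * y$i)" for y unfolding l_def by simp
    have "eval l u = 0" "eval l v = 0" by (simp_all add: l det3_def algebra_simps)
    then obtain a b where ab: "x = a *s u + b *s v"
      using functional_kernel_span[OF \<open>n \<noteq> 0\<close> _ _ _ ind, of x] x(3) unfolding ker by metis
    have ab0: "a \<noteq> 0 \<or> b \<noteq> 0" using ab x(2) by auto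
    obtain d e where de: "a * e + b * d \<noteq> 0"
      using ab0 by (cases "a = 0") (auto intro: that[of 1 0] that[of 0 1])
    let ?w = "d *s u + e *s v"
    have indw: "indep2 x ?w"
      unfolding indep2_def
    proof (intro allI impI)
      fix p q assume "p *s x + q *s ?w = 0"
      then have "(p * a + q * d) *s u + (p * b + q * e) *s v = 0"
        unfolding ab by (simp add: vec_eq_iff algebra_simps)
      then have z: "p * a + q * d = 0" "p * b + q * e = 0" using ind unfolding indep2_def by blast+
      have eqs: "p * (a * e + b * d) = e * (p * a + q * d) + d * (p * b + q * e)"
        "q * (a * e + b * d) = b * (p * a + q * d) + a * (p * b + q * e)"
        by (simp_all add: algebra_simps)
      have "p * (a * e + b * d) = 0" "q * (a * e + b * d) = 0"
        unfolding eqs z by simp_all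
      then show "p = 0 \<and> q = 0" using de by simp
    qed
    define L where "L ai bi = [:bi * a + ai * b, bi * d + ai * e:]" for ai bi
    have lr: "line_restrict ?f x ?w = smult k (L a1 b1 * L a2 b2 * L a3 b3)"
    proof (rule poly_ext)
      fix t
      have "x + t *s ?w = (a + t * d) *s u + (b + t * e) *s v"
        unfolding ab by (simp add: vec_eq_iff algebra_simps)
      then have "poly (line_restrict ?f x ?w) t = eval ?f ((a + t * d) *s u + (b + t * e) *s v)"
        by (simp only: poly_line_restrict)
      then show "poly (line_restrict ?f x ?w) t = poly (smult k (L a1 b1 * L a2 b2 * L a3 b3)) t"
        unfolding split L_def by (simp add: algebra_simps)
    qed
    have L0: "bi * a + ai * b \<noteq> 0 \<or> bi * d + ai * e \<noteq> 0" if "ai \<noteq> 0 \<or> bi \<noteq> 0" for ai bi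
    proof (rule ccontr)
      assume "\<not> ?thesis"
      then have z: "bi * a + ai * b = 0" "bi * d + ai * e = 0" by auto
      have eqs: "bi * (a * e + b * d) = e * (bi * a + ai * b) + b * (bi * d + ai * e)"
        "ai * (a * e + b * d) = d * (bi * a + ai * b) + a * (bi * d + ai * e)"
        by (simp_all add: algebra_simps)
      have "bi * (a * e + b * d) = 0" "ai * (a * e + b * d) = 0"
        unfolding eqs z by simp_all
      then show False using de that by simp
    qed
    have ord: "Polynomial.order 0 (L ai bi) = (if proj_pt (ai *s u + bi *s v) = S then 1 else 0)"
      "L ai bi \<noteq> 0" if "ai \<noteq> 0 \<or> bi \<noteq> 0" for ai bi
      using order_linear_factor[OF L0[OF that]] L0[OF that] proj_pt_on_line[OF ind that ab0]
      by (auto simp: L_def x(1) ab)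
    have nz_prod: "L a1 b1 * L a2 b2 * L a3 b3 \<noteq> 0" using ord(2) nz by simp
    have "line_restrict ?f x ?w \<noteq> 0" unfolding lr using k nz_prod by simp
    moreover have "Polynomial.order 0 (line_restrict ?f x ?w) = count {#proj_pt (a1 *s u + b1 *s v),
      proj_pt (a2 *s u + b2 *s v), proj_pt (a3 *s u + b3 *s v)#} S"
    proof -
      have "Polynomial.order 0 (line_restrict ?f x ?w) = Polynomial.order 0 (L a1 b1) +
          Polynomial.order 0 (L a2 b2) + Polynomial.order 0 (L a3 b3)"
        unfolding lr order_smult[OF k] using ord(2) nz by (simp add: order_mult)
      then show ?thesis unfolding count_mset3 ord(1)[OF nz(1)] ord(1)[OF nz(2)] ord(1)[OF nz(3)] .
    qed
    moreover have "line_mult ?f l (proj_pt x) =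
      (if line_restrict ?f x ?w = 0 then \<infinity> else enat (Polynomial.order 0 (line_restrict ?f x ?w)))"
      unfolding line_mult_cubic[OF lin x(3) on_l indw] line_restrict_cubic
      by (rule order_cubic_poly[symmetric])
    ultimately show ?thesis unfolding x(1) by simp
  qed
  show ?thesis unfolding line_section_def
    using lin on_curve[OF nz(1)] on_curve[OF nz(2)] on_curve[OF nz(3)] mult by blast
qed

lemma line_mult_ge_2_tangent:
  fixes p w :: "'k^3"
  assumes "linear_form l" "eval l p = 0" "eval l w = 0" "indep2 p w"
    and "line_mult (cubic A c) l (proj_pt p) = enat n" "n \<ge> 2"
  shows "polar A c p p = 0" "polar A c p w = 0"
proof -
  have "lowest_index (polar A c p p) (polar A c p w) (polar A c w p) (polar A c w w) = enat n"
    using line_mult_cubic[OF assms(1-4), of A c] assms(5) by simp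
  then show "polar A c p p = 0" "polar A c p w = 0"
    using assms(6) unfolding lowest_index_def
    by (auto simp: zero_enat_def one_enat_def split: if_splits)
qed

text \<open>
  At a smooth point the derivative is a nonzero functional, and a line of multiplicity at least two
  lies in its kernel.
\<close>

lemma tangent_line_unique:
  fixes p :: "'k^3"
  assumes smooth: "smooth (cubic A c)" and p: "p \<noteq> 0"
    and l: "linear_form l" "eval l p = 0" "line_mult (cubic A c) l (proj_pt p) = enat n" "n \<ge> 2"
  shows "eval l x = 0 \<longleftrightarrow> polar A c p x = 0"
proof -
  obtain n where n: "n \<noteq> 0" and ln: "l = (\<Sum>i\<in>UNIV. Const (n $ i) * Var i)"
    using linear_form_functional[OF l(1)] .
  have ev: "eval l y = (\<Sum>i\<in>UNIV. n $ i * y $ i)" for y unfolding ln by simp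
  obtain b w where b: "(\<Sum>i\<in>UNIV. n$i * b$i) = 1" and w: "(\<Sum>i\<in>UNIV. n$i * w$i) = 0"
    and d: "det3 b w p \<noteq> 0"
    using functional_basis_through[OF n _ p] l(2) unfolding ev by metis
  have ind: "indep2 p w"
  proof -
    have "det3 p w b \<noteq> 0" using d by (simp add: det3_def algebra_simps)
    then show ?thesis by (rule det3_indep2)
  qed
  have t: "polar A c p p = 0" "polar A c p w = 0"
    using line_mult_ge_2_tangent[OF l(1,2) _ ind l(3,4)] w ev by simp_all
  define m where "m = (\<chi> j. polar A c p (axis j 1))"
  have m: "polar A c p y = (\<Sum>j\<in>UNIV. m $ j * y $ j)" for y
    unfolding m_def by (subst polar_functional) simp
  have m0: "m \<noteq> 0"
  proof
    assume "m = 0"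
    then have "polar A c p y = 0" for y unfolding m by simp
    then show False using smooth_cubic[OF smooth] p by blast
  qed
  show ?thesis
  proof
    assume "eval l x = 0"
    then obtain a b where x: "x = a *s p + b *s w"
      using functional_kernel_span[OF n _ _ _ ind, of x] l(2) w unfolding ev by metis
    show "polar A c p x = 0" unfolding x polar_add_right polar_scale_right t by simp
  next
    assume "polar A c p x = 0"
    then obtain a b where x: "x = a *s p + b *s w"
      using functional_kernel_span[OF m0 _ _ _ ind, of x] t unfolding m by metis
    have "eval l x = a * eval l p + b * eval l w"
      unfolding ev x by (simp add: sum_3 algebra_simps)
    moreover have "eval l w = 0" unfolding ev by (rule w)
    ultimately show "eval l x = 0" using l(2) by simp
  qed
qed

text \<open>
  The line is determined as the line through \<open>P\<close> and \<open>Q\<close> if they differ and as tangent line if they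
  agree. The intersection multiplicities with it then determine the third point.
\<close>

lemma line_section_unique:
  fixes A :: "'k^3^3"
  assumes smooth: "smooth (cubic A c)"
    and "line_section (cubic A c) P Q R" "line_section (cubic A c) P Q R'"
  shows "R = R'"
proof -
  let ?f = "cubic A c"
  obtain l where l: "linear_form l" "{P, Q, R} \<subseteq> curve l"
    "\<forall>S\<in>curve l. line_mult ?f l S = enat (count {#P, Q, R#} S)"
    using assms(2) unfolding line_section_def by blast
  obtain l' where l': "linear_form l'" "{P, Q, R'} \<subseteq> curve l'"
    "\<forall>S\<in>curve l'. line_mult ?f l' S = enat (count {#P, Q, R'#} S)"
    using assms(3) unfolding line_section_def by blast
  obtain p where p: "P = proj_pt p" "p \<noteq> 0" "eval l p = 0" using l(2) unfolding curve_def by blast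
  obtain q where q: "Q = proj_pt q" "q \<noteq> 0" "eval l q = 0" using l(2) unfolding curve_def by blast
  have p': "eval l' p = 0" using l'(2) curve_linear_form[OF l'(1) p(2)] p(1) by simp
  have q': "eval l' q = 0" using l'(2) curve_linear_form[OF l'(1) q(2)] q(1) by simp
  have same: "eval l x = 0 \<longleftrightarrow> eval l' x = 0" for x
  proof (cases "P = Q")
    case True
    have "line_mult ?f l (proj_pt p) = enat (count {#P, Q, R#} P)"
      "line_mult ?f l' (proj_pt p) = enat (count {#P, Q, R'#} P)"
      using l(2,3) l'(2,3) unfolding p(1)[symmetric] by simp_all
    moreover have "count {#P, Q, R#} P \<ge> 2" "count {#P, Q, R'#} P \<ge> 2"
      using True unfolding count_mset3 by simp_all
    ultimately show ?thesis
      using tangent_line_unique[OF smooth p(2) l(1) p(3), of _ x]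
        tangent_line_unique[OF smooth p(2) l'(1) p', of _ x] by metis
  next
    case False
    then have ind: "indep2 p q" using indep2_iff_proj_pt[OF p(2) q(2)] p(1) q(1) by simp
    have incl: "eval m' x = 0" if m: "linear_form m" "eval m p = 0" "eval m q = 0" "eval m x = 0"
      and m': "linear_form m'" "eval m' p = 0" "eval m' q = 0" for m m'
    proof -
      obtain n where n: "n \<noteq> 0" and mn: "m = (\<Sum>i\<in>UNIV. Const (n $ i) * Var i)"
        using linear_form_functional[OF m(1)] .
      obtain n' where mn': "m' = (\<Sum>i\<in>UNIV. Const (n' $ i) * Var i)"
        using linear_form_functional[OF m'(1)] .
      have ev: "eval m y = (\<Sum>i\<in>UNIV. n $ i * y $ i)" for y unfolding mn by simp
      obtain a b where x: "x = a *s p + b *s q"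
        using functional_kernel_span[OF n _ _ _ ind, of x] m(2-4) unfolding ev by metis
      have "eval m' x = a * eval m' p + b * eval m' q"
        unfolding x mn' by (simp add: sum_3 algebra_simps)
      then show ?thesis using m' by simp
    qed
    show ?thesis using incl[OF l(1) p(3) q(3) _ l'(1) p' q'] incl[OF l'(1) p' q' _ l(1) p(3) q(3)] by blast
  qed
  have "count {#P, Q, R#} S = count {#P, Q, R'#} S" for S
  proof (cases "S \<in> curve l")
    case True
    then have "enat (count {#P, Q, R#} S) = line_mult ?f l S" using l(3) by simp
    also have "\<dots> = line_mult ?f l' S" by (rule line_mult_cong) (rule same)
    also have "\<dots> = enat (count {#P, Q, R'#} S)" using l'(3) True curve_cong[OF same] by simp
    finally show ?thesis by simp
  next
    case False
    moreover have "S \<notin> curve l'" using False curve_cong[OF same] by simp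
    ultimately have "P \<noteq> S" "Q \<noteq> S" "R \<noteq> S" "R' \<noteq> S" using l(2) l'(2) by blast+
    then show ?thesis unfolding count_mset3 by simp
  qed
  then have "{#P, Q, R#} = {#P, Q, R'#}" by (rule multiset_eqI)
  then show "R = R'" by simp
qed

lemma third_point_eq:
  fixes A :: "'k^3^3"
  assumes "smooth (cubic A c)" "line_section (cubic A c) P Q R"
  shows "third_point (cubic A c) P Q = R"
  unfolding third_point_def
  by (rule the_equality[where P = "line_section (cubic A c) P Q", OF assms(2)])
    (rule line_section_unique[OF assms(1) _ assms(2)])

lemma line_section_exists:
  fixes p q :: "'k^3"
  assumes smooth: "smooth (cubic A c)" and p: "p \<noteq> 0" "polar A c p p = 0" and q: "q \<noteq> 0" "polar A c q q = 0"
    and ne: "proj_pt p \<noteq> proj_pt q"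
  obtains R where "line_section (cubic A c) (proj_pt p) (proj_pt q) R"
proof -
  have ind: "indep2 p q" using indep2_iff_proj_pt[OF p(1) q(1)] ne by simp
  let ?b = "polar A c p q" and ?g = "polar A c q p"
  have nz: "?g \<noteq> 0 \<or> ?b \<noteq> 0"
    using smooth_cubic_contains_no_line[OF smooth ind p(2) _ _ q(2)] by blast
  have "line_section (cubic A c) (proj_pt (1 *s p + 0 *s q)) (proj_pt (0 *s p + 1 *s q))
      (proj_pt (?g *s p + ?b *s q))"
    by (rule line_section_cubicI[where k = 1, OF ind _ _ _ nz])
      (simp_all add: eval_cubic_line p q power2_eq_square algebra_simps)
  then show thesis using that by simp
qed

text \<open>
  Let \<open>T\<close> be the third point on the tangent at \<open>E\<close>. If the tangent at \<open>P \<noteq> E\<close> passes through \<open>T\<close>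
  too, then \<open>P + P\<close> is the third point of \<open>E\<close> and \<open>T\<close>, which is \<open>E\<close>. The line through \<open>T = [t]\<close> and
  \<open>[w]\<close> is a tangent with double point away from \<open>T\<close>, or an inflectional tangent at \<open>T\<close>, if the
  coefficient \<open>P(w, t)\<close> of the linear term in \<open>s\<close> of the cubic at \<open>s t + w\<close> vanishes. This quadratic
  form in \<open>w\<close> does not change when a multiple of \<open>t\<close> is added to \<open>w\<close>, and it vanishes at a vector
  \<open>v\<close> on the tangent at \<open>E\<close>. Its polarization is \<open>c \<noteq> 0\<close> times a determinant, so that it has a second
  zero, off this tangent.
\<close>

theorem ell_2_torsion:
  fixes A :: "'k^3^3"
  assumes smooth: "smooth (cubic A c)" and c: "c \<noteq> 0" and E: "E \<in> curve (cubic A c)"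
  obtains P where "P \<in> curve (cubic A c)" "P \<noteq> E" "ell_mult (cubic A c) E 2 P = E"
proof -
  let ?f = "cubic A c"
  obtain e where e: "E = proj_pt e" "e \<noteq> 0" "polar A c e e = 0"
    using E unfolding curve_def eval_cubic by blast
  define m where "m = (\<chi> j. polar A c e (axis j 1))"
  have m: "polar A c e y = (\<Sum>j\<in>UNIV. m $ j * y $ j)" for y
    unfolding m_def by (subst polar_functional) simp
  have "m \<noteq> 0"
  proof
    assume "m = 0"
    then have "polar A c e y = 0" for y unfolding m by simp
    then show False using smooth_cubic[OF smooth] e(2) by blast
  qed
  then obtain b d where b: "polar A c e b = 1" and d: "polar A c e d = 0" and det: "det3 b d e \<noteq> 0"
    using functional_basis_through[of m e] e(2,3) unfolding m by metis
  have det': "det3 e d b \<noteq> 0" using det by (simp add: det3_def algebra_simps)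
  have ind: "indep2 e d" using det' by (rule det3_indep2)
  define g where "g = polar A c d e"
  define h where "h = polar A c d d"
  have gh: "h \<noteq> 0 \<or> g \<noteq> 0"
    using smooth_cubic_contains_no_line[OF smooth ind e(3) d] unfolding g_def h_def by blast
  (* On the tangent the cubic is r^2 (g s + h r), where s and r are the coordinates for e and d. *)
  define t where "t = h *s e + g *s d"
  have secE: "line_section ?f E E (proj_pt t)"
  proof -
    have "line_section ?f (proj_pt (1 *s e + 0 *s d)) (proj_pt (1 *s e + 0 *s d)) (proj_pt t)"
      unfolding t_def
      by (rule line_section_cubicI[where k = 1, OF ind _ _ _ gh])
        (simp_all add: eval_cubic_line e d power2_eq_square power3_eq_cube algebra_simps
          flip: g_def h_def)
    then show ?thesis by (simp add: e(1))
  qed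
  have t0: "t \<noteq> 0" using ind gh unfolding t_def indep2_def by blast
  have tt: "polar A c t t = 0"
    using eval_cubic_line[of A c h e g d] unfolding eval_cubic
    by (simp add: t_def e d power2_eq_square power3_eq_cube flip: g_def h_def)
  obtain v x y where v: "det3 t v b \<noteq> 0" "polar A c v t = 0" and ev: "e = x *s t + y *s v"
    and gv: "g = 0 \<Longrightarrow> t = h *s e \<and> v = d"
  proof (cases "g = 0")
    case True
    then have h: "h \<noteq> 0" and t: "t = h *s e" using gh by (auto simp: t_def)
    show ?thesis
    proof (rule that[of d "1 / h" 0])
      have "det3 t d b = h * det3 e d b" unfolding t by (simp add: det3_def algebra_simps)
      then show "det3 t d b \<noteq> 0" using h det' by simp
      show "polar A c d t = 0" unfolding t using True by (simp add: polar_scale_right g_def)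
      show "e = (1 / h) *s t + 0 *s d" unfolding t using h by simp
    qed (use t in simp)
  next
    case False
    show ?thesis
    proof (rule that[of e 0 1])
      have "det3 t e b = g * det3 e d b" by (simp add: t_def det3_def algebra_simps)
      then show "det3 t e b \<noteq> 0" using False det' by simp
      show "polar A c e t = 0"
        by (simp add: t_def polar_add_right polar_scale_right e d)
    qed (use False in simp_all)
  qed
  (* Adding a v to b changes P(b, t) by a c det3 t v b because P(v, t) = 0. *)
  define a where "a = polar A c b t / (c * det3 t v b)"
  define w where "w = a *s v + b"
  have det_w: "det3 t v w = det3 t v b" by (simp add: w_def det3_def algebra_simps)
  have wt: "polar A c w t = 0"
  proof -
    have "det3 (a *s v) b t = a * det3 t v b" by (simp add: det3_def algebra_simps)
    then have "polar A c w t = polar A c b t + c * (a * det3 t v b)"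
      by (simp add: w_def polar_linear v)
    also have "c * (a * det3 t v b) = polar A c b t" using c v(1) by (simp add: a_def)
    finally show ?thesis by simp
  qed
  have ind_tw: "indep2 t w"
  proof -
    have "det3 t w v \<noteq> 0" using v(1) unfolding det_w[symmetric] by (simp add: det3_def algebra_simps)
    then show ?thesis by (rule det3_indep2)
  qed
  define L where "L = polar A c t w"
  define K where "K = polar A c w w"
  have LK: "L \<noteq> 0 \<or> K \<noteq> 0"
    using smooth_cubic_contains_no_line[OF smooth ind_tw tt _ wt] unfolding L_def K_def by blast
  have line: "eval ?f (s *s t + r *s w) = s\<^sup>2 * r * L + r ^ 3 * K" for s r
    unfolding eval_cubic_line by (simp add: tt wt L_def K_def)
  obtain p where p: "p \<noteq> 0" "eval ?f p = 0" "proj_pt p \<noteq> E"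
    and secP: "line_section ?f (proj_pt p) (proj_pt p) (proj_pt t)"
  proof (cases "L = 0")
    case True
    then have K: "K \<noteq> 0" using LK by blast
    have "line_section ?f (proj_pt (1 *s t + 0 *s w)) (proj_pt (1 *s t + 0 *s w)) (proj_pt (1 *s t + 0 *s w))"
      by (rule line_section_cubicI[where k = K, OF ind_tw K])
        (simp_all add: line True power3_eq_cube algebra_simps)
    then have sec: "line_section ?f (proj_pt t) (proj_pt t) (proj_pt t)" by simp
    (* For g = 0 the points E and T agree, and L = 0 would put w on the tangent at E. *)
    have "g \<noteq> 0"
    proof
      assume g: "g = 0"
      then have "h \<noteq> 0" using gh by simp
      moreover have "L = h\<^sup>2 * polar A c e w" unfolding L_def using gv[OF g] by (simp add: polar_scale_left)
      moreover have "polar A c e w = 1"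
        using gv[OF g] b d by (simp add: w_def polar_add_right polar_scale_right)
      ultimately show False using True by simp
    qed
    have "proj_pt t \<noteq> E"
    proof
      assume "proj_pt t = E"
      then have "proj_pt (h *s e + g *s d) = proj_pt (1 *s e + 0 *s d)" by (simp add: t_def e(1))
      then show False using proj_pt_on_line[OF ind gh, of 1 0] \<open>g \<noteq> 0\<close> by simp
    qed
    then show ?thesis using that[of t] t0 tt sec by (simp add: eval_cubic)
  next
    case False
    obtain s where s: "s\<^sup>2 = K / L" using sqrt_exists .
    then have sL: "L * (s * s) = K" using False by (simp add: power2_eq_square)
    let ?p = "s *s t + 1 *s w"
    have "line_section ?f (proj_pt ?p) (proj_pt ?p) (proj_pt (1 *s t + 0 *s w))"
      by (rule line_section_cubicI[where k = L, OF ind_tw False])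
        (simp_all add: line power2_eq_square power3_eq_cube algebra_simps sL flip: sL)
    moreover have "?p \<noteq> 0" using ind_tw unfolding indep2_def by (metis one_neq_zero)
    moreover have "eval ?f ?p = 0" unfolding line using sL by (simp add: power2_eq_square mult.commute)
    moreover have "proj_pt ?p \<noteq> E"
    proof
      assume "proj_pt ?p = E"
      then obtain k where "k \<noteq> 0" "e = k *s ?p"
        using proj_pt_eq_iff[OF \<open>?p \<noteq> 0\<close>] e(1) by blast
      then have "det3 t v (k *s ?p) = 0" using ev by (metis det3_span)
      moreover have "det3 t v (k *s ?p) = k * det3 t v w" by (simp add: det3_def algebra_simps)
      ultimately show False using \<open>k \<noteq> 0\<close> v(1) det_w by simp
    qed
    ultimately show ?thesis using that[of ?p] by simp
  qed
  have pp: "polar A c p p = 0" using p(2) by (simp add: eval_cubic)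
  obtain R where R: "line_section ?f (proj_pt p) E R"
    using line_section_exists[OF smooth p(1) pp e(2,3)] p(3) e(1) by metis
  have "third_point ?f (proj_pt p) E = R" by (rule third_point_eq[OF smooth R])
  moreover have "third_point ?f E R = proj_pt p"
    by (rule third_point_eq[OF smooth line_section_perm[OF R]])
  moreover have "third_point ?f (proj_pt p) (proj_pt p) = proj_pt t" by (rule third_point_eq[OF smooth secP])
  moreover have "third_point ?f E (proj_pt t) = E"
    by (rule third_point_eq[OF smooth line_section_perm[OF secE]])
  ultimately have "ell_mult ?f E 2 (proj_pt p) = E"
    by (simp add: ell_mult_def ell_add_def numeral_2_eq_2)
  moreover have "proj_pt p \<in> curve ?f" using p(1,2) unfolding curve_def by blast
  ultimately show thesis using that p(3) by blast
qed

end

section \<open>The curves of the list\<close>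

subsection \<open>Factors of forms\<close>

interpretation poly_Const_hom: coeff_hom "\<lambda>c. [:Const c:]"
  by unfold_locales (simp_all add: Const_add Const_mult)

text \<open>
  The polynomial \<open>p(xT, yT, zT)\<close> in a new variable \<open>T\<close>. Its coefficients are the homogeneous parts
  of \<open>p\<close>, so that a form becomes a monomial in \<open>T\<close>.
\<close>

definition homogenize :: "'a::field ternary \<Rightarrow> 'a ternary poly" where
  "homogenize p = insertion (\<lambda>c. [:Const c:]) (\<lambda>i. [:0, Var i:]) p"

lemma homogenize_mult: "homogenize (p * q) = homogenize p * homogenize q"
  by (simp add: homogenize_def poly_Const_hom.insertion_mult)

lemma coeff_homogenize: "coeff (homogenize p) d = hom_part d p"
proof (induction p rule: mpoly_induct)
  case (monom m c)
  have var: "[:0, Var i :: 'a ternary:] ^ k = Polynomial.monom (Var i ^ k) k" for i k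
    by (induction k) (simp_all add: monom_0 monom_Suc smult_monom one_pCons)
  have "homogenize (Poly_Mapping.single m c) = Polynomial.monom (Poly_Mapping.single m c) (mono_degree m)"
    unfolding homogenize_def poly_Const_hom.insertion_monom prod_UNIV_3 var
    by (subst monomial_eq_prod[of m c])
      (simp add: mult_monom prod_UNIV_3 mono_degree_def sum_3 smult_monom mult.assoc)
  then show ?case
    by (intro poly_mapping_eqI) (auto simp: hom_part_lookup lookup_single when_def)
next
  case (add p q)
  then show ?case by (simp add: homogenize_def poly_Const_hom.insertion_add hom_part_add)
qed

text \<open>
  Degree and order of vanishing at zero are both additive and agree for a monomial. As the order is
  at most the degree, they agree for the factors as well.
\<close>

lemma factors_of_monom:
  fixes p q :: "'a::idom poly"
  assumes "p * q = Polynomial.monom g d" "g \<noteq> 0"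
  obtains i j where "i + j = d" "\<forall>k. k \<noteq> i \<longrightarrow> coeff p k = 0" "\<forall>k. k \<noteq> j \<longrightarrow> coeff q k = 0"
proof -
  have pq: "p * q \<noteq> 0" using assms by simp
  then have nz: "p \<noteq> 0" "q \<noteq> 0" by auto
  have "degree p + degree q = d"
    using degree_mult_eq[OF nz] assms by (simp add: degree_monom_eq)
  moreover have "Polynomial.order 0 p + Polynomial.order 0 q = d"
    using order_mult[OF pq, of 0] order_0_eqI[of "Polynomial.monom g d" d] assms by simp
  moreover have "Polynomial.order 0 p \<le> degree p" "Polynomial.order 0 q \<le> degree q"
    using nz by (auto intro: order_degree)
  ultimately have o: "Polynomial.order 0 p = degree p" "Polynomial.order 0 q = degree q" by simp_all
  have "coeff r k = 0" if "Polynomial.order 0 r = degree r" "k \<noteq> degree r" for r :: "'a poly" and k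
  proof (cases "k < degree r")
    case True
    then have "r \<noteq> 0" by auto
    then have "Polynomial.monom 1 (degree r) dvd r" using monom_1_dvd_iff[of r "degree r"] that(1) by simp
    then show ?thesis using True monom_1_dvd_iff' by blast
  next
    case False
    then show ?thesis using that(2) by (simp add: coeff_eq_0)
  qed
  then show thesis using that \<open>degree p + degree q = d\<close> o by blast
qed

lemma form_if_hom_parts_vanish:
  assumes "\<And>k. k \<noteq> d \<Longrightarrow> hom_part k p = 0" shows "form d p"
  unfolding form_def
proof (rule ballI, rule ccontr)
  fix m assume m: "m \<in> Poly_Mapping.keys p" "mono_degree m \<noteq> d"
  then have "Poly_Mapping.lookup (hom_part (mono_degree m) p) m = 0" using assms by simp
  then show False using m(1) by (simp add: hom_part_lookup in_keys_iff)
qed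

lemma factors_of_form:
  fixes p q :: "'a::field ternary"
  assumes "form d (p * q)" "p * q \<noteq> 0"
  obtains i j where "i + j = d" "form i p" "form j q"
proof -
  have "homogenize p * homogenize q = Polynomial.monom (p * q) d"
  proof (rule poly_eqI)
    fix k show "coeff (homogenize p * homogenize q) k = coeff (Polynomial.monom (p * q) d) k"
      unfolding homogenize_mult[symmetric] coeff_homogenize using hom_part_form[OF assms(1), of k] by auto
  qed
  then obtain i j where ij: "i + j = d" and i: "\<forall>k. k \<noteq> i \<longrightarrow> hom_part k p = 0"
    and j: "\<forall>k. k \<noteq> j \<longrightarrow> hom_part k q = 0"
    using factors_of_monom[of "homogenize p" "homogenize q", OF _ assms(2)]
    unfolding coeff_homogenize by blast
  have "form i p" "form j q" using i j by (simp_all add: form_if_hom_parts_vanish)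
  with ij show thesis by (rule that)
qed

lemma form_0_eq_Const:
  fixes p :: "'a::field ternary"
  assumes "form 0 p" shows "p = Const (Poly_Mapping.lookup p 0)"
proof (rule poly_mapping_eqI)
  fix m
  show "Poly_Mapping.lookup p m = Poly_Mapping.lookup (Const (Poly_Mapping.lookup p 0)) m"
  proof (cases "m = 0")
    case False
    then have "mono_degree m \<noteq> 0" by (auto simp: mono_degree_def intro!: poly_mapping_eqI)
    then have "m \<notin> Poly_Mapping.keys p" using assms unfolding form_def by auto
    then show ?thesis using False by (simp add: Const_def lookup_single in_keys_iff)
  qed (simp add: Const_def)
qed

lemma form_0_unit:
  fixes p :: "'a::field ternary"
  assumes "form 0 p" "p \<noteq> 0" shows "p dvd 1"
proof -
  obtain c where c: "p = Const c" using form_0_eq_Const[OF assms(1)] by blast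
  then have "c \<noteq> 0" using assms(2) by auto
  then have "p * Const (1 / c) = 1" unfolding c Const_mult[symmetric] by simp
  then show ?thesis by (metis dvd_triv_left)
qed

lemma tangent_cone_eq:
  assumes "taylor v f = p + q" "form d p" "form (Suc d) q" "p \<noteq> 0"
  shows "point_mult f v = d" "tangent_cone f v = p"
proof -
  have h: "hom_part e (taylor v f) = (if e = d then p else if e = Suc d then q else 0)" for e
    unfolding assms(1) hom_part_add using hom_part_form[OF assms(2), of e] hom_part_form[OF assms(3), of e] by simp
  show "point_mult f v = d"
    unfolding point_mult_def
  proof (rule Least_equality)
    show "hom_part d (taylor v f) \<noteq> 0" using h assms(4) by simp
    show "d \<le> e" if "hom_part e (taylor v f) \<noteq> 0" for e
      using that unfolding h by (auto split: if_splits)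
  qed
  then show "tangent_cone f v = p" unfolding tangent_cone_def using h by simp
qed

lemma form_Var_power: "form n (Var i ^ n)"
  using form_power[OF form_Var, of n i] by simp

lemma proj_pt_z:
  assumes "v \<noteq> 0" "v$1 = 0" "v$2 = (0::'a::field)"
  shows "proj_pt v = proj_pt (vector [0, 0, 1])"
proof -
  have "v$3 \<noteq> 0" using assms by (simp add: vec3_eq_iff)
  then have "\<exists>k. k \<noteq> 0 \<and> vector [0, 0, 1] = k *s v"
    using assms by (intro exI[of _ "1 / v$3"]) (simp add: vec3_eq_iff)
  then show ?thesis using proj_pt_eq_iff[OF assms(1)] by blast
qed

lemma vec_z_nonzero: "(vector [0, 0, 1] :: 'a::field^3) \<noteq> 0"
  by (simp add: vec3_eq_iff)

context alg_closed_char_2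
begin

lemma fermat_eq_cubic: "vx^3 + vy^3 + vz^3 = cubic (mat3 1 0 0 0 1 0 0 0 1) (0::'k)"
  and cuspidal_eq_cubic: "vx^2 * vz + vy^3 = cubic (mat3 0 0 1 0 1 0 0 0 0) (0::'k)"
  and conic_tangent_eq_cubic: "vx^2 * vz + vx * vy^2 = cubic (mat3 0 0 1 1 0 0 0 0 0) (0::'k)"
  by (simp_all add: cubic_def sum_3 power2_eq_square power3_eq_cube algebra_simps)

lemma smooth_fermat: "smooth (vx^3 + vy^3 + vz^3 :: 'k ternary)"
  unfolding fermat_eq_cubic
proof -
  have "u = 0" if "\<forall>i. eval (partial i (cubic (mat3 1 0 0 0 1 0 0 0 1) (0::'k))) u = 0" for u
    using that unfolding partial_cubic forall_3
    by (simp add: polar_def gram_def sum_3 axis_def vec3_eq_iff)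
  then show "smooth (cubic (mat3 1 0 0 0 1 0 0 0 1) (0::'k))"
    unfolding smooth_def singular_points_def by blast
qed

text \<open>
  The derivative at \<open>u\<close> is given by the transposed matrix applied to the squares of the coordinates,
  and every vector consists of squares.
\<close>

lemma smooth_imp_invertible:
  assumes "smooth (cubic A (0::'k))" shows "invertible A"
proof (rule ccontr)
  assume "\<not> invertible A"
  then have "\<not> invertible (transpose A)" by (simp add: invertible_det_nz det_transpose)
  then obtain x where x: "x \<noteq> 0" "transpose A *v x = 0" by (rule singular_matrix_kernel)
  define u where "u = (\<chi> i. char2_root (x $ i))"
  have g: "gram A u w = (\<Sum>j\<in>UNIV. (transpose A *v x) $ j * w $ j)" for w
    by (simp add: gram_def u_def char2_root_square matrix_vector_mult_def transpose_def sum_3 algebra_simps)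
  have "polar A 0 u w = 0" for w unfolding polar_def g x(2) by simp
  then have "u = 0" using smooth_cubic[OF assms] by blast
  then have "char2_root (x $ i) = 0" for i unfolding u_def by (simp add: vec_eq_iff)
  then have "x = 0" using char2_root_eq_0_iff by (simp add: vec_eq_iff)
  then show False using x(1) by contradiction
qed

lemma smooth_no_mixed_term_fermat:
  assumes "smooth (cubic A (0::'k))" shows "proj_equiv (cubic A 0) (vx^3 + vy^3 + vz^3)"
  unfolding fermat_eq_cubic
  by (rule congr_imp_proj_equiv[OF invertible_congr_fermat[OF smooth_imp_invertible[OF assms]]])

text \<open>
  A proper factorization of a cubic form contains a linear form, whose zeros would all lie on the
  curve; but no line lies on it.
\<close>

lemma irreducible_cuspidal: "Factorial_Ring.irreducible (vx^2 * vz + vy^3 :: 'k ternary)"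
proof (rule irreducibleI)
  let ?g = "vx^2 * vz + vy^3 :: 'k ternary"
  have g0: "?g \<noteq> 0"
  proof
    assume zero: "?g = 0"
    show False using arg_cong[OF zero, of "\<lambda>p. eval p (vector [0, 1, 0])"] by simp
  qed
  then show "?g \<noteq> 0" .
  show "\<not> ?g dvd 1"
  proof
    assume "?g dvd 1"
    then obtain h where h: "1 = ?g * h" by (elim dvdE)
    show False using arg_cong[OF h, of "\<lambda>p. eval p (vector [0, 0, 1])"] by simp
  qed
  have no_linear: "\<not> form 1 a" if ab: "?g = a * b" for a b
  proof
    assume "form 1 a"
    then obtain n where a: "a = (\<Sum>i\<in>UNIV. Const (n $ i) * Var i)" by (rule form_1_eq)
    have zero: "(x$1)\<^sup>2 * x$3 + (x$2)^3 = 0" if "n$1 * x$1 + n$2 * x$2 + n$3 * x$3 = 0" for x :: "'k^3"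
    proof -
      have "eval ?g x = eval a x * eval b x" unfolding ab by simp
      then show ?thesis using that by (simp add: a sum_3)
    qed
    have n3: "n$3 = 0" using zero[of "vector [0, n$3, n$2]"] by (simp add: mult.commute)
    have n1: "n$1 = 0"
      using zero[of "vector [n$2, n$1, 0]"] n3 by (simp add: mult.commute)
    have "n$2 = 0" using zero[of "vector [1, 0, 1]"] zero[of "vector [n$2, n$1, 1]"] n1 n3
      by simp
    then have "a = 0" using n1 n3 by (simp add: a sum_3)
    then show False using ab g0 by simp
  qed
  fix a b assume ab: "?g = a * b"
  have "form 3 ?g" unfolding cuspidal_eq_cubic by (rule form_cubic)
  then obtain i j where ij: "i + j = 3" "form i a" "form j b"
    using factors_of_form[of 3 a b] g0 ab by metis
  have "i \<noteq> 1" "j \<noteq> 1" using no_linear[of a b] no_linear[of b a] ij ab by (auto simp: mult.commute)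
  then have "i = 0 \<or> j = 0" using ij(1) by arith
  moreover have "a \<noteq> 0" "b \<noteq> 0" using g0 ab by auto
  ultimately show "a dvd 1 \<or> b dvd 1" using form_0_unit ij(2,3) by blast
qed

lemma singular_points_cuspidal:
  "singular_points (vx^2 * vz + vy^3 :: 'k ternary) = {proj_pt (vector [0, 0, 1])}"
proof (intro equalityI subsetI)
  fix P assume "P \<in> singular_points (vx^2 * vz + vy^3 :: 'k ternary)"
  then obtain v where v: "P = proj_pt v" "v \<noteq> 0"
    "\<forall>i. eval (partial i (vx^2 * vz + vy^3 :: 'k ternary)) v = 0"
    unfolding singular_points_def by blast
  then have "v$1 = 0" "v$2 = 0"
    unfolding cuspidal_eq_cubic partial_cubic forall_3
    by (simp_all add: polar_def gram_def sum_3 axis_def)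
  then show "P \<in> {proj_pt (vector [0, 0, 1])}" using proj_pt_z v by simp
next
  fix P :: "('k^3) set" assume P: "P \<in> {proj_pt (vector [0, 0, 1])}"
  have "eval (vx^2 * vz + vy^3 :: 'k ternary) (vector [0, 0, 1]) = 0" by simp
  moreover have "\<forall>i. eval (partial i (vx^2 * vz + vy^3 :: 'k ternary)) (vector [0, 0, 1]) = 0"
    unfolding cuspidal_eq_cubic partial_cubic forall_3
    by (simp add: polar_def gram_def sum_3 axis_def)
  ultimately show "P \<in> singular_points (vx^2 * vz + vy^3 :: 'k ternary)"
    unfolding singular_points_def using P vec_z_nonzero by blast
qed

lemma linear_form_Var: "linear_form (Var i :: 'k ternary)"
  unfolding linear_form_def
proof
  have "eval (Var i :: 'k ternary) (axis i 1) \<noteq> eval 0 (axis i 1)" by (simp add: axis_def)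
  then show "(Var i :: 'k ternary) \<noteq> 0" by metis
qed (rule form_Var)

text \<open>
  The lowest term of \<open>x\<^sup>2(1 + z) + y\<^sup>3\<close> is \<open>x\<^sup>2\<close>, and the line \<open>x = 0\<close> meets the curve in \<open>y\<^sup>3 = 0\<close>.
  A linear form that divides \<open>x\<^sup>2\<close> can vanish only where \<open>x\<close> does.
\<close>

lemma cusp_cuspidal: "cusp (vx^2 * vz + vy^3 :: 'k ternary) (vector [0, 0, 1])"
proof -
  let ?g = "vx^2 * vz + vy^3 :: 'k ternary" and ?z = "vector [0, 0, 1] :: 'k^3"
  have taylor: "taylor ?z ?g = vx^2 + (vx^2 * vz + vy^3)" by (simp add: algebra_simps)
  have "vx^2 \<noteq> (0 :: 'k ternary)" using linear_form_Var[of 1] unfolding linear_form_def by simp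
  moreover have "form (Suc 2) ?g" using form_cubic[of "mat3 0 0 1 0 1 0 0 0 (0::'k)" 0] unfolding cuspidal_eq_cubic
    by (simp add: numeral_3_eq_3 numeral_2_eq_2)
  ultimately have cone: "point_mult ?g ?z = 2" "tangent_cone ?g ?z = vx^2"
    using tangent_cone_eq[OF taylor form_Var_power] by blast+
  have tangent: "tangent_line ?g ?z l \<longleftrightarrow> (\<exists>c. c \<noteq> 0 \<and> l = Const c * vx)" for l
  proof
    assume "tangent_line ?g ?z l"
    then have l: "linear_form l" "l dvd vx^2" unfolding tangent_line_def cone by auto
    obtain n where n: "n \<noteq> 0" and ln: "l = (\<Sum>i\<in>UNIV. Const (n $ i) * Var i)"
      using linear_form_functional[OF l(1)] .
    obtain h where h: "vx^2 = l * h" using l(2) by (elim dvdE)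
    have zero: "x$1 = 0" if "n$1 * x$1 + n$2 * x$2 + n$3 * x$3 = 0" for x :: "'k^3"
    proof -
      have "eval (vx^2) x = eval l x * eval h x" unfolding h by simp
      then show ?thesis using that by (simp add: ln sum_3)
    qed
    have "n$2 = 0" using zero[of "vector [n$2, n$1, 0]"] by (simp add: mult.commute)
    moreover have "n$3 = 0" using zero[of "vector [n$3, 0, n$1]"] by (simp add: mult.commute)
    ultimately show "\<exists>c. c \<noteq> 0 \<and> l = Const c * vx"
      using n by (intro exI[of _ "n$1"]) (simp add: ln sum_3 vec3_eq_iff)
  next
    assume "\<exists>c. c \<noteq> 0 \<and> l = Const c * vx"
    then obtain c where c: "c \<noteq> 0" "l = Const c * vx" by blast
    have "l * (Const (1 / c) * vx) = Const (c * (1 / c)) * vx^2"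
      unfolding c(2) Const_mult by (simp add: power2_eq_square ac_simps)
    then have "vx^2 = l * (Const (1 / c) * vx)" using c(1) by simp
    then have "l dvd vx^2" by (metis dvd_triv_left)
    moreover have "linear_form l"
    proof -
      have "vector [c, 0, 0] \<noteq> (0::'k^3)" using c(1) by (simp add: vec3_eq_iff)
      then have "linear_form (\<Sum>i\<in>UNIV. Const (vector [c, 0, 0] $ i) * Var i :: 'k ternary)"
        by (rule linear_formI)
      then show ?thesis unfolding c(2) by (simp add: sum_3)
    qed
    ultimately show "tangent_line ?g ?z l" unfolding tangent_line_def cone by blast
  qed
  have "indep2 ?z (vector [0, 1, 0])" by (simp add: indep2_def vec3_eq_iff)
  then have "line_mult ?g vx (proj_pt ?z) = 3"
    unfolding cuspidal_eq_cubic using line_mult_cubic[OF linear_form_Var[of 1], of ?z "vector [0, 1, 0]"]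
    by (simp add: polar_def gram_def sum_3 lowest_index_def)
  then show ?thesis unfolding cusp_def using cone(1) tangent by blast
qed

lemma smooth_conic: "smooth (vx * vz + vy^2 :: 'k ternary)"
proof -
  have "v = 0" if "eval (vx * vz + vy^2) v = 0" "\<forall>i. eval (partial i (vx * vz + vy^2)) v = 0" for v :: "'k^3"
    using that unfolding forall_3 by (simp add: power2_eq_square vec3_eq_iff)
  then show ?thesis unfolding smooth_def singular_points_def by blast
qed

lemma conic_and_tangent:
  defines "q \<equiv> vx * vz + vy^2 :: 'k ternary"
  shows "form 2 q" "curve (q * vx) = curve q \<union> curve vx"
    "curve q \<inter> curve vx = {proj_pt (vector [0, 0, 1])}"
    "tangent_line q (vector [0, 0, 1]) vx"
proof -
  show form_q: "form 2 q"
    unfolding q_def using form_mult[OF form_Var form_Var, of 1 3] form_Var_power[of 2 2]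
    by (intro form_add) (simp_all add: numeral_2_eq_2)
  show "curve (q * vx) = curve q \<union> curve vx" unfolding curve_def by auto
  show "curve q \<inter> curve vx = {proj_pt (vector [0, 0, 1])}"
  proof (intro equalityI subsetI)
    fix P assume "P \<in> curve q \<inter> curve vx"
    then obtain v where v: "P = proj_pt v" "v \<noteq> 0" "eval q v = 0" and "P \<in> curve vx"
      unfolding curve_def by blast
    then have "v$1 = 0" using curve_linear_form[OF linear_form_Var v(2), of 1] by simp
    moreover from this have "v$2 = 0" using v(3) by (simp add: q_def)
    ultimately show "P \<in> {proj_pt (vector [0, 0, 1])}" using proj_pt_z v by simp
  next
    fix P :: "('k^3) set" assume P: "P \<in> {proj_pt (vector [0, 0, 1])}"
    have "eval q (vector [0, 0, 1]) = 0" "eval (vx :: 'k ternary) (vector [0, 0, 1]) = 0"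
      by (simp_all add: q_def)
    then show "P \<in> curve q \<inter> curve vx" unfolding curve_def using P vec_z_nonzero by blast
  qed
  have "taylor (vector [0, 0, 1]) q = vx + q" by (simp add: q_def algebra_simps)
  then have "tangent_cone q (vector [0, 0, 1]) = vx"
    using tangent_cone_eq(2)[OF _ form_Var, of "vector [0,0,1]" q 1 q] form_q linear_form_Var[of 1]
    unfolding linear_form_def by (simp add: numeral_2_eq_2)
  then show "tangent_line q (vector [0, 0, 1]) vx"
    unfolding tangent_line_def using linear_form_Var by simp
qed

end

theorem theorem4p2:
  assumes "CHAR('k::alg_closed_field) = 2"
  shows
    "(\<forall>f :: 'k ternary. form 3 f \<and> nondegenerate f \<and> \<not> F_pure TYPE('m) f \<longrightarrow>
        proj_equiv f (vx^3 + vy^3 + vz^3) \<or>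
        proj_equiv f (vx^2 * vz + vy^3) \<or>
        proj_equiv f (vx^2 * vz + vx * vy^2))
   \<and> (let g = vx^3 + vy^3 + vz^3 :: 'k ternary in
        form 3 g \<and> smooth g \<and> \<not> F_pure TYPE('k ternary set set) g \<and>
        (\<forall>f :: 'k ternary. form 3 f \<and> smooth f \<and> \<not> F_pure TYPE('m) f \<longrightarrow> proj_equiv f g) \<and>
        (\<forall>(f :: 'k ternary) e. elliptic_curve f e \<and> supersingular f e \<longrightarrow> proj_equiv f g))
   \<and> (let g = vx^2 * vz + vy^3 :: 'k ternary in
        form 3 g \<and> Factorial_Ring.irreducible g \<and>
        singular_points g = {proj_pt (vector [0, 0, 1])} \<and>
        cusp g (vector [0, 0, 1]))
   \<and> (let g = vx^2 * vz + vx * vy^2 :: 'k ternary in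
        \<exists>q l. form 2 q \<and> smooth q \<and> linear_form l \<and> g = q * l \<and>
              curve g = curve q \<union> curve l \<and>
              curve q \<inter> curve l = {proj_pt (vector [0, 0, 1])} \<and>
              tangent_line q (vector [0, 0, 1]) l)"
proof -
  interpret alg_closed_char_2 "TYPE('k)" by unfold_locales (rule assms)
  have not_F_pure: "\<exists>A. f = cubic A 0" if "form 3 f" "\<not> F_pure TYPE('m) f" for f :: "'k ternary"
    using form_3_eq_cubic[OF that(1)] that(2) F_pure_cubic by metis
  have 1: "proj_equiv f (vx^3 + vy^3 + vz^3) \<or> proj_equiv f (vx^2 * vz + vy^3) \<or>
      proj_equiv f (vx^2 * vz + vx * vy^2)"
    if f: "form 3 f" "nondegenerate f" "\<not> F_pure TYPE('m) f" for f :: "'k ternary"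
  proof -
    obtain A where A: "f = cubic A 0" using not_F_pure f by blast
    have "radical_free A" using nondegenerate_imp_radical_free f(2) A by blast
    then show ?thesis
      unfolding A fermat_eq_cubic cuspidal_eq_cubic conic_tangent_eq_cubic
      using radical_free_classification congr_imp_proj_equiv by metis
  qed
  have 2: "proj_equiv f (vx^3 + vy^3 + vz^3)"
    if f: "form 3 f" "smooth f" "\<not> F_pure TYPE('m) f" for f :: "'k ternary"
    using not_F_pure[OF f(1,3)] smooth_no_mixed_term_fermat f(2) by blast
  have 3: "proj_equiv f (vx^3 + vy^3 + vz^3)"
    if f: "elliptic_curve f e" "supersingular f e" for f :: "'k ternary" and e
  proof -
    obtain A c where A: "f = cubic A c" using form_3_eq_cubic f(1) unfolding elliptic_curve_def by blast
    have smooth: "smooth (cubic A c)" and e: "e \<in> curve (cubic A c)"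
      using f(1) unfolding elliptic_curve_def A by auto
    have "c = 0"
    proof (rule ccontr)
      assume "c \<noteq> 0"
      then obtain P where "P \<in> curve (cubic A c)" "P \<noteq> e" "ell_mult (cubic A c) e 2 P = e"
        using ell_2_torsion[OF smooth _ e] by blast
      then show False using f(2) unfolding supersingular_def assms A by blast
    qed
    then show ?thesis using smooth_no_mixed_term_fermat smooth A by simp
  qed
  have 4: "form 3 (vx^3 + vy^3 + vz^3 :: 'k ternary)" "form 3 (vx^2 * vz + vy^3 :: 'k ternary)"
    unfolding fermat_eq_cubic cuspidal_eq_cubic by (rule form_cubic)+
  have 5: "vx^2 * vz + vx * vy^2 = (vx * vz + vy^2) * (vx :: 'k ternary)"
    by (simp add: algebra_simps power2_eq_square)
  show ?thesis
    unfolding Let_def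
  proof (intro conjI allI impI; (elim conjE)?)
    show "\<exists>q l. form 2 q \<and> smooth q \<and> linear_form l \<and> vx^2 * vz + vx * vy^2 = q * l \<and>
        curve (vx^2 * vz + vx * vy^2 :: 'k ternary) = curve q \<union> curve l \<and>
        curve q \<inter> curve l = {proj_pt (vector [0, 0, 1])} \<and> tangent_line q (vector [0, 0, 1]) l"
      unfolding 5 using conic_and_tangent smooth_conic linear_form_Var by blast
  qed (fact 1 2 3 4 smooth_fermat fermat_not_F_pure irreducible_cuspidal
      singular_points_cuspidal cusp_cuspidal)+
qed

end
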